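(* Let $n\ge 1$ be an integer. For every unit vector $\mathbf a=(a_1,\dots,a_{n+1})\in\mathbb R^{n+1}$ with $\sum_{j=1}^{n+1}a_j=0$, we have $$V(\mathbf a)\;\ge\; V_{\min}:=\frac{\sqrt{n+1}}{(n-1)!}\Big(\frac{n}{n+1}\Big)^{n-\frac12},$$ where $V(\mathbf a)=\mathrm{Vol}_{n-1}(\Delta_n\cap\mathbf a^\perp)$. Equality holds if and only if $\mathbf a$ is obtained, up to permutation of coordinates and multiplication by $-1$, from the vector $$\mathbf a_{\min}:=\Big(\sqrt{\tfrac{n}{n+1}},\,-\tfrac{1}{\sqrt{n(n+1)}},\,\ldots,\,-\tfrac{1}{\sqrt{n(n+1)}}\Big)\in\mathbb R^{n+1}.$$
   Context: $\Delta_n$ is the standard regular simplex, i.e. the convex hull of the standard basis vectors $\mathbf e_1,\dots,\mathbf e_{n+1}$ of $\mathbb R^{n+1}$. For a unit vector $\mathbf a\in\mathbb R^{n+1}$ with coordinate sum zero, $\mathbf a^\perp$ is the linear hyperplane orthogonal to $\mathbf a$; it passes through the centroid of $\Delta_n$. $\mathrm{Vol}_{n-1}$ denotes $(n-1)$-dimensional volume (Hausdorff measure normalised to agree with Lebesgue measure on $(n-1)$-dimensional affine subspaces; counting measure if $n=1$). *)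

theory Defs
  imports "HOL-Analysis.Analysis"
begin

text \<open>
  The \<open>d\<close>-dimensional Hausdorff measure, with the gauge \<open>diameter U ^ d\<close>, as a set function
  on all subsets of a metric space. Covers consist of bounded sets because \<^const>\<open>diameter\<close>
  is unspecified on unbounded ones. The empty set has weight \<open>0\<close> also for \<open>d = 0\<close> (where
  \<open>0 ^ 0 = 1\<close>), so that the case \<open>d = 0\<close> is counting measure.
\<close>

definition hausdorff_weight :: "nat \<Rightarrow> 'a::metric_space set \<Rightarrow> ennreal" where
  "hausdorff_weight d U = (if U = {} then 0 else ennreal (diameter U ^ d))"

definition hausdorff_premeasure :: "nat \<Rightarrow> real \<Rightarrow> 'a::metric_space set \<Rightarrow> ennreal" where
  "hausdorff_premeasure d \<delta> S =
     (INF U \<in> {U :: nat \<Rightarrow> 'a set. S \<subseteq> (\<Union>i. U i) \<and> (\<forall>i. bounded (U i) \<and> diameter (U i) \<le> \<delta>)}.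
        \<Sum>i. hausdorff_weight d (U i))"

definition hausdorff_measure :: "nat \<Rightarrow> 'a::metric_space set \<Rightarrow> ennreal" where
  "hausdorff_measure d S = (SUP \<delta> \<in> {0<..}. hausdorff_premeasure d \<delta> S)"

text \<open>
  \<open>cbox 0 (\<Sum>D)\<close> is the \<open>d\<close>-dimensional unit cube spanned by the basis vectors in \<open>D\<close>.
  It is only used for \<open>d \<le> DIM('a)\<close>; all choices of \<open>D\<close> give isometric cubes.
\<close>

definition unit_cube :: "nat \<Rightarrow> 'a::euclidean_space set" where
  "unit_cube d = cbox 0 (\<Sum>(SOME D. D \<subseteq> Basis \<and> card D = d))"

text \<open>
  The Hausdorff measure scaled so that the \<open>d\<close>-dimensional unit cube has volume \<open>1\<close>. This is
  the scaling for which it agrees with Lebesgue measure on \<open>d\<close>-dimensional affine subspaces.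
\<close>

definition Vol :: "nat \<Rightarrow> 'a::euclidean_space set \<Rightarrow> real" where
  "Vol d S = enn2real (hausdorff_measure d S / hausdorff_measure d (unit_cube d :: 'a set))"

text \<open>
  The dimension \<open>n + 1\<close> of the ambient space is \<open>CARD('m)\<close>.
\<close>

definition std_simplex :: "(real ^ 'm) set" where
  "std_simplex = convex hull (range (\<lambda>i. axis i 1))"

definition V :: "real ^ 'm \<Rightarrow> real" where
  "V a = Vol (CARD('m) - 2) (std_simplex \<inter> {x. a \<bullet> x = 0})"

definition V_min :: "nat \<Rightarrow> real" where
  "V_min n = sqrt (real n + 1) / fact (n - 1) * (real n / (real n + 1)) powr (real n - 1 / 2)"

text \<open>
  The index type \<open>'m\<close> carries no order, so the index \<open>k\<close> of the coordinate listed first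
  is a parameter.
\<close>

definition a_min :: "nat \<Rightarrow> 'm \<Rightarrow> real ^ 'm" where
  "a_min n k = (\<chi> i. if i = k then sqrt (real n / (real n + 1))
                      else - 1 / sqrt (real n * (real n + 1)))"

end

theory Submission
  imports Defs "HOL-Complex_Analysis.Complex_Analysis"
    "HOL-Probability.Probability" "HOL-Real_Asymp.Real_Asymp"
begin

unbundle no Formal_Power_Series.fps_syntax

text \<open>
  Put \<open>N = n + 1\<close> and let \<open>E\<^sub>j\<close> be independent standard exponential variables. The density at \<open>0\<close>
  of \<open>\<Sum>j. a\<^sub>j E\<^sub>j\<close> is \<open>(n - 1)! / sqrt N\<close> times the volume \<open>V a\<close>, and by Fourier inversion it is
  \<open>1 / \<pi>\<close> times the integral of \<open>Re (1 / P (\<i> t))\<close> over \<open>t > 0\<close>, where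
  \<open>P z = \<Prod>j. 1 - a\<^sub>j z\<close>.

  Deform the contour to the curve \<open>z = x + \<i> y\<close> on which \<open>P\<close> is real and positive. Then
  the integral becomes \<open>\<integral> exp (- u) dy\<close> with \<open>u = ln P\<close>, and it suffices to
  bound \<open>u\<close> from above at every height \<open>y\<close>. Let \<open>D = 1 / (ln P)' - z / N\<close>. Two inequalities for
  \<open>D\<close>, both equalities for the extremal vector, follow from the sharp bound for the quadratic form
  \<open>\<Sum>j. a\<^sub>j x\<^sub>j\<^sup>2\<close> on vectors with coordinate sum \<open>0\<close>. With respect to the parameter
  \<open>s = y exp (- u / N)\<close> they turn into differential inequalities for \<open>u\<close> and \<open>v = x / y\<close>
  whose right-hand sides increase in both unknowns, so \<open>u\<close> and \<open>\<bar>v\<bar>\<close> are dominated by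
  their values for the extremal vector. If equality holds, then the two curves agree up to reflection,
  so the two polynomials \<open>P\<close> agree at infinitely many points up to \<open>a \<mapsto> - a\<close>,
  and have the same roots.

  That the Hausdorff measure of a section is a Lebesgue measure is shown by covering the section, thickened by
  the unit cube in the orthogonal coordinate directions, and averaging over these directions; isometry
  invariance of Lebesgue measure is the case without further directions.
\<close>

section \<open>The drift along the level curve\<close>

text \<open>On the imaginary axis \<open>Re (1 / P)\<close> may change sign, which defeats a
  pointwise comparison; on the level curve the integrand is positive and a local bound makes sense.
  The obstacle is that an inequality for du/dy alone does not close: it involves |z|, hence x, and x
  is driven by the real part of D. So two unknowns are compared at once, and one-sided comparison of
  systems needs right-hand sides that increase in the unknowns. The parameter s achieves this: y = s
  exp (u / N) turns each occurrence of y into an increasing function of u.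

  Origin of the bounds: with w = 1 / z one has D = - 1 / g, where g = <a, (w - M)^-1 a> and M is the
  compression of the diagonal matrix of a to the vectors of coordinate sum 0. The extremal vector is
  an eigenvector of its own M, with eigenvalue beta = (n - 1) / sqrt (n (n + 1)), whence D = beta -
  1 / z. In general M has its spectrum in [- beta, beta], which gives one inequality; Cauchy-Schwarz
  for g gives the other.\<close>

lemma zero_sum_quadratic_form_bound:
  fixes a x :: "'i \<Rightarrow> real"
  assumes fin: "finite I" and card: "card I = n + 1" and n: "n \<ge> 1"
    and a0: "(\<Sum>i\<in>I. a i) = 0" and a1: "(\<Sum>i\<in>I. (a i)\<^sup>2) = 1"
    and x0: "(\<Sum>i\<in>I. x i) = 0"
  shows "\<bar>\<Sum>i\<in>I. a i * (x i)\<^sup>2\<bar> \<le> (real n - 1) / sqrt (real n * (real n + 1)) * (\<Sum>i\<in>I. (x i)\<^sup>2)"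
proof -
  define N where "N = real n + 1"
  define s where "s = (\<Sum>i\<in>I. (x i)\<^sup>2)"
  have cardN: "real (card I) = N" using card by (simp add: N_def)
  have N: "N > 0" and n0: "real n > 0" using n by (auto simp: N_def)
  \<comment> \<open>The diagonal matrix of a compressed to the zero-sum vectors; the term (sum of a)
    / N^2 of the compression vanishes. Its trace is 0.\<close>
  define M where "M i j = (if i = j then a i else 0) - (a i + a j) / N" for i j
  \<comment> \<open>x x^T minus the multiple of the projection onto the zero-sum vectors that makes
    the trace 0. As \<open>M\<close> has trace 0, the pairing with \<open>M\<close> does not change,
    while the squared norm drops from s^2 to s^2 (n - 1) / n; this makes Cauchy-Schwarz
    sharp.\<close>
  define Q where "Q i j = x i * x j - ((if i = j then 1 else 0) - 1 / N) * (s / n)" for i j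
  let ?S = "\<lambda>f. (\<Sum>i\<in>I. \<Sum>j\<in>I. f i j)"
  have delta: "(\<Sum>j\<in>I. (if i = j then f j else 0)) = f i" if "i \<in> I" for i and f :: "'i \<Rightarrow> real"
    using that fin by (simp add: sum.delta)
  have rowM: "(\<Sum>j\<in>I. M i j) = 0" if "i \<in> I" for i
    using that N delta[OF that, of "\<lambda>_. a i"]
    by (simp add: M_def sum_subtractf sum.distrib a0 cardN flip: sum_divide_distrib)
  have traceM: "(\<Sum>i\<in>I. M i i) = 0"
    by (simp add: M_def sum_subtractf a0 flip: sum_divide_distrib sum_distrib_left)
  have MM: "(\<Sum>j\<in>I. M i j * M i j) = (a i)\<^sup>2 - 4 * (a i)\<^sup>2 / N + (a i)\<^sup>2 / N + 1 / N\<^sup>2" if i: "i \<in> I" for i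
  proof -
    have "M i j * M i j = (if i = j then (a i)\<^sup>2 - 4 * (a i)\<^sup>2 / N else 0) + ((a i)\<^sup>2 + 2 * a i * a j + (a j)\<^sup>2) / N\<^sup>2" for j
      using N by (auto simp: M_def power2_eq_square field_simps)
    then have "(\<Sum>j\<in>I. M i j * M i j) = (a i)\<^sup>2 - 4 * (a i)\<^sup>2 / N + (N * (a i)\<^sup>2 + 2 * a i * (\<Sum>j\<in>I. a j) + (\<Sum>j\<in>I. (a j)\<^sup>2)) / N\<^sup>2"
      using delta[OF i, of "\<lambda>_. (a i)\<^sup>2 - 4 * (a i)\<^sup>2 / N"]
      by (simp add: sum.distrib cardN flip: sum_divide_distrib sum_distrib_left)
    moreover have "(N * (a i)\<^sup>2 + 2 * a i * 0 + 1) / N\<^sup>2 = (a i)\<^sup>2 / N + 1 / N\<^sup>2"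
      using N by (simp add: add_divide_distrib power2_eq_square)
    ultimately show ?thesis unfolding a0 a1 by simp
  qed
  have "?S (\<lambda>i j. M i j * M i j) = (\<Sum>i\<in>I. (a i)\<^sup>2 - 4 * (a i)\<^sup>2 / N + (a i)\<^sup>2 / N + 1 / N\<^sup>2)"
    by (intro sum.cong refl MM)
  also have "\<dots> = 1 - 4 / N + 1 / N + N * (1 / N\<^sup>2)"
    by (simp add: sum.distrib sum_subtractf a1 cardN flip: sum_divide_distrib sum_distrib_left)
  also have "N * (1 / N\<^sup>2) = 1 / N" by (simp add: power2_eq_square)
  also have "1 - 4 / N + 1 / N + 1 / N = (real n - 1) / N" using N by (simp add: N_def field_simps)
  finally have MMs: "?S (\<lambda>i j. M i j * M i j) = (real n - 1) / N" .
  have QQ: "(\<Sum>j\<in>I. Q i j * Q i j) = (x i)\<^sup>2 * s - 2 * (s / n) * (x i)\<^sup>2 + (1 - 1 / N) * (s / n)\<^sup>2" if i: "i \<in> I" for i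
  proof -
    have "Q i j * Q i j = (if i = j then (1 - 2 / N) * (s / n)\<^sup>2 - 2 * (s / n) * (x i)\<^sup>2 else 0)
        + ((x i)\<^sup>2 * (x j)\<^sup>2 + 2 * (s / n) * x i * x j / N + (s / n)\<^sup>2 / N\<^sup>2)" for j
      using n0 N by (auto simp: Q_def power2_eq_square field_simps)
    then have "(\<Sum>j\<in>I. Q i j * Q i j) = (1 - 2 / N) * (s / n)\<^sup>2 - 2 * (s / n) * (x i)\<^sup>2
         + ((x i)\<^sup>2 * (\<Sum>j\<in>I. (x j)\<^sup>2) + 2 * (s / n) * x i * (\<Sum>j\<in>I. x j) / N + N * ((s / n)\<^sup>2 / N\<^sup>2))"
      using delta[OF i, of "\<lambda>_. (1 - 2 / N) * (s / n)\<^sup>2 - 2 * (s / n) * (x i)\<^sup>2"]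
      by (simp add: sum.distrib cardN flip: sum_divide_distrib sum_distrib_left)
    moreover have "N * ((s / n)\<^sup>2 / N\<^sup>2) = (s / n)\<^sup>2 / N" using N by (simp add: power2_eq_square)
    ultimately show ?thesis by (simp add: x0 s_def[symmetric] algebra_simps)
  qed
  have "?S (\<lambda>i j. Q i j * Q i j) = (\<Sum>i\<in>I. (x i)\<^sup>2 * s - 2 * (s / n) * (x i)\<^sup>2 + (1 - 1 / N) * (s / n)\<^sup>2)"
    by (intro sum.cong refl QQ)
  also have "\<dots> = s * s - 2 * (s / n) * s + N * ((1 - 1 / N) * (s / n)\<^sup>2)"
    by (simp add: sum.distrib sum_subtractf cardN s_def[symmetric] flip: sum_divide_distrib sum_distrib_left sum_distrib_right)
  also have "N * ((1 - 1 / N) * (s / n)\<^sup>2) = (N - 1) * (s / n)\<^sup>2"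
    using N by (simp add: left_diff_distrib right_diff_distrib)
  also have "(N - 1) = n" by (simp add: N_def)
  also have "s * s - 2 * (s / n) * s + n * (s / n)\<^sup>2 = s\<^sup>2 * ((real n - 1) / n)"
    using n0 by (simp add: power2_eq_square field_simps)
  finally have QQs: "?S (\<lambda>i j. Q i j * Q i j) = s\<^sup>2 * ((real n - 1) / n)" .
  have MQ: "(\<Sum>j\<in>I. M i j * Q i j) = a i * (x i)\<^sup>2 - (x i / N) * (\<Sum>j\<in>I. a j * x j) - M i i * (s / n)" if i: "i \<in> I" for i
  proof -
    have "M i j * Q i j = (if i = j then a i * (x i)\<^sup>2 - M i i * (s / n) else 0)
        - (x i * a i * x j / N + x i / N * (a j * x j)) + M i j * (s / n / N)" for j
      by (auto simp: M_def Q_def power2_eq_square algebra_simps add_divide_distrib)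
    then have "(\<Sum>j\<in>I. M i j * Q i j) = (a i * (x i)\<^sup>2 - M i i * (s / n))
        - (x i * a i * (\<Sum>j\<in>I. x j) / N + x i / N * (\<Sum>j\<in>I. a j * x j)) + (\<Sum>j\<in>I. M i j) * (s / n / N)"
      using delta[OF i, of "\<lambda>_. a i * (x i)\<^sup>2 - M i i * (s / n)"]
      by (simp add: sum.distrib sum_subtractf flip: sum_divide_distrib sum_distrib_left sum_distrib_right)
    then show ?thesis by (simp add: x0 rowM[OF i])
  qed
  have "?S (\<lambda>i j. M i j * Q i j) = (\<Sum>i\<in>I. a i * (x i)\<^sup>2 - (x i / N) * (\<Sum>j\<in>I. a j * x j) - M i i * (s / n))"
    by (intro sum.cong refl MQ)
  also have "\<dots> = (\<Sum>i\<in>I. a i * (x i)\<^sup>2) - (\<Sum>i\<in>I. x i) / N * (\<Sum>j\<in>I. a j * x j) - (\<Sum>i\<in>I. M i i) * (s / n)"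
    by (simp add: sum_subtractf sum_distrib_right sum_divide_distrib)
  finally have MQs: "?S (\<lambda>i j. M i j * Q i j) = (\<Sum>i\<in>I. a i * (x i)\<^sup>2)" by (simp add: x0 traceM)
  have CS: "(?S (\<lambda>i j. M i j * Q i j))\<^sup>2 \<le> ?S (\<lambda>i j. M i j * M i j) * ?S (\<lambda>i j. Q i j * Q i j)"
    using Cauchy_Schwarz_ineq_sum[of "\<lambda>(i,j). M i j" "\<lambda>(i,j). Q i j" "I \<times> I"]
    by (simp add: sum.cartesian_product split_def power2_eq_square)
  have "(\<Sum>i\<in>I. a i * (x i)\<^sup>2)\<^sup>2 \<le> ((real n - 1) / N) * (s\<^sup>2 * ((real n - 1) / n))"
    using CS unfolding MQs MMs QQs .
  also have "\<dots> = ((real n - 1) / sqrt (real n * N) * s)\<^sup>2"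
    using n0 N by (simp add: power_mult_distrib power_divide) (simp add: power2_eq_square mult_ac)
  finally have "\<bar>\<Sum>i\<in>I. a i * (x i)\<^sup>2\<bar> \<le> \<bar>(real n - 1) / sqrt (real n * N) * s\<bar>"
    by (simp only: abs_le_square_iff)
  moreover have "(real n - 1) / sqrt (real n * N) * s \<ge> 0"
    using n N by (intro mult_nonneg_nonneg divide_nonneg_nonneg) (auto simp: s_def intro!: sum_nonneg)
  ultimately show ?thesis by (simp add: s_def N_def)
qed

locale centred_unit =
  fixes a :: "'m::finite \<Rightarrow> real" and n :: nat
  assumes card: "CARD('m) = n + 1" and n: "n \<ge> 1"
    and sum0: "(\<Sum>j\<in>UNIV. a j) = 0" and sum1: "(\<Sum>j\<in>UNIV. (a j)\<^sup>2) = 1"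
begin

definition logd :: "complex \<Rightarrow> complex" where
  "logd z = (\<Sum>j\<in>UNIV. of_real (a j) / (1 - of_real (a j) * z))"

text \<open>As \<open>logd\<close> is - P' / P, \<open>- 1 / logd z\<close> is dz/du on the level
  curve. If all a_j are nonzero, P has degree n + 1 and this grows like z / (n + 1) at infinity;
  \<open>drift\<close> is what remains without the linear growth.\<close>

definition drift :: "complex \<Rightarrow> complex" where
  "drift z = - 1 / logd z - z / (real n + 1)"

lemma one_minus_nz:
  assumes "Im z > 0" shows "1 - of_real c * z \<noteq> 0"
proof
  assume *: "1 - complex_of_real c * z = 0"
  then have "Im (1 - complex_of_real c * z) = 0" "Re (1 - complex_of_real c * z) = 0" by simp_all
  then have "c = 0" using assms by simp
  then show False using * by simp
qed

text \<open>\<open>drift z\<close> is - 1 / g for the resolvent entry g = <a, (w - M)^-1 a> with w =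
  1 / z. Everything follows from cnj g = w Y - Q, where Y is the squared norm of the resolvent
  vector and Q the form with coefficients a_j at that vector: |g|^2 <= Y bounds
  \<open>Im (drift z)\<close> from below, and |Q| <= beta Y bounds the real part. The factor c
  stands for the two signs.\<close>

lemma drift_facts:
  assumes z: "Im z > 0"
  shows Im_logd_pos: "Im (logd z) > 0"
    and "Im (drift z) \<ge> Im z / (cmod z)\<^sup>2"
    and "\<bar>c\<bar> = 1 \<Longrightarrow> c * (Im z * Re (drift z)) \<le> ((real n - 1) / sqrt (real n * (real n + 1)) * (cmod z)\<^sup>2 - c * Re z) * Im (drift z)"
proof -
  define w where "w = 1 / z"
  have z0: "z \<noteq> 0" using z by auto
  define N where "N = real n + 1"
  have N: "N > 0" by (simp add: N_def)
  define t where "t j = 1 / (w - of_real (a j))" for j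
  have wz: "w - of_real (a j) = (1 - of_real (a j) * z) / z" for j
    using z0 by (simp add: w_def field_simps)
  have wa: "w - of_real (a j) \<noteq> 0" for j
    using z0 one_minus_nz[OF z, of "a j"] by (simp add: wz)
  have Imw: "Im w = - Im z / (cmod z)\<^sup>2" by (simp add: w_def Im_divide cmod_power2)
  have Rew: "Re w = Re z / (cmod z)\<^sup>2" by (simp add: w_def Re_divide cmod_power2)
  have q: "Im w < 0" using z z0 by (simp add: Imw)
  have Imt: "Im (t j) > 0" for j
  proof -
    have "Im (t j) = - Im w / (cmod (w - of_real (a j)))\<^sup>2"
      by (simp add: t_def Im_divide cmod_power2[symmetric]) (simp add: cmod_power2)
    then show ?thesis using q wa[of j] by (simp add: divide_neg_pos)
  qed
  define T where "T = (\<Sum>j\<in>UNIV. t j)"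
  define S where "S = (\<Sum>j\<in>UNIV. of_real (a j) * t j)"
  \<comment> \<open>Coordinate sum 0 absorbs the constant term of each fraction. The weights a_j^2
    that remain are nonnegative, so the sign of \<open>Im (logd z)\<close> can be read off.\<close>
  have logd: "logd z = (\<Sum>j\<in>UNIV. of_real ((a j)\<^sup>2) * t j)"
  proof -
    have "of_real (a j) / (1 - of_real (a j) * z) = of_real ((a j)\<^sup>2) * t j + of_real (a j)" for j
      using z0 one_minus_nz[OF z, of "a j"] by (simp add: t_def wz field_simps power2_eq_square)
    then show ?thesis
      unfolding logd_def by (simp add: sum.distrib sum0 flip: of_real_sum)
  qed
  have a_nz: "\<exists>j. a j \<noteq> 0" using sum1 by (metis (mono_tags, lifting) power_zero_numeral sum.neutral zero_neq_one)
  show Imlog: "Im (logd z) > 0"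
    unfolding logd Im_sum
  proof -
    obtain j where j: "a j \<noteq> 0" using a_nz by auto
    have "0 < Im (of_real ((a j)\<^sup>2) * t j)" using Imt[of j] j by simp
    then show "0 < (\<Sum>x\<in>UNIV. Im (complex_of_real ((a x)\<^sup>2) * t x))"
      by (intro sum_pos2[where i = j]) (auto intro!: mult_nonneg_nonneg less_imp_le[OF Imt])
  qed
  have T0: "T \<noteq> 0"
  proof -
    have "Im T > 0" unfolding T_def Im_sum by (intro sum_pos) (auto simp: Imt)
    then show ?thesis by auto
  qed
  have at: "of_real (a j) * t j = w * t j - 1" for j
    using wa[of j] by (simp add: t_def field_simps)
  have sw: "logd z = w * S"
  proof -
    have "of_real ((a j)\<^sup>2) * t j = w * (of_real (a j) * t j) - of_real (a j)" for j
    proof -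
      have "of_real ((a j)\<^sup>2) * t j = of_real (a j) * (of_real (a j) * t j)" by (simp add: power2_eq_square)
      also have "\<dots> = of_real (a j) * (w * t j - 1)" by (subst at) simp
      finally show ?thesis by (simp add: algebra_simps)
    qed
    then show ?thesis
      unfolding logd S_def by (simp add: sum_subtractf sum0 flip: of_real_sum sum_distrib_left)
  qed
  have S0: "S \<noteq> 0" using Imlog sw by auto
  have wT: "S = w * T - of_real N"
    unfolding S_def T_def at by (simp add: sum_subtractf card N_def sum_distrib_left)
  \<comment> \<open>The factor N / T makes the coordinates sum to 0. Then (w - a_j) y_j is a_j plus
    a constant, which is the resolvent equation for the compression of diag a.\<close>
  define y where "y j = of_real N * t j / T - 1" for j
  have y0: "(\<Sum>j\<in>UNIV. y j) = 0"
    using T0 by (simp add: y_def sum_subtractf card N_def T_def[symmetric] flip: sum_divide_distrib sum_distrib_left)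
  define g where "g = (\<Sum>j\<in>UNIV. of_real (a j) * y j)"
  have gST: "g = of_real N * S / T"
  proof -
    have "of_real (a j) * y j = of_real N * (of_real (a j) * t j) / T - of_real (a j)" for j
      by (simp add: y_def algebra_simps)
    then show ?thesis
      unfolding g_def S_def by (simp add: sum_subtractf sum0 flip: of_real_sum sum_divide_distrib sum_distrib_left)
  qed
  have g0: "g \<noteq> 0" using gST S0 T0 N by simp
  have D: "drift z = - 1 / g"
  proof -
    have zw: "z * w = 1" using z0 by (simp add: w_def)
    have "z * S + z * of_real N = z * w * T" by (simp add: wT algebra_simps)
    then have T: "z * S + z * of_real N = T" by (simp add: zw)
    have "drift z = - z / S - z / of_real N"
      unfolding drift_def sw using z0 S0 by (simp add: w_def N_def)
    also have "\<dots> = - (z * S + z * of_real N) / (of_real N * S)"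
      using S0 N by (simp add: field_simps)
    also have "\<dots> = - 1 / g" unfolding T gST by simp
    finally show ?thesis .
  qed
  define Y where "Y = (\<Sum>j\<in>UNIV. (cmod (y j))\<^sup>2)"
  define Q where "Q = (\<Sum>j\<in>UNIV. a j * (cmod (y j))\<^sup>2)"
  \<comment> \<open>Pairing the resolvent equation with the conjugate of \<open>y\<close> removes
    the constant, because \<open>y\<close> sums to 0.\<close>
  have cg: "cnj g = w * of_real Y - of_real Q"
  proof -
    have "cnj (y j) * ((w - of_real (a j)) * y j) = cnj (y j) * ((of_real N / T - w) + of_real (a j))" for j
    proof -
      have "(w - of_real (a j)) * t j = 1" using wa[of j] by (simp add: t_def)
      then have "(w - of_real (a j)) * (of_real N * t j / T) = of_real N / T"
        by (metis mult.left_commute mult.right_neutral times_divide_eq_right)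
      then have "(w - of_real (a j)) * y j = of_real N / T - w + of_real (a j)"
        unfolding y_def by (simp only: right_diff_distrib) simp
      then show ?thesis by simp
    qed
    then have "(\<Sum>j\<in>UNIV. cnj (y j) * ((w - of_real (a j)) * y j))
         = (\<Sum>j\<in>UNIV. cnj (y j)) * (of_real N / T - w) + (\<Sum>j\<in>UNIV. of_real (a j) * cnj (y j))"
      by (simp add: distrib_left sum.distrib sum_distrib_left mult.commute)
    also have "(\<Sum>j\<in>UNIV. cnj (y j)) = 0" using y0 by (metis cnj_sum complex_cnj_zero)
    also have "(\<Sum>j\<in>UNIV. of_real (a j) * cnj (y j)) = cnj g" by (simp add: g_def)
    also have "(\<Sum>j\<in>UNIV. cnj (y j) * ((w - of_real (a j)) * y j)) = w * of_real Y - of_real Q"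
    proof -
      have "cnj (y j) * ((w - of_real (a j)) * y j) = w * of_real ((cmod (y j))\<^sup>2) - of_real (a j * (cmod (y j))\<^sup>2)" for j
        using complex_norm_square[of "y j"] by (simp add: algebra_simps)
      then show ?thesis by (simp add: Y_def Q_def sum_subtractf sum_distrib_left)
    qed
    finally show ?thesis by simp
  qed
  have Reg: "Re g = Re w * Y - Q" and Img: "Im g = - Im w * Y"
    using arg_cong[OF cg, of Re] arg_cong[OF cg, of Im] by auto
  have gY: "(cmod g)\<^sup>2 \<le> Y"
  proof -
    have "cmod g \<le> (\<Sum>j\<in>UNIV. \<bar>a j\<bar> * cmod (y j))"
      unfolding g_def by (rule order_trans[OF norm_sum]) (simp add: norm_mult)
    then have "(cmod g)\<^sup>2 \<le> (\<Sum>j\<in>UNIV. \<bar>a j\<bar> * cmod (y j))\<^sup>2" by (intro power_mono) auto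
    also have "\<dots> \<le> (\<Sum>j\<in>UNIV. \<bar>a j\<bar>\<^sup>2) * (\<Sum>j\<in>UNIV. (cmod (y j))\<^sup>2)" by (rule Cauchy_Schwarz_ineq_sum)
    finally show ?thesis by (simp add: sum1 Y_def)
  qed
  have G2: "(cmod g)\<^sup>2 > 0" using g0 by simp
  then have Y0: "Y > 0" using gY by linarith
  define \<beta> where "\<beta> = (real n - 1) / sqrt (real n * (real n + 1))"
  have QY: "\<bar>Q\<bar> \<le> \<beta> * Y"
  proof -
    have c: "card (UNIV :: 'm set) = n + 1" using card by simp
    have r0: "(\<Sum>j\<in>UNIV. Re (y j)) = 0" "(\<Sum>j\<in>UNIV. Im (y j)) = 0" using y0 by (simp_all flip: Re_sum Im_sum)
    note R = zero_sum_quadratic_form_bound[OF finite c n sum0 sum1 r0(1)]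
    note I = zero_sum_quadratic_form_bound[OF finite c n sum0 sum1 r0(2)]
    have "Q = (\<Sum>j\<in>UNIV. a j * (Re (y j))\<^sup>2) + (\<Sum>j\<in>UNIV. a j * (Im (y j))\<^sup>2)"
      by (simp add: Q_def cmod_power2 algebra_simps sum.distrib)
    moreover have "Y = (\<Sum>j\<in>UNIV. (Re (y j))\<^sup>2) + (\<Sum>j\<in>UNIV. (Im (y j))\<^sup>2)"
      by (simp add: Y_def cmod_power2 sum.distrib)
    ultimately show ?thesis using R I unfolding \<beta>_def[symmetric] by (simp add: algebra_simps)
  qed
  have ImD: "Im (drift z) = Im z / (cmod z)\<^sup>2 * (Y / (cmod g)\<^sup>2)"
    by (simp add: D Im_divide cmod_power2[symmetric] Imw[symmetric]) (simp add: Img Imw cmod_power2)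
  have ReD: "Re (drift z) = (Q - Re z / (cmod z)\<^sup>2 * Y) / (cmod g)\<^sup>2"
    by (simp add: D Re_divide cmod_power2[symmetric]) (simp add: Reg Rew minus_divide_left cmod_power2)
  have "1 \<le> Y / (cmod g)\<^sup>2" using gY G2 by simp
  then show "Im z / (cmod z)\<^sup>2 \<le> Im (drift z)"
    unfolding ImD using mult_left_mono[of 1 "Y / (cmod g)\<^sup>2" "Im z / (cmod z)\<^sup>2"] z by simp
  show "c * (Im z * Re (drift z)) \<le> ((real n - 1) / sqrt (real n * (real n + 1)) * (cmod z)\<^sup>2 - c * Re z) * Im (drift z)"
    if c: "\<bar>c\<bar> = 1"
  proof -
    have cQ: "c * Q \<le> \<beta> * Y" using QY c by (auto simp: abs_if split: if_splits)
    have "c * (Im z * Re (drift z)) = Im z * (c * Q - c * (Re z / (cmod z)\<^sup>2) * Y) / (cmod g)\<^sup>2"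
      by (simp add: ReD algebra_simps)
    also have "\<dots> \<le> Im z * (\<beta> * Y - c * (Re z / (cmod z)\<^sup>2) * Y) / (cmod g)\<^sup>2"
      using cQ z G2 by (intro divide_right_mono mult_left_mono) auto
    also have "\<dots> = (\<beta> * (cmod z)\<^sup>2 - c * Re z) * Im (drift z)"
      unfolding ImD using z0 G2 by (simp add: field_simps)
    finally show ?thesis unfolding \<beta>_def .
  qed
qed

text \<open>Let p = n / m and - r = - 1 / m, with m = sqrt (n (n + 1)), be the two coordinate
  values. Since p (p + r) = 1, the partial fractions of \<open>logd\<close> collapse to z / ((1 - p
  z) (1 + r z)). Its negative reciprocal is - 1 / z + (p - r) + p r z, and p r = 1 / (n + 1) is the
  slope that \<open>drift\<close> removes.\<close>

lemma drift_extremal: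
  assumes z: "Im z > 0" and k: "a k = sqrt (real n / (real n + 1))"
    and nk: "\<And>j. j \<noteq> k \<Longrightarrow> a j = - 1 / sqrt (real n * (real n + 1))"
  shows "drift z = of_real ((real n - 1) / sqrt (real n * (real n + 1))) - 1 / z"
proof -
  define N where "N = real n + 1"
  define m where "m = sqrt (real n * N)"
  have n0: "real n > 0" using n by simp
  have N: "N > 0" by (simp add: N_def)
  have m: "m > 0" "m * m = real n * N" using n0 N by (auto simp: m_def)
  have ak: "a k = real n / m"
    using n0 N unfolding k m_def N_def[symmetric]
    by (simp add: real_sqrt_divide real_sqrt_mult field_simps)
  define p r where "p = real n / m" and "r = 1 / m"
  have z0: "z \<noteq> 0" using z by auto
  have fin: "UNIV = insert k (UNIV - {k})" by auto
  have nz: "1 - of_real c * z \<noteq> 0" for c using one_minus_nz[OF z] .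
  have "logd z = of_real (a k) / (1 - of_real (a k) * z) + (\<Sum>j\<in>UNIV - {k}. of_real (- 1 / m) / (1 - of_real (- 1 / m) * z))"
    unfolding logd_def by (subst fin, subst sum.insert) (auto intro!: sum.cong simp: nk m_def N_def)
  also have "(\<Sum>j\<in>UNIV - {k}. of_real (- 1 / m) / (1 - of_real (- 1 / m) * z)) = of_real (real n) * (of_real (- 1 / m) / (1 - of_real (- 1 / m) * z))"
    by (simp add: card_Diff_singleton card)
  finally have 1: "logd z = of_real p / (1 - of_real p * z) - of_real p / (1 + of_real r * z)"
    by (simp add: ak p_def r_def)
  have nz': "1 - of_real p * z \<noteq> 0" "1 + of_real r * z \<noteq> 0"
    using nz[of p] nz[of "- r"] by simp_all
  have "logd z = (of_real (p * (p + r)) * z) / ((1 - of_real p * z) * (1 + of_real r * z))"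
    unfolding 1 using nz' by (simp add: divide_simps) (simp add: algebra_simps)
  also have "p * (p + r) = 1"
    using m N n0 by (simp add: p_def r_def N_def add_divide_distrib[symmetric])
  finally have "logd z = z / ((1 - of_real p * z) * (1 + of_real r * z))" by simp
  then have "- 1 / logd z = - ((1 - of_real p * z) * (1 + of_real r * z)) / z" by simp
  also have "\<dots> = - 1 / z + of_real (p - r) + of_real (p * r) * z"
    using z0 by (simp add: field_simps)
  also have "p * r = 1 / N" using m n0 by (simp add: p_def r_def)
  also have "p - r = (real n - 1) / m" by (simp add: p_def r_def diff_divide_distrib)
  finally have "drift z = of_real ((real n - 1) / m) - 1 / z"
    unfolding drift_def by (simp add: N_def)
  then show ?thesis by (simp add: m_def N_def)
qed

end

section \<open>The level curve of the characteristic function\<close>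

text \<open>The argument lies in [0, pi / 2), where an angle is at most its tangent.\<close>

lemma Im_Ln_le_ratio:
  assumes "Re w > 0" "Im w \<ge> 0"
  shows "Im (Ln w) \<le> Im w / Re w"
proof -
  define \<theta> where "\<theta> = Im (Ln w)"
  have w0: "w \<noteq> 0" using assms by auto
  have \<theta>: "0 \<le> \<theta>" "\<theta> < pi / 2"
    using Im_Ln_pos_le[OF w0] Re_Ln_pos_lt_imp[OF assms(1)] assms by (auto simp: \<theta>_def)
  have w: "Re w = cmod w * cos \<theta>" "Im w = cmod w * sin \<theta>"
    using exp_Ln[OF w0] w0 by (metis Re_exp Re_Ln exp_ln zero_less_norm_iff \<theta>_def, metis Im_exp exp_Ln Re_Ln exp_ln zero_less_norm_iff \<theta>_def)
  have "cos \<theta> > 0" using \<theta> by (intro cos_gt_zero_pi) auto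
  moreover have "\<theta> * cos \<theta> \<le> sin \<theta>"
  proof (cases "\<theta> = 0")
    case False
    then have "\<theta> \<le> tan \<theta>" using \<theta> arctan_le_self[of "tan \<theta>"] arctan_tan[of \<theta>] tan_pos_pi2_le[of \<theta>] by auto
    then show ?thesis using \<open>cos \<theta> > 0\<close> by (simp add: tan_def field_simps)
  qed auto
  ultimately show ?thesis using w0 unfolding w \<theta>_def[symmetric] by (simp add: field_simps)
qed

lemma has_real_derivative_Im:
  "(f has_vector_derivative d) (at x) \<Longrightarrow> ((\<lambda>x. Im (f x)) has_real_derivative Im d) (at x)"
  unfolding has_real_derivative_iff_has_vector_derivative
  by (rule bounded_linear.has_vector_derivative[OF bounded_linear_Im])

lemma Re_one_divide_pos: "Re w > 0 \<Longrightarrow> Re (1 / w) > 0"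
  by (auto simp: Re_divide intro!: divide_pos_pos add_pos_nonneg)

lemma isCont_Im: "isCont f x \<Longrightarrow> isCont (\<lambda>x. Im (f x)) x"
  unfolding isCont_def by (rule tendsto_Im)

lemma isCont_Complex1: "isCont (\<lambda>x. Complex x y) x" and isCont_Complex2: "isCont (\<lambda>y. Complex x y) y"
  by (auto simp: Complex_eq intro!: continuous_intros)

section \<open>The argument of P and the curve on which it vanishes\<close>

context centred_unit
begin

text \<open>All |a_j| are at most 1, so off the real rays |x| >= 1 no factor 1 - a_j z meets the
  branch cut of \<open>Ln\<close>. One region thus serves every admissible a, and it contains the
  origin, the imaginary axis and the upper half plane.\<close>

definition slit :: "complex set" where
  "slit = {z. Im z \<noteq> 0 \<or> \<bar>Re z\<bar> < 1}"

text \<open>A sum of principal logarithms is a continuous branch of ln P on \<open>slit\<close>;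
  \<open>Ln\<close> of the product would jump where the arguments add up to more than pi.\<close>

definition llog :: "complex \<Rightarrow> complex" where
  "llog z = (\<Sum>j\<in>UNIV. Ln (1 - of_real (a j) * z))"

lemma neg: "centred_unit (\<lambda>j. - a j) n"
  by unfold_locales (use n in \<open>auto simp: card sum0 sum1 sum_negf\<close>)

lemma abs_le_1: "\<bar>a j\<bar> \<le> 1"
proof -
  have "(a j)\<^sup>2 \<le> (\<Sum>j\<in>UNIV. (a j)\<^sup>2)" by (rule member_le_sum) auto
  then show ?thesis unfolding sum1 by (simp add: abs_square_le_1)
qed

lemma ex_pos: "\<exists>k. a k > 0"
proof (rule ccontr)
  assume "\<nexists>k. a k > 0"
  then have "\<forall>j\<in>UNIV. - a j \<ge> 0" by (auto simp: not_less)
  then have "\<forall>j\<in>UNIV. - a j = 0" using sum_nonneg_eq_0_iff[of UNIV "\<lambda>j. - a j"] sum0 by (auto simp: sum_negf)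
  then have "(\<Sum>j\<in>UNIV. (a j)\<^sup>2) = 0" by simp
  then show False using sum1 by simp
qed

lemma ex_neg: "\<exists>k. a k < 0"
  using centred_unit.ex_pos[OF neg] by simp

lemma slit_nonpos: "z \<in> slit \<Longrightarrow> 1 - of_real (a j) * z \<notin> \<real>\<^sub>\<le>\<^sub>0"
proof
  assume z: "z \<in> slit" and "1 - of_real (a j) * z \<in> \<real>\<^sub>\<le>\<^sub>0"
  then have *: "a j * Im z = 0" "1 \<le> a j * Re z" by (auto simp: complex_nonpos_Reals_iff)
  then have "Im z = 0" by auto
  then have "\<bar>Re z\<bar> < 1" using z by (auto simp: slit_def)
  moreover have "a j * Re z \<le> \<bar>a j\<bar> * \<bar>Re z\<bar>" by (metis abs_ge_self abs_mult)
  moreover have "\<bar>a j\<bar> * \<bar>Re z\<bar> \<le> 1 * \<bar>Re z\<bar>" by (intro mult_right_mono abs_le_1) auto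
  ultimately show False using * by linarith
qed

lemma slit_nz: "z \<in> slit \<Longrightarrow> 1 - of_real (a j) * z \<noteq> 0"
  using slit_nonpos[of z j] by auto

lemma llog_DERIV: 
  assumes "z \<in> slit" shows "(llog has_field_derivative - logd z) (at z)"
proof -
  have "(llog has_field_derivative (\<Sum>j\<in>UNIV. inverse (1 - of_real (a j) * z) * (0 - of_real (a j) * 1))) (at z)"
    unfolding llog_def
    by (intro DERIV_sum DERIV_chain2[of Ln] has_field_derivative_Ln slit_nonpos assms derivative_eq_intros refl) auto
  also have "(\<Sum>j\<in>UNIV. inverse (1 - of_real (a j) * z) * (0 - of_real (a j) * 1)) = - logd z"
    by (simp add: logd_def sum_negf divide_inverse mult.commute)
  finally show ?thesis .
qed

lemma exp_llog: "z \<in> slit \<Longrightarrow> exp (llog z) = (\<Prod>j\<in>UNIV. 1 - of_real (a j) * z)"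
  by (simp add: llog_def exp_sum exp_Ln[OF slit_nz])

lemma upper_slit: "Im z > 0 \<Longrightarrow> z \<in> slit" by (simp add: slit_def)

lemma llog_0 [simp]: "llog 0 = 0" by (simp add: llog_def)

lemma isCont_llog: "z \<in> slit \<Longrightarrow> isCont llog z"
  using llog_DERIV by (rule DERIV_isCont)

text \<open>The derivative in the horizontal direction is \<open>- logd\<close>, with negative
  imaginary part. Hence each horizontal line meets the curve at most once, and the sign of
  \<open>Im (llog z)\<close> tells on which side of the curve z lies.\<close>

lemma Im_llog_decreasing:
  assumes "x1 < x2" "y > 0" shows "Im (llog (Complex x2 y)) < Im (llog (Complex x1 y))"
proof -
  have C: "(\<lambda>x. Complex x y) = (\<lambda>x. of_real x + \<i> * of_real y)" by (auto simp: complex_eq_iff)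
  show ?thesis
  proof (rule DERIV_neg_imp_decreasing[OF assms(1)])
    fix x
    have "((\<lambda>x. Complex x y) has_vector_derivative 1) (at x)"
      unfolding C by (auto intro!: derivative_eq_intros has_vector_derivative_add_const[THEN iffD2])
    then have "((llog \<circ> (\<lambda>x. Complex x y)) has_vector_derivative (1 * - logd (Complex x y))) (at x)"
      by (intro field_vector_diff_chain_at llog_DERIV upper_slit) (use assms in auto)
    then have "((\<lambda>x. Im (llog (Complex x y))) has_real_derivative Im (- logd (Complex x y))) (at x)"
      by (simp only: o_def has_real_derivative_Im mult_1)
    then show "\<exists>d. ((\<lambda>x. Im (llog (Complex x y))) has_real_derivative d) (at x) \<and> d < 0"
      using Im_logd_pos[of "Complex x y"] assms by auto
  qed
qed

text \<open>Once a_k x >= 1, the factor with index k has nonpositive real and negative imaginary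
  part, so its argument is at most - pi / 2. Each of the other n factors contributes at most y / x,
  together at most 1, which is less than pi / 2.\<close>

lemma Im_llog_neg_large:
  assumes k: "a k > 0" and x: "a k * x \<ge> 1" "x \<ge> real n * y" and y: "y > 0"
  shows "Im (llog (Complex x y)) < 0"
proof -
  define z where "z = Complex x y"
  have z: "Im z = y" "Re z = x" by (auto simp: z_def)
  have zs: "z \<in> slit" using y z by (auto simp: slit_def)
  have x0: "x > 0" using x(1) k by (smt (verit) mult_nonneg_nonpos)
  let ?w = "\<lambda>j. 1 - of_real (a j) * z"
  have 1: "Im (Ln (?w k)) \<le> - (pi / 2)"
  proof -
    have "Im (?w k) < 0" "Re (?w k) \<le> 0" using k x y z by auto
    moreover have "?w k \<noteq> 0" using slit_nz[OF zs] .
    ultimately show ?thesis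
      using Im_Ln_pos_le[of "?w k"] Re_Ln_pos_lt[of "?w k"] Im_Ln_le_pi[of "?w k"] by force
  qed
  have 2: "Im (Ln (?w j)) \<le> y / x" for j
  proof (cases "a j \<ge> 0")
    case True
    show ?thesis
    proof (cases "a j = 0")
      case False
      then have "Im (?w j) < 0" using True y z by auto
      then have "Im (Ln (?w j)) \<le> 0"
        using Im_Ln_pos_le[of "?w j"] slit_nz[OF zs, of j] Im_Ln_le_pi[of "?w j"] by force
      then show ?thesis using x0 y by (smt (verit) divide_nonneg_pos)
    qed (use x0 y in auto)
  next
    case False
    define c where "c = - a j"
    have c: "c > 0" using False by (simp add: c_def)
    have aj: "a j = - c" by (simp add: c_def)
    have "Im (Ln (?w j)) \<le> Im (?w j) / Re (?w j)"
    proof (rule Im_Ln_le_ratio)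
      show "0 < Re (?w j)" using mult_pos_pos[OF c x0] unfolding aj by (simp add: z del: zero_less_mult_iff)
      show "0 \<le> Im (?w j)" using mult_pos_pos[OF c y] unfolding aj by (simp add: z)
    qed
    also have "\<dots> = c * y / (1 + c * x)" using z by (simp add: c_def)
    also have "\<dots> \<le> c * y / (c * x)"
      using c x0 y mult_pos_pos[OF c x0] mult_pos_pos[OF c y] by (intro divide_left_mono mult_pos_pos) linarith+
    also have "\<dots> = y / x" using c by simp
    finally show ?thesis .
  qed
  have "Im (llog z) = Im (Ln (?w k)) + (\<Sum>j\<in>UNIV - {k}. Im (Ln (?w j)))"
    unfolding llog_def Im_sum by (simp add: sum.remove)
  also have "\<dots> \<le> - (pi / 2) + (\<Sum>j\<in>UNIV - {k}. y / x)"
    by (intro add_mono 1 sum_mono 2)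
  also have "(\<Sum>j\<in>UNIV - {k}. y / x) = real n * (y / x)" by (simp add: card_Diff_singleton card)
  also have "\<dots> \<le> 1" using x x0 by (simp add: field_simps)
  also have "- (pi / 2) + 1 < 0" using pi_gt3 by simp
  finally show ?thesis by (simp add: z_def)
qed

text \<open>Replacing a by - a and reflecting z in the imaginary axis conjugates every factor.
  Bounds on one side of the curve thereby transfer to the other side.\<close>

lemma llog_neg: 
  assumes "y > 0"
  shows "Im (centred_unit.llog (\<lambda>j. - a j) (Complex x y)) = - Im (llog (Complex (-x) y))"
proof -
  have "Im (Ln (1 - of_real (- a j) * Complex x y)) = - Im (Ln (1 - of_real (a j) * Complex (- x) y))" for j
  proof -
    have "1 - of_real (- a j) * Complex x y = cnj (1 - of_real (a j) * Complex (- x) y)"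
      by (simp add: complex_eq_iff)
    moreover have "Complex (- x) y \<in> slit" using assms by (simp add: slit_def)
    ultimately show ?thesis using cnj_Ln[OF slit_nonpos, of "Complex (- x) y" j] by (metis cnj.sel(2))
  qed
  then show ?thesis
    unfolding llog_def centred_unit.llog_def[OF neg] Im_sum by (simp add: sum_negf)
qed

lemma Im_llog_pos_large:
  assumes k: "a k < 0" and x: "a k * x \<ge> 1" "x \<le> - real n * y" and y: "y > 0"
  shows "Im (llog (Complex x y)) > 0"
  using centred_unit.Im_llog_neg_large[OF neg, of k "- x" y] assms llog_neg[of y "- x"] by auto

lemma isCont_Im_llog: "y > 0 \<Longrightarrow> isCont (\<lambda>x. Im (llog (Complex x y))) x"
  by (intro isCont_Im isCont_o2[OF isCont_Complex1, where g = llog] isCont_llog upper_slit) auto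

lemma ex1_level: 
  assumes y: "y > 0" shows "\<exists>!x. Im (llog (Complex x y)) = 0"
proof -
  obtain k l where k: "a k > 0" and l: "a l < 0" using ex_pos ex_neg by blast
  define x1 where "x1 = max (1 / a k) (real n * y)"
  define x2 where "x2 = min (1 / a l) (- real n * y)"
  have "a k * (1 / a k) \<le> a k * x1" using k by (intro mult_left_mono) (auto simp: x1_def)
  then have 1: "Im (llog (Complex x1 y)) < 0"
    using k y by (intro Im_llog_neg_large[of k]) (auto simp: x1_def)
  have "a l * (1 / a l) \<le> a l * x2" using l by (intro mult_left_mono_neg) (auto simp: x2_def)
  then have 2: "Im (llog (Complex x2 y)) > 0"
    using l y by (intro Im_llog_pos_large[of l]) (auto simp: x2_def)
  have "x2 \<le> x1" using y unfolding x1_def x2_def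
    by (smt (verit) mult_nonneg_nonneg of_nat_0_le_iff mult_minus_left)
  then obtain x where x: "Im (llog (Complex x y)) = 0"
    using IVT2[of "\<lambda>x. Im (llog (Complex x y))" x1 0 x2] 1 2 isCont_Im_llog[OF y] by auto
  show ?thesis
  proof (rule ex1I)
    show "Im (llog (Complex x y)) = 0" by (rule x)
  next
    fix x' assume "Im (llog (Complex x' y)) = 0"
    then show "x' = x" using x Im_llog_decreasing[of x x' y] Im_llog_decreasing[of x' x y] y
      by (cases x x' rule: linorder_cases) auto
  qed
qed

text \<open>
  The level curve \<open>z = zc y\<close>, parametrised by the height \<open>y = Im z > 0\<close>, on which
  \<open>\<Prod>j. 1 - a\<^sub>j z\<close> equals \<open>exp (uc y) > 0\<close>.
\<close>

definition xc :: "real \<Rightarrow> real" where "xc y = (THE x. Im (llog (Complex x y)) = 0)"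
definition zc :: "real \<Rightarrow> complex" where "zc y = Complex (xc y) y"
definition uc :: "real \<Rightarrow> real" where "uc y = Re (llog (zc y))"

lemma Im_zc [simp]: "Im (zc y) = y" and Re_zc [simp]: "Re (zc y) = xc y" by (auto simp: zc_def)

lemma Im_llog_zc: "y > 0 \<Longrightarrow> Im (llog (zc y)) = 0"
  unfolding zc_def xc_def using theI'[OF ex1_level] by blast

lemma llog_zc: "y > 0 \<Longrightarrow> llog (zc y) = of_real (uc y)"
  using Im_llog_zc by (simp add: uc_def complex_eq_iff)

lemma xc_less: "y > 0 \<Longrightarrow> Im (llog (Complex x y)) < 0 \<Longrightarrow> xc y < x"
  using Im_llog_zc[of y] Im_llog_decreasing[of x "xc y" y] by (cases x "xc y" rule: linorder_cases) (auto simp: zc_def)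

lemma xc_greater: "y > 0 \<Longrightarrow> Im (llog (Complex x y)) > 0 \<Longrightarrow> xc y > x"
  using Im_llog_zc[of y] Im_llog_decreasing[of "xc y" x y] by (cases x "xc y" rule: linorder_cases) (auto simp: zc_def)

text \<open>Linear growth suffices later: the horizontal segment that closes the contour at height y
  has length at most n y, while 1 / P decays quadratically.\<close>

lemma xc_large: "\<exists>Y>0. \<forall>y\<ge>Y. \<bar>xc y\<bar> \<le> real n * y"
proof -
  obtain k l where k: "a k > 0" and l: "a l < 0" using ex_pos ex_neg by blast
  define Y where "Y = max (1 / a k) (1 / - a l)"
  have n1: "real n \<ge> 1" using n by simp
  have Y0: "Y > 0" using k by (simp add: Y_def less_max_iff_disj)
  have "\<bar>xc y\<bar> \<le> real n * y" if "y \<ge> Y" for y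
  proof -
    have y: "y > 0" using that Y0 by linarith
    have "y \<le> real n * y" using n1 y by simp
    then have b: "1 / a k \<le> real n * y" "1 / - a l \<le> real n * y" using that by (auto simp: Y_def)
    have "a k * (1 / a k) \<le> a k * (real n * y)" using k b by (intro mult_left_mono) auto
    moreover have "(- a l) * (1 / - a l) \<le> - a l * (real n * y)" using l b by (intro mult_left_mono) auto
    ultimately show ?thesis
      using xc_less[OF y Im_llog_neg_large[OF k, of "real n * y" y]] y k l
        xc_greater[OF y Im_llog_pos_large[OF l, of "- real n * y" y]] by auto
  qed
  then show ?thesis using Y0 by blast
qed

text \<open>For z = t (1 + i) one has logd z = z S with Re S > 0, and (1 + i)^2 = 2 i, so
  \<open>Im (llog z)\<close> strictly decreases along the ray from its value 0 at the origin. The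
  condition y < 1 keeps the real parts of all factors positive. The resulting cone |x| < y makes the
  curve start at the origin with bounded slope x / y.\<close>

lemma ray_neg:
  assumes "0 < y" "y < 1" shows "Im (llog (Complex y y)) < 0"
proof -
  define c where "c = 1 + \<i>"
  have C: "Complex t t = of_real t * c" for t by (simp add: c_def complex_eq_iff)
  let ?f = "\<lambda>t. Im (llog (of_real t * c))"
  have D: "(?f has_real_derivative Im (c * - logd (of_real t * c))) (at t)" if "\<bar>t\<bar> < 1" for t
  proof -
    have "((\<lambda>t. of_real t * c) has_vector_derivative c) (at t)"
      by (auto intro!: derivative_eq_intros)
    moreover have "of_real t * c \<in> slit" using that by (auto simp: slit_def c_def)
    ultimately have "((llog \<circ> (\<lambda>t. of_real t * c)) has_vector_derivative (c * - logd (of_real t * c))) (at t)"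
      by (intro field_vector_diff_chain_at llog_DERIV)
    then show ?thesis by (simp only: o_def has_real_derivative_Im)
  qed
  have neg: "Im (c * - logd (of_real t * c)) < 0" if t: "0 < t" "t < 1" for t
  proof -
    let ?z = "of_real t * c"
    have zs: "?z \<in> slit" using t by (auto simp: slit_def c_def)
    have "of_real (a j) / (1 - of_real (a j) * ?z) = ?z * (of_real ((a j)\<^sup>2) / (1 - of_real (a j) * ?z)) + of_real (a j)" for j
      using slit_nz[OF zs, of j] by (simp add: field_simps power2_eq_square)
    then have L: "logd ?z = ?z * (\<Sum>j\<in>UNIV. of_real ((a j)\<^sup>2) / (1 - of_real (a j) * ?z))"
      unfolding logd_def by (simp add: sum.distrib sum0 sum_distrib_left flip: of_real_sum)
    define S where "S = (\<Sum>j\<in>UNIV. of_real ((a j)\<^sup>2) / (1 - of_real (a j) * ?z))"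
    have pos: "Re (of_real ((a j)\<^sup>2) / (1 - of_real (a j) * ?z)) \<ge> 0" and pos': "a j \<noteq> 0 \<Longrightarrow> Re (of_real ((a j)\<^sup>2) / (1 - of_real (a j) * ?z)) > 0" for j
    proof -
      have "a j * t \<le> \<bar>a j\<bar> * t" using t by (intro mult_right_mono) auto
      also have "\<dots> \<le> 1 * t" using t abs_le_1 by (intro mult_right_mono) auto
      finally have "a j * t < 1" using t by linarith
      then have "Re (1 - of_real (a j) * ?z) > 0" by (simp add: c_def)
      then have "Re (1 / (1 - of_real (a j) * ?z)) > 0" by (rule Re_one_divide_pos)
      moreover have "of_real ((a j)\<^sup>2) / (1 - of_real (a j) * ?z) = of_real ((a j)\<^sup>2) * (1 / (1 - of_real (a j) * ?z))" by simp
      then have "Re (of_real ((a j)\<^sup>2) / (1 - of_real (a j) * ?z)) = (a j)\<^sup>2 * Re (1 / (1 - of_real (a j) * ?z))"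
        by (simp only: times_complex.sel Re_complex_of_real Im_complex_of_real mult_zero_left diff_zero add_0_right)
      ultimately show "Re (of_real ((a j)\<^sup>2) / (1 - of_real (a j) * ?z)) \<ge> 0"
         "a j \<noteq> 0 \<Longrightarrow> Re (of_real ((a j)\<^sup>2) / (1 - of_real (a j) * ?z)) > 0" by simp_all
    qed
    obtain k where "a k > 0" using ex_pos by blast
    then have "Re S > 0" unfolding S_def Re_sum using pos'[of k] pos by (intro sum_pos2[of _ k]) auto
    moreover have "c * c = 2 * \<i>" by (simp add: c_def complex_eq_iff)
    then have "c * - logd ?z = - (2 * \<i>) * of_real t * S" unfolding L S_def[symmetric] by (simp add: mult_ac)
    ultimately show ?thesis using t by simp
  qed
  have "?f y < ?f 0"
  proof (rule DERIV_neg_imp_decreasing_open[OF assms(1)])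
    show "\<exists>d. (?f has_real_derivative d) (at x) \<and> d < 0" if "0 < x" "x < y" for x
      using D[of x] neg[of x] that assms by force
    show "continuous_on {0..y} ?f"
      using D assms by (intro continuous_at_imp_continuous_on ballI DERIV_isCont[OF D]) auto
  qed
  then show ?thesis by (simp add: C)
qed

lemma xc_small: "0 < y \<Longrightarrow> y < 1 \<Longrightarrow> \<bar>xc y\<bar> < y"
  using xc_less[OF _ ray_neg, of y] xc_greater[of y "- y"] centred_unit.ray_neg[OF neg, of y] llog_neg[of y y] by auto

text \<open>For fixed b the sign of \<open>Im (llog (Complex b y))\<close> decides whether the curve
  passes to the left or to the right of b, and a strict sign persists under small changes of
  y.\<close>

lemma isCont_zc: assumes y: "y > 0" shows "isCont zc y"
proof -
  have "isCont xc y"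
    unfolding isCont_def
  proof (rule order_tendstoI)
    have cont: "isCont (\<lambda>y. Im (llog (Complex x y))) y" for x
      using y by (intro isCont_Im isCont_o2[OF isCont_Complex2, where g = llog] isCont_llog upper_slit) auto
    have ev: "eventually (\<lambda>y. y > 0) (at y)" using y by (intro eventually_at_in_open'[of "{0<..}", simplified]) auto
    fix b assume b: "b < xc y"
    then have "Im (llog (Complex b y)) > 0"
      using Im_llog_decreasing[OF b y] Im_llog_zc[OF y] by (simp add: zc_def)
    then have "eventually (\<lambda>y. Im (llog (Complex b y)) > 0) (at y)"
      using cont[of b] unfolding isCont_def by (rule order_tendstoD(1)[rotated])
    with ev show "eventually (\<lambda>y. b < xc y) (at y)" by eventually_elim (rule xc_greater)
  next
    have cont: "isCont (\<lambda>y. Im (llog (Complex x y))) y" for x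
      using y by (intro isCont_Im isCont_o2[OF isCont_Complex2, where g = llog] isCont_llog upper_slit) auto
    have ev: "eventually (\<lambda>y. y > 0) (at y)" using y by (intro eventually_at_in_open'[of "{0<..}", simplified]) auto
    fix b assume b: "xc y < b"
    then have "Im (llog (Complex b y)) < 0"
      using Im_llog_decreasing[OF b y] Im_llog_zc[OF y] by (simp add: zc_def)
    then have "eventually (\<lambda>y. Im (llog (Complex b y)) < 0) (at y)"
      using cont[of b] unfolding isCont_def by (rule order_tendstoD(2)[rotated])
    with ev show "eventually (\<lambda>y. xc y < b) (at y)" by eventually_elim (rule xc_less)
  qed
  moreover have "zc = (\<lambda>y. of_real (xc y) + \<i> * of_real y)" by (auto simp: complex_eq_iff)
  ultimately show ?thesis by (auto intro!: continuous_intros)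
qed

lemma drift_inverse: "- 1 / logd z = drift z + z / (real n + 1)" by (simp add: drift_def)

lemma speed_pos: "Im z > 0 \<Longrightarrow> Im (drift z) + Im z / (real n + 1) > 0"
proof -
  assume z: "Im z > 0"
  then have "Im z / (cmod z)\<^sup>2 > 0" by (metis divide_pos_pos less_irrefl zero_complex.simps(2) zero_less_norm_iff zero_less_power)
  then have "Im (drift z) > 0" using drift_facts(2)[OF z] by linarith
  then show ?thesis using z by (simp add: add_pos_nonneg)
qed

text \<open>\<open>llog\<close> is real on the curve, so a chord of the curve is the real increment
  of \<open>uc\<close> times the reciprocal of the difference quotient \<open>q\<close> of
  \<open>llog\<close>. The imaginary part of the chord is the increment of y, which differentiates
  \<open>uc\<close>; the real part then differentiates \<open>xc\<close>.\<close>

lemma curve_DERIV: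
  assumes y: "y > 0"
  defines "s \<equiv> Im (drift (zc y)) + y / (real n + 1)"
  shows "(uc has_real_derivative 1 / s) (at y)"
    and "(xc has_real_derivative (Re (drift (zc y)) + xc y / (real n + 1)) / s) (at y)"
proof -
  define z0 where "z0 = zc y"
  have z0: "Im z0 > 0" using y by (simp add: z0_def)
  define q where "q t = (llog (zc t) - llog z0) / (zc t - z0)" for t
  define d where "d = - 1 / logd z0"
  have d: "d = drift z0 + z0 / (real n + 1)" unfolding d_def by (rule drift_inverse)
  have cn: "complex_of_real (real n + 1) = of_real (real n + 1)" by simp
  have Imd: "Im d = s" and Red: "Re d = Re (drift z0) + xc y / (real n + 1)"
    unfolding d s_def z0_def using Im_divide_of_real[of "zc y" "real n + 1"] Re_divide_of_real[of "zc y" "real n + 1"] by simp_all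
  have s0: "s > 0" using speed_pos[OF z0] by (simp add: s_def z0_def)
  have ld: "logd z0 \<noteq> 0" using Im_logd_pos[OF z0] by auto
  have evne: "eventually (\<lambda>t. t \<noteq> y) (at y)" by (simp add: eventually_at_filter)
  have "((\<lambda>w. (llog w - llog z0) / (w - z0)) \<longlongrightarrow> - logd z0) (at z0)"
    using llog_DERIV[OF upper_slit[OF z0]] by (simp add: has_field_derivative_iff)
  moreover have "filterlim zc (at z0) (at y)"
    unfolding filterlim_at
  proof
    show "(zc \<longlongrightarrow> z0) (at y)" using isCont_zc[OF y] by (simp add: isCont_def z0_def)
    show "eventually (\<lambda>t. zc t \<in> UNIV \<and> zc t \<noteq> z0) (at y)"
      using evne by eventually_elim (metis Im_zc UNIV_I z0_def)
  qed
  ultimately have q: "(q \<longlongrightarrow> - logd z0) (at y)"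
    unfolding q_def by (rule filterlim_compose)
  then have "((\<lambda>t. 1 / q t) \<longlongrightarrow> 1 / (- logd z0)) (at y)"
    by (intro tendsto_divide tendsto_const) (use ld in auto)
  moreover have "1 / (- logd z0) = d" by (simp add: d_def)
  ultimately have qi: "((\<lambda>t. 1 / q t) \<longlongrightarrow> d) (at y)" by simp
  then have "((\<lambda>t. Im (1 / q t)) \<longlongrightarrow> s) (at y)" by (subst Imd[symmetric]) (rule tendsto_Im)
  then have u1: "((\<lambda>t. 1 / Im (1 / q t)) \<longlongrightarrow> 1 / s) (at y)" by (intro tendsto_divide tendsto_const) (use s0 in auto)
  have ev: "eventually (\<lambda>t. t > 0) (at y)" using y by (intro eventually_at_in_open'[of "{0<..}", simplified]) auto
  have evq: "eventually (\<lambda>t. q t \<noteq> 0) (at y)" by (rule tendsto_imp_eventually_ne[OF q]) (use ld in auto)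
  have key: "eventually (\<lambda>t. zc t - z0 = of_real (uc t - uc y) * (1 / q t)) (at y)"
    using ev evq evne
  proof eventually_elim
    case (elim t)
    have "zc t \<noteq> z0" using elim by (metis Im_zc z0_def)
    moreover have "of_real (uc t - uc y) = llog (zc t) - llog z0" using elim y by (simp add: llog_zc z0_def)
    ultimately show ?case using elim by (simp add: q_def)
  qed
  have evI: "eventually (\<lambda>t. (uc t - uc y) / (t - y) = 1 / Im (1 / q t)) (at y)"
    using key evne
  proof eventually_elim
    case (elim t)
    have "t - y = (uc t - uc y) * Im (1 / q t)"
      using arg_cong[OF elim(1), of Im] by (simp only: z0_def Im_zc minus_complex.sel times_complex.sel Re_complex_of_real Im_complex_of_real mult_zero_left diff_zero add_0_right)
    then show ?case using elim(2) by (metis divide_cancel_left divide_divide_eq_right mult_cancel_right2 mult_zero_left nonzero_mult_div_cancel_left eq_iff_diff_eq_0 divide_divide_eq_left' divide_self_if mult.commute)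
  qed
  have u2: "((\<lambda>t. (uc t - uc y) / (t - y)) \<longlongrightarrow> 1 / s) (at y)"
    using u1 evI by (rule Lim_transform_eventually[OF _ eventually_mono]) auto
  then show "(uc has_real_derivative 1 / s) (at y)" by (simp add: has_field_derivative_iff)
  have "((\<lambda>t. (uc t - uc y) / (t - y) * Re (1 / q t)) \<longlongrightarrow> 1 / s * Re d) (at y)"
    by (intro tendsto_mult u2 tendsto_Re qi)
  moreover have "eventually (\<lambda>t. (uc t - uc y) / (t - y) * Re (1 / q t) = (xc t - xc y) / (t - y)) (at y)"
    using key
  proof eventually_elim
    case (elim t)
    have "xc t - xc y = (uc t - uc y) * Re (1 / q t)"
      using arg_cong[OF elim, of Re] by (simp only: z0_def Re_zc minus_complex.sel times_complex.sel Re_complex_of_real Im_complex_of_real mult_zero_left diff_zero add_0_right)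
    then show ?case by simp
  qed
  ultimately have "((\<lambda>t. (xc t - xc y) / (t - y)) \<longlongrightarrow> 1 / s * Re d) (at y)"
    by (rule Lim_transform_eventually)
  moreover have "1 / s * Re d = (Re (drift (zc y)) + xc y / (real n + 1)) / s"
    unfolding Red by (simp add: z0_def)
  ultimately show "(xc has_real_derivative (Re (drift (zc y)) + xc y / (real n + 1)) / s) (at y)"
    by (simp only: has_field_derivative_iff)
qed

lemma zc_tendsto_0: "(zc \<longlongrightarrow> 0) (at_right 0)"
proof -
  have "(xc \<longlongrightarrow> 0) (at_right 0)"
  proof (rule Lim_null_comparison)
    show "eventually (\<lambda>y. norm (xc y) \<le> y) (at_right 0)"
      using eventually_at_right_real[OF zero_less_one] by (rule eventually_mono) (use xc_small in force)
    show "((\<lambda>y::real. y) \<longlongrightarrow> 0) (at_right 0)" by (rule tendsto_ident_at)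
  qed
  then have "((\<lambda>y. of_real (xc y) + \<i> * of_real y) \<longlongrightarrow> of_real 0 + \<i> * of_real 0) (at_right 0)"
    by (intro tendsto_intros)
  moreover have "zc = (\<lambda>y. of_real (xc y) + \<i> * of_real y)" by (auto simp: complex_eq_iff)
  ultimately show ?thesis by simp
qed

lemma uc_tendsto_0: "(uc \<longlongrightarrow> 0) (at_right 0)"
proof -
  have "isCont llog 0" by (rule isCont_llog) (simp add: slit_def)
  then have "((\<lambda>y. llog (zc y)) \<longlongrightarrow> llog 0) (at_right 0)"
    by (rule isCont_tendsto_compose[OF _ zc_tendsto_0])
  then have "((\<lambda>y. Re (llog (zc y))) \<longlongrightarrow> Re (llog 0)) (at_right 0)" by (rule tendsto_Re)
  then show ?thesis by (simp add: uc_def[abs_def])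
qed

end

section \<open>A comparison theorem for a cooperative system\<close>

text \<open>
  The system \<open>u' = exp (2 \<sigma> u) s (1 + v\<^sup>2)\<close>, \<open>(s\<^sup>2 v)' = b s\<^sup>2 exp (\<sigma> u) (1 + v\<^sup>2)\<close> is cooperative
  in the region \<open>v \<ge> 0\<close>, so subsolutions stay below solutions. The defect is estimated against
  the growing weight \<open>exp (2 C s)\<close>, which replaces Gronwall's inequality.
\<close>

lemma exp_poly_lipschitz:
  fixes \<sigma> :: real
  assumes "0 \<le> \<sigma>" "0 \<le> R"
  shows "\<exists>C>0. \<forall>u v m. 0 \<le> u \<longrightarrow> u \<le> R \<longrightarrow> 0 \<le> v \<longrightarrow> v \<le> R \<longrightarrow> 0 \<le> m \<longrightarrow> m \<le> R \<longrightarrow>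
     exp (\<sigma> * (u + m)) * (1 + (v + m)\<^sup>2) \<le> exp (\<sigma> * u) * (1 + v\<^sup>2) + C * m"
proof -
  define f where "f u v m = exp (\<sigma> * (u + m)) * (1 + (v + m)\<^sup>2)" for u v m
  define f' where "f' u v m = \<sigma> * exp (\<sigma> * (u + m)) * (1 + (v + m)\<^sup>2) + exp (\<sigma> * (u + m)) * (2 * (v + m))" for u v m
  \<comment> \<open>Bounds the derivative along a common shift: all of u, v and the shift lie in
    [0, R], so their sums are at most 2 R. The final 1 keeps \<open>C\<close> positive when the rest
    is 0.\<close>
  define C where "C = \<sigma> * exp (\<sigma> * (2 * R)) * (1 + (2 * R)\<^sup>2) + exp (\<sigma> * (2 * R)) * (2 * (2 * R)) + 1"
  have C0: "C > 0" using assms unfolding C_def by (intro add_nonneg_pos add_nonneg_nonneg mult_nonneg_nonneg) auto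
  have "f u v m \<le> f u v 0 + C * m" if h: "0 \<le> u" "u \<le> R" "0 \<le> v" "v \<le> R" "0 \<le> m" "m \<le> R" for u v m
  proof (cases "m = 0")
    case False
    then have m: "m > 0" using h by simp
    have D: "(f u v has_real_derivative f' u v x) (at x)" for x
      unfolding f_def f'_def by (auto intro!: derivative_eq_intros simp: algebra_simps)
    obtain x where x: "0 < x" "x < m" "f u v m - f u v 0 = (m - 0) * f' u v x"
      using MVT2[OF m D] by blast
    have e: "exp (\<sigma> * (u + x)) \<le> exp (\<sigma> * (2 * R))" using x h assms by (auto intro!: mult_left_mono)
    have q: "(v + x)\<^sup>2 \<le> (2 * R)\<^sup>2" using x h by (intro power_mono) auto
    have "f' u v x \<le> C"
      unfolding f'_def C_def using assms x h e q
      by (intro add_increasing2 add_mono mult_mono order_refl) auto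
    then have "m * f' u v x \<le> m * C" using m by simp
    then show ?thesis using x(3) by (simp add: mult.commute[of C])
  qed (simp add: f_def)
  then show ?thesis using C0 unfolding f_def by (intro exI[of _ C]) auto
qed

text \<open>The level curves are parametrised by s > 0 only, so initial values enter as one-sided
  limits: monotonicity on [r, s] is used and r tends to 0.\<close>

lemma nonpos_of_DERIV_nonpos_at_right:
  fixes f f' :: "real \<Rightarrow> real"
  assumes lim: "(f \<longlongrightarrow> l) (at_right 0)" and l: "l \<le> 0"
    and D: "\<And>s. 0 < s \<Longrightarrow> s \<le> T \<Longrightarrow> (f has_real_derivative f' s) (at s) \<and> f' s \<le> 0"
    and s: "0 < s" "s \<le> T"
  shows "f s \<le> 0"
proof -
  have "f s \<le> f r" if "0 < r" "r < s" for r
  proof (rule DERIV_nonpos_imp_nonincreasing[of r s f])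
    show "r \<le> s" using that by simp
    fix x assume "r \<le> x" "x \<le> s"
    then show "\<exists>y. (f has_real_derivative y) (at x) \<and> y \<le> 0" using D[of x] that s by force
  qed
  then have "eventually (\<lambda>r. f s \<le> f r) (at_right 0)"
    using eventually_at_right_real[OF s(1)] by (auto elim!: eventually_mono)
  then have "f s \<le> l" using lim by (intro tendsto_lowerbound[OF lim]) auto
  then show ?thesis using l by simp
qed

text \<open>Differentiating s^2 v instead of v avoids the singular term 2 v / s in the equation for
  v, and the initial value 0 of s^2 v follows from the boundedness of v. The bound on |w| serves
  \<open>v\<close> and \<open>- v\<close> at once, both of which are compared with
  \<open>V\<close>.\<close>

lemma cooperative_comparison:
  fixes u v u' w U V U' W :: "real \<Rightarrow> real"
  assumes \<sigma>: "0 \<le> \<sigma>" and b: "0 \<le> b" and T: "T > 0"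
    and u: "\<And>s. 0 < s \<Longrightarrow> s \<le> T \<Longrightarrow> (u has_real_derivative u' s) (at s)"
    and u': "\<And>s. 0 < s \<Longrightarrow> s \<le> T \<Longrightarrow> u' s \<le> exp (2 * \<sigma> * u s) * s * (1 + (v s)\<^sup>2)"
    and v: "\<And>s. 0 < s \<Longrightarrow> s \<le> T \<Longrightarrow> ((\<lambda>s. s\<^sup>2 * v s) has_real_derivative w s) (at s)"
    and w: "\<And>s. 0 < s \<Longrightarrow> s \<le> T \<Longrightarrow> \<bar>w s\<bar> \<le> b * s\<^sup>2 * exp (\<sigma> * u s) * (1 + (v s)\<^sup>2)"
    and U: "\<And>s. 0 < s \<Longrightarrow> s \<le> T \<Longrightarrow> (U has_real_derivative U' s) (at s)"
    and U': "\<And>s. 0 < s \<Longrightarrow> s \<le> T \<Longrightarrow> U' s = exp (2 * \<sigma> * U s) * s * (1 + (V s)\<^sup>2)"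
    and V: "\<And>s. 0 < s \<Longrightarrow> s \<le> T \<Longrightarrow> ((\<lambda>s. s\<^sup>2 * V s) has_real_derivative W s) (at s)"
    and W: "\<And>s. 0 < s \<Longrightarrow> s \<le> T \<Longrightarrow> W s = b * s\<^sup>2 * exp (\<sigma> * U s) * (1 + (V s)\<^sup>2)"
    and bd: "\<And>s. 0 < s \<Longrightarrow> s \<le> T \<Longrightarrow> 0 \<le> u s \<and> u s \<le> R \<and> 0 \<le> U s \<and> U s \<le> R \<and> \<bar>v s\<bar> \<le> R \<and> \<bar>V s\<bar> \<le> R"
    and lim: "(u \<longlongrightarrow> 0) (at_right 0)" "(U \<longlongrightarrow> 0) (at_right 0)"
    and s: "0 < s" "s \<le> T"
  shows "u s \<le> U s \<and> \<bar>v s\<bar> \<le> V s"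
proof -
  have R: "R \<ge> 0" using bd[of T] T by linarith
  have limv: "((\<lambda>s. s\<^sup>2 * f s) \<longlongrightarrow> 0) (at_right 0)" if "\<And>s. 0 < s \<Longrightarrow> s \<le> T \<Longrightarrow> \<bar>f s\<bar> \<le> R" for f :: "real \<Rightarrow> real"
  proof (rule Lim_null_comparison)
    show "eventually (\<lambda>s. norm (s\<^sup>2 * f s) \<le> s\<^sup>2 * R) (at_right 0)"
      using eventually_at_right_real[OF T] by (rule eventually_mono) (auto simp: abs_mult intro!: mult_left_mono that)
    have "((\<lambda>s. s\<^sup>2 * R) \<longlongrightarrow> 0\<^sup>2 * R) (at_right 0)" by (intro tendsto_intros)
    then show "((\<lambda>s. s\<^sup>2 * R) \<longlongrightarrow> 0) (at_right 0)" by simp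
  qed
  \<comment> \<open>Nonnegativity puts \<open>V\<close> in the region where 1 + v^2 is increasing;
    it holds because s^2 V starts at 0 and has a nonnegative derivative.\<close>
  have V0: "V s \<ge> 0" if s: "0 < s" "s \<le> T" for s
  proof -
    have "- (s\<^sup>2 * V s) \<le> 0"
    proof (rule nonpos_of_DERIV_nonpos_at_right[OF _ _ _ s])
      show "((\<lambda>s. - (s\<^sup>2 * V s)) \<longlongrightarrow> - 0) (at_right 0)" by (intro tendsto_minus limv) (use bd in blast)
      fix x :: real assume x: "0 < x" "x \<le> T"
      have "W x \<ge> 0" unfolding W[OF x] using b x by auto
      then show "((\<lambda>s. - (s\<^sup>2 * V s)) has_real_derivative - W x) (at x) \<and> - W x \<le> 0"
        using DERIV_minus[OF V[OF x]] by auto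
    qed auto
    then show ?thesis using s by (simp add: zero_le_mult_iff)
  qed
  obtain C1 where C1: "C1 > 0" "\<And>u v m. 0 \<le> u \<Longrightarrow> u \<le> R \<Longrightarrow> 0 \<le> v \<Longrightarrow> v \<le> R \<Longrightarrow> 0 \<le> m \<Longrightarrow> m \<le> R \<Longrightarrow>
     exp (2 * \<sigma> * (u + m)) * (1 + (v + m)\<^sup>2) \<le> exp (2 * \<sigma> * u) * (1 + v\<^sup>2) + C1 * m"
    using exp_poly_lipschitz[of "2 * \<sigma>" R] \<sigma> R by auto
  obtain C2 where C2: "C2 > 0" "\<And>u v m. 0 \<le> u \<Longrightarrow> u \<le> R \<Longrightarrow> 0 \<le> v \<Longrightarrow> v \<le> R \<Longrightarrow> 0 \<le> m \<Longrightarrow> m \<le> R \<Longrightarrow>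
     exp (\<sigma> * (u + m)) * (1 + (v + m)\<^sup>2) \<le> exp (\<sigma> * u) * (1 + v\<^sup>2) + C2 * m"
    using exp_poly_lipschitz[of "\<sigma>" R] \<sigma> R by auto
  \<comment> \<open>\<open>T * C1\<close> absorbs the factor s <= T in the equation for u, and
    \<open>b * C2\<close> the constant in the equation for s^2 v.\<close>
  define C where "C = T * C1 + b * C2 + 1"
  have C: "C \<ge> T * C1" "C \<ge> b * C2" "C > 0" using T b C1 C2 by (auto simp: C_def add_nonneg_pos)
  \<comment> \<open>The least nonnegative common shift that lifts (U, V) above (u, |v|) at
    s.\<close>
  define m where "m s = max 0 (max (u s - U s) (\<bar>v s\<bar> - V s))" for s
  have m: "m s \<ge> 0" "u s \<le> U s + m s" "\<bar>v s\<bar> \<le> V s + m s" for s by (auto simp: m_def)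
  have mR: "m s \<le> R" if "0 < s" "s \<le> T" for s using bd[OF that] V0[OF that] R by (auto simp: m_def)
  define K where "K = Sup ((\<lambda>s. exp (- 2 * C * s) * m s) ` {0<..T})"
  have bdd: "bdd_above ((\<lambda>s. exp (- 2 * C * s) * m s) ` {0<..T})"
  proof (rule bdd_aboveI2)
    fix s assume "s \<in> {0<..T}"
    then have "exp (- 2 * C * s) * m s \<le> 1 * R" using C mR m(1) by (intro mult_mono) auto
    then show "exp (- 2 * C * s) * m s \<le> R" by simp
  qed
  have ne: "{0<..T} \<noteq> {}" using T by auto
  have mK: "m s \<le> K * exp (2 * C * s)" if "0 < s" "s \<le> T" for s
  proof -
    have "exp (- 2 * C * s) * m s \<le> K" unfolding K_def using that by (intro cSUP_upper bdd) auto
    then have "exp (2 * C * s) * (exp (- 2 * C * s) * m s) \<le> exp (2 * C * s) * K" by (intro mult_left_mono) auto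
    then have "(exp (2 * C * s) * exp (- 2 * C * s)) * m s \<le> K * exp (2 * C * s)"
      by (simp only: mult.assoc mult.commute[of K])
    then show ?thesis by (simp add: mult_exp_exp)
  qed
  have K0: "K \<ge> 0"
    using cSUP_upper[OF _ bdd, of T] T m(1)[of T] unfolding K_def by (auto intro: order_trans[rotated])
  have du: "u' x - U' x \<le> C * (K * exp (2 * C * x))" if x: "0 < x" "x \<le> T" for x
  proof -
    have "exp (2 * \<sigma> * u x) * (1 + (v x)\<^sup>2) \<le> exp (2 * \<sigma> * (U x + m x)) * (1 + (V x + m x)\<^sup>2)"
    proof (intro mult_mono add_left_mono)
      show "exp (2 * \<sigma> * u x) \<le> exp (2 * \<sigma> * (U x + m x))" using m(2)[of x] \<sigma> by (auto intro!: mult_left_mono)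
      show "(v x)\<^sup>2 \<le> (V x + m x)\<^sup>2" using m(3)[of x] by (metis abs_ge_zero power2_abs power_mono)
    qed auto
    also have "\<dots> \<le> exp (2 * \<sigma> * U x) * (1 + (V x)\<^sup>2) + C1 * m x"
      using bd[OF x] V0[OF x] m(1)[of x] mR[OF x] by (intro C1) auto
    finally have "x * (exp (2 * \<sigma> * u x) * (1 + (v x)\<^sup>2)) \<le> x * (exp (2 * \<sigma> * U x) * (1 + (V x)\<^sup>2) + C1 * m x)"
      using x by (intro mult_left_mono) auto
    then have "u' x - U' x \<le> x * (C1 * m x)" using u'[OF x] U'[OF x] by (simp add: algebra_simps)
    also have "\<dots> \<le> T * (C1 * m x)" using x C1 m(1)[of x] by (intro mult_right_mono) auto
    also have "\<dots> \<le> C * m x" using mult_right_mono[OF C(1) m(1)[of x]] by (simp add: mult.assoc)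
    also have "\<dots> \<le> C * (K * exp (2 * C * x))" using mK[OF x] C by (intro mult_left_mono) auto
    finally show ?thesis .
  qed
  have dv: "c * w x - W x \<le> x\<^sup>2 * (C * (K * exp (2 * C * x)))" if x: "0 < x" "x \<le> T" and c: "\<bar>c\<bar> = 1" for x c
  proof -
    have "exp (\<sigma> * u x) * (1 + (v x)\<^sup>2) \<le> exp (\<sigma> * (U x + m x)) * (1 + (V x + m x)\<^sup>2)"
    proof (intro mult_mono add_left_mono)
      show "exp (\<sigma> * u x) \<le> exp (\<sigma> * (U x + m x))" using m(2)[of x] \<sigma> by (auto intro!: mult_left_mono)
      show "(v x)\<^sup>2 \<le> (V x + m x)\<^sup>2" using m(3)[of x] by (metis abs_ge_zero power2_abs power_mono)
    qed auto
    also have "\<dots> \<le> exp (\<sigma> * U x) * (1 + (V x)\<^sup>2) + C2 * m x"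
      using bd[OF x] V0[OF x] m(1)[of x] mR[OF x] by (intro C2) auto
    finally have "b * x\<^sup>2 * (exp (\<sigma> * u x) * (1 + (v x)\<^sup>2)) \<le> b * x\<^sup>2 * (exp (\<sigma> * U x) * (1 + (V x)\<^sup>2) + C2 * m x)"
      using b by (intro mult_left_mono) auto
    moreover have "c * w x \<le> \<bar>w x\<bar>" using c by (auto simp: abs_if split: if_splits)
    ultimately have "c * w x - W x \<le> b * x\<^sup>2 * (C2 * m x)" using w[OF x] W[OF x] by (simp add: algebra_simps)
    also have "\<dots> = x\<^sup>2 * ((b * C2) * m x)" by (simp add: mult_ac)
    also have "\<dots> \<le> x\<^sup>2 * (C * m x)" using C m(1)[of x] by (intro mult_left_mono mult_right_mono) auto
    also have "\<dots> \<le> x\<^sup>2 * (C * (K * exp (2 * C * x)))" using mK[OF x] C by (intro mult_left_mono) auto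
    finally show ?thesis .
  qed
  \<comment> \<open>Both defects grow at rate at most C K exp (2 C s), which is the derivative of (K
    / 2) exp (2 C s); integrating returns half of the assumed bound. For the second unknown the
    weight carries the factor s^2, whose derivative has the favourable sign. So K <= K / 2.\<close>
  have mK2: "m s \<le> K / 2 * exp (2 * C * s)" if s: "0 < s" "s \<le> T" for s
  proof -
    have 1: "u s - U s - K / 2 * exp (2 * C * s) \<le> 0"
    proof (rule nonpos_of_DERIV_nonpos_at_right[OF _ _ _ s])
      have "((\<lambda>s. K / 2 * exp (2 * C * s)) \<longlongrightarrow> K / 2 * exp (2 * C * 0)) (at_right 0)" by (intro tendsto_intros)
      then show "((\<lambda>s. u s - U s - K / 2 * exp (2 * C * s)) \<longlongrightarrow> 0 - 0 - K / 2 * exp (2 * C * 0)) (at_right 0)"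
        by (intro tendsto_diff lim)
      show "0 - 0 - K / 2 * exp (2 * C * 0) \<le> 0" using K0 by simp
      fix x assume x: "0 < x" "x \<le> T"
      have "((\<lambda>s. u s - U s - K / 2 * exp (2 * C * s)) has_real_derivative u' x - U' x - K / 2 * (exp (2 * C * x) * (2 * C))) (at x)"
        by (auto intro!: derivative_eq_intros u[OF x] U[OF x])
      then show "((\<lambda>s. u s - U s - K / 2 * exp (2 * C * s)) has_real_derivative u' x - U' x - K / 2 * (exp (2 * C * x) * (2 * C))) (at x)
          \<and> u' x - U' x - K / 2 * (exp (2 * C * x) * (2 * C)) \<le> 0"
        using du[OF x] by (simp add: mult_ac)
    qed
    have 2: "s\<^sup>2 * (c * v s) - s\<^sup>2 * V s - s\<^sup>2 * (K / 2 * exp (2 * C * s)) \<le> 0" if c: "\<bar>c\<bar> = 1" for c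
    proof (rule nonpos_of_DERIV_nonpos_at_right[OF _ _ _ s])
      have "((\<lambda>s. s\<^sup>2 * (K / 2 * exp (2 * C * s))) \<longlongrightarrow> 0\<^sup>2 * (K / 2 * exp (2 * C * 0))) (at_right 0)" by (intro tendsto_intros)
      then show "((\<lambda>s. s\<^sup>2 * (c * v s) - s\<^sup>2 * V s - s\<^sup>2 * (K / 2 * exp (2 * C * s))) \<longlongrightarrow> 0 - 0 - 0\<^sup>2 * (K / 2 * exp (2 * C * 0))) (at_right 0)"
        by (intro tendsto_diff limv) (use bd c in \<open>auto simp: abs_mult\<close>)
      show "0 - 0 - 0\<^sup>2 * (K / 2 * exp (2 * C * 0)) \<le> 0" by simp
      fix x assume x: "0 < x" "x \<le> T"
      let ?d = "c * w x - W x - (2 * x * (K / 2 * exp (2 * C * x)) + x\<^sup>2 * (K / 2 * (exp (2 * C * x) * (2 * C))))"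
      have e: "((\<lambda>s. s\<^sup>2 * (K / 2 * exp (2 * C * s))) has_real_derivative
          (2 * x * (K / 2 * exp (2 * C * x)) + x\<^sup>2 * (K / 2 * (exp (2 * C * x) * (2 * C))))) (at x)"
        by (auto intro!: derivative_eq_intros)
      have "((\<lambda>s. c * (s\<^sup>2 * v s) - s\<^sup>2 * V s - s\<^sup>2 * (K / 2 * exp (2 * C * s))) has_real_derivative ?d) (at x)"
        by (rule DERIV_diff[OF DERIV_diff[OF DERIV_cmult[OF v[OF x]] V[OF x]] e])
      then have "((\<lambda>s. s\<^sup>2 * (c * v s) - s\<^sup>2 * V s - s\<^sup>2 * (K / 2 * exp (2 * C * s))) has_real_derivative ?d) (at x)"
        by (simp only: mult.left_commute[of c])
      moreover have "0 \<le> 2 * x * (K / 2 * exp (2 * C * x))" using x K0 by (intro mult_nonneg_nonneg) auto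
      then have "?d \<le> 0" using dv[OF x c] by (simp add: algebra_simps)
      ultimately show "((\<lambda>s. s\<^sup>2 * (c * v s) - s\<^sup>2 * V s - s\<^sup>2 * (K / 2 * exp (2 * C * s))) has_real_derivative ?d) (at x) \<and> ?d \<le> 0"
        by blast
    qed
    have 3: "c * v s - V s \<le> K / 2 * exp (2 * C * s)" if "\<bar>c\<bar> = 1" for c
    proof -
      have "s\<^sup>2 * (c * v s - V s - K / 2 * exp (2 * C * s)) \<le> 0" using 2[OF that] by (simp add: right_diff_distrib)
      then show ?thesis using s by (simp add: mult_le_0_iff)
    qed
    have "\<bar>v s\<bar> - V s \<le> K / 2 * exp (2 * C * s)" using 3[of 1] 3[of "-1"] by (auto simp: abs_if)
    moreover have "0 \<le> K / 2 * exp (2 * C * s)" using K0 by simp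
    ultimately show ?thesis using 1 unfolding m_def by (intro max.boundedI) linarith+
  qed
  have "K \<le> K / 2" unfolding K_def
  proof (rule cSUP_least[OF ne], fold K_def)
    fix s assume "s \<in> {0<..T}"
    then have "exp (- 2 * C * s) * m s \<le> exp (- 2 * C * s) * (K / 2 * exp (2 * C * s))" using mK2[of s] by (intro mult_left_mono) auto
    also have "\<dots> = K / 2 * (exp (- 2 * C * s) * exp (2 * C * s))" by simp
    also have "\<dots> = K / 2" by (simp add: mult_exp_exp)
    finally show "exp (- 2 * C * s) * m s \<le> K / 2" .
  qed
  then have "K = 0" using K0 by simp
  then have "m s \<le> 0" using mK[OF s] by simp
  then show ?thesis by (auto simp: m_def)
qed

section \<open>Comparison of level curves\<close>

context centred_unit
begin

text \<open>
  The derivative of \<open>z exp (- u / (n + 1))\<close> by \<open>u = uc y\<close> is \<open>exp (- u / (n + 1))\<close> times the drift,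
  so the imaginary part of this product is the natural parameter of the level curve.
\<close>

definition hc :: "real \<Rightarrow> real" where
  "hc y = y * exp (- (uc y / (real n + 1)))"

definition hinv :: "real \<Rightarrow> real" where
  "hinv s = (THE y. y > 0 \<and> hc y = s)"

lemma drift_Im_pos: "Im z > 0 \<Longrightarrow> Im (drift z) > 0"
proof -
  assume z: "Im z > 0"
  then have "Im z / (cmod z)\<^sup>2 > 0" by (metis divide_pos_pos less_irrefl zero_complex.simps(2) zero_less_norm_iff zero_less_power)
  then show "Im (drift z) > 0" using drift_facts(2)[OF z] by linarith
qed

text \<open>The sign is that of \<open>Im (drift (zc y))\<close>, which is positive; this is what
  allows s to replace the height as parameter.\<close>

lemma hc_DERIV:
  assumes y: "y > 0"
  defines "\<eta> \<equiv> Im (drift (zc y))"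
  shows "(hc has_real_derivative exp (- (uc y / (real n + 1))) * (\<eta> / (\<eta> + y / (real n + 1)))) (at y)"
    and "exp (- (uc y / (real n + 1))) * (\<eta> / (\<eta> + y / (real n + 1))) > 0"
proof -
  define s where "s = \<eta> + y / (real n + 1)"
  have s: "s > 0" using speed_pos[of "zc y"] y by (simp add: s_def \<eta>_def)
  have \<eta>: "\<eta> > 0" using drift_Im_pos[of "zc y"] y by (simp add: \<eta>_def)
  have "(hc has_real_derivative (1 * exp (- (uc y / (real n + 1))) + exp (- (uc y / (real n + 1))) * (- ((1 / s) / (real n + 1))) * y)) (at y)"
    unfolding hc_def using curve_DERIV(1)[OF y]
    by (auto intro!: derivative_eq_intros simp: s_def \<eta>_def)
  also have "1 * exp (- (uc y / (real n + 1))) + exp (- (uc y / (real n + 1))) * (- ((1 / s) / (real n + 1))) * y = exp (- (uc y / (real n + 1))) * (\<eta> / s)"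
  proof -
    define r where "r = 1 / (real n + 1)"
    have "\<eta> = s - y * r" by (simp add: s_def r_def)
    then have "\<eta> / s = 1 - y * r / s" using s by (simp only: diff_divide_distrib) simp
    moreover have "1 / s / (real n + 1) = r / s" by (simp add: r_def)
    ultimately show ?thesis by (simp only:) (simp add: algebra_simps)
  qed
  finally show "(hc has_real_derivative exp (- (uc y / (real n + 1))) * (\<eta> / (\<eta> + y / (real n + 1)))) (at y)" by (simp add: s_def)
  show "exp (- (uc y / (real n + 1))) * (\<eta> / (\<eta> + y / (real n + 1))) > 0" using s \<eta> by (simp add: s_def)
qed

lemma hc_strict_mono: "0 < y \<Longrightarrow> y < y' \<Longrightarrow> hc y < hc y'"
proof (rule DERIV_pos_imp_increasing[of y y' hc])
  fix x assume "0 < y" "y \<le> x"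
  then have "x > 0" by simp
  then show "\<exists>d. (hc has_real_derivative d) (at x) \<and> d > 0" using hc_DERIV[of x] by blast
qed

lemma isCont_hc: "y > 0 \<Longrightarrow> isCont hc y" using hc_DERIV(1) DERIV_isCont by blast

lemma uc_strict_mono: "0 < y \<Longrightarrow> y < y' \<Longrightarrow> uc y < uc y'"
proof (rule DERIV_pos_imp_increasing[of y y' uc])
  fix x assume "0 < y" "y \<le> x"
  then show "\<exists>d. (uc has_real_derivative d) (at x) \<and> d > 0"
    using curve_DERIV(1)[of x] speed_pos[of "zc x"] by force
qed

lemma uc_nonneg: assumes "y > 0" shows "uc y \<ge> 0"
proof (rule tendsto_upperbound[OF uc_tendsto_0])
  show "eventually (\<lambda>r. uc r \<le> uc y) (at_right 0)"
    using eventually_at_right_real[OF assms] by (rule eventually_mono) (use uc_strict_mono in force)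
qed auto

lemma hc_pos: "y > 0 \<Longrightarrow> hc y > 0" by (simp add: hc_def)

lemma hc_le: "y > 0 \<Longrightarrow> hc y \<le> y"
  using uc_nonneg[of y] by (simp add: hc_def mult_le_cancel_left1 divide_le_0_iff)

lemma hc_surj:
  assumes "0 < y0" "0 < s" "s \<le> hc y0" shows "\<exists>y>0. y \<le> y0 \<and> hc y = s"
proof -
  \<comment> \<open>Since \<open>uc\<close> is nonnegative, hc r <= r <= s, so \<open>r\<close> is a
    lower starting point for the intermediate value theorem.\<close>
  define r where "r = min s y0"
  have r: "0 < r" "r \<le> y0" "hc r \<le> s" using assms hc_le[of r] by (auto simp: r_def)
  then obtain y where "r \<le> y" "y \<le> y0" "hc y = s"
    using IVT[of hc r s y0] assms isCont_hc by force
  then show ?thesis using r by (intro exI[of _ y]) auto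
qed

lemma hinv_hc [simp]: assumes "y > 0" shows "hinv (hc y) = y"
  unfolding hinv_def
proof (rule the_equality)
  fix z assume "z > 0 \<and> hc z = hc y"
  then show "z = y" using hc_strict_mono[of z y] hc_strict_mono[of y z] assms by (cases z y rule: linorder_cases) auto
qed (use assms in auto)

lemma hinv_DERIV:
  assumes y: "y > 0"
  defines "\<eta> \<equiv> Im (drift (zc y))"
  shows "(hinv has_real_derivative exp (uc y / (real n + 1)) * ((\<eta> + y / (real n + 1)) / \<eta>)) (at (hc y))"
proof -
  let ?D = "exp (- (uc y / (real n + 1))) * (\<eta> / (\<eta> + y / (real n + 1)))"
  have D: "(hc has_real_derivative ?D) (at y)" "?D > 0" using hc_DERIV[OF y] by (auto simp: \<eta>_def)
  have c: "isCont hinv (hc y)"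
    by (rule isCont_inverse_function2[of "y/2" y "2*y"]) (use y isCont_hc in auto)
  have "(hinv has_real_derivative inverse ?D) (at (hc y))"
  proof (rule DERIV_inverse_function[where a = "hc (y/2)" and b = "hc (2*y)"])
    show "(hc has_real_derivative ?D) (at (hinv (hc y)))" using D y by simp
    show "hc (y/2) < hc y" "hc y < hc (2*y)" using y by (auto intro: hc_strict_mono)
    fix s assume "hc (y/2) < s" "s < hc (2*y)"
    then obtain z where "z > 0" "hc z = s" using hc_surj[of "2*y" s] y hc_pos[of "y/2"] by auto
    then show "hc (hinv s) = s" by auto
  qed (use D c in auto)
  moreover have "inverse ?D = exp (uc y / (real n + 1)) * ((\<eta> + y / (real n + 1)) / \<eta>)"
    by (simp only: inverse_mult_distrib exp_minus inverse_inverse_eq inverse_divide)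
  ultimately show ?thesis by simp
qed

lemma hinv_tendsto: "filterlim hinv (at_right 0) (at_right 0)"
proof -
  have *: "eventually (\<lambda>s. 0 < hinv s \<and> hinv s < e) (at_right 0)" if e: "e > 0" for e
    using eventually_at_right_real[OF hc_pos[OF e]]
  proof (rule eventually_mono)
    fix s assume s: "s \<in> {0<..<hc e}"
    then obtain y where y: "y > 0" "y \<le> e" "hc y = s" using hc_surj[of e s] e by auto
    then have "y \<noteq> e" using s by auto
    then show "0 < hinv s \<and> hinv s < e" using y by auto
  qed
  have "(hinv \<longlongrightarrow> 0) (at_right 0)"
  proof (rule order_tendstoI)
    fix b :: real assume "b < 0"
    then show "eventually (\<lambda>x. b < hinv x) (at_right 0)" by (intro eventually_mono[OF *[of 1]]) auto
  next
    fix b :: real assume "0 < b"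
    then show "eventually (\<lambda>x. hinv x < b) (at_right 0)" by (intro eventually_mono[OF *[of b]]) auto
  qed
  then show ?thesis
    unfolding filterlim_at by (intro conjI eventually_mono[OF *[of 1]]) auto
qed

text \<open>Near 0 the cone of \<open>xc_small\<close> applies, and on the remaining interval
  compactness; the cut 1/2 only has to lie below 1. This is the a priori bound that
  \<open>cooperative_comparison\<close> asks for.\<close>

lemma slope_bounded: "\<exists>R. \<forall>y. 0 < y \<and> y \<le> y0 \<longrightarrow> \<bar>xc y / y\<bar> \<le> R"
proof -
  have "continuous_on {1/2..y0} (\<lambda>y. xc y / y)"
    by (intro continuous_at_imp_continuous_on ballI continuous_divide DERIV_isCont[OF curve_DERIV(2)] continuous_ident) auto
  then have "bounded ((\<lambda>y. xc y / y) ` {1/2..y0})"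
    by (intro compact_imp_bounded compact_continuous_image) auto
  then obtain R where *: "\<forall>w\<in>(\<lambda>y. xc y / y) ` {1/2..y0}. norm w \<le> R"
    unfolding bounded_iff by blast
  then have R: "\<bar>xc y / y\<bar> \<le> R" if "1/2 \<le> y" "y \<le> y0" for y
    using bspec[OF * imageI[of y]] that by simp
  have "\<bar>xc y / y\<bar> \<le> max R 1" if "0 < y" "y \<le> y0" for y
  proof (cases "y < 1/2")
    case True
    then have "\<bar>xc y / y\<bar> \<le> 1" using xc_small[of y] that by simp
    then show ?thesis by simp
  next
    case False
    then show ?thesis using R[of y] that by (simp add: le_max_iff_disj)
  qed
  then show ?thesis by blast
qed

text \<open>Put zeta = z exp (- sigma u). Then d zeta / du = exp (- sigma u) drift, s = Im zeta and
  s^2 x / y = Re zeta Im zeta; both formulas are quotients of derivatives with respect to u. The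
  combination xi y / eta + x in the second is the one controlled by the third part of
  \<open>drift_facts\<close>.\<close>

lemma curve_system:
  assumes y: "y > 0"
  defines "\<sigma> \<equiv> 1 / (real n + 1)" and "s \<equiv> hc y" and "\<eta> \<equiv> Im (drift (zc y))" and "\<xi> \<equiv> Re (drift (zc y))"
  shows "((\<lambda>s. uc (hinv s)) has_real_derivative exp (\<sigma> * uc y) / \<eta>) (at s)"
    and "((\<lambda>s. s\<^sup>2 * (xc (hinv s) / hinv s)) has_real_derivative exp (- (\<sigma> * uc y)) * (\<xi> * y / \<eta> + xc y)) (at s)"
proof -
  define S where "S = \<eta> + y * \<sigma>"
  have S0: "S > 0" using speed_pos[of "zc y"] y by (simp add: S_def \<eta>_def \<sigma>_def)
  have \<eta>0: "\<eta> > 0" using drift_Im_pos[of "zc y"] y by (simp add: \<eta>_def)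
  define E where "E = exp (\<sigma> * uc y)"
  have E0: "E > 0" by (simp add: E_def)
  have h: "(hinv has_real_derivative E * (S / \<eta>)) (at s)"
    using hinv_DERIV[OF y] by (simp add: S_def E_def \<sigma>_def \<eta>_def s_def mult.commute)
  have u: "(uc has_real_derivative 1 / S) (at (hinv s))" and x: "(xc has_real_derivative (\<xi> + xc y * \<sigma>) / S) (at (hinv s))"
    using curve_DERIV[OF y] y by (simp_all add: S_def \<sigma>_def \<eta>_def \<xi>_def s_def)
  have "((\<lambda>s. uc (hinv s)) has_real_derivative (1 / S) * (E * (S / \<eta>))) (at s)" by (rule DERIV_chain2[OF u h])
  then show "((\<lambda>s. uc (hinv s)) has_real_derivative E / \<eta>) (at s)" using S0 by simp
  define p where "p t = exp (- (2 * \<sigma> * uc t)) * (xc t * t)" for t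
  have "(p has_real_derivative (exp (- (2 * \<sigma> * uc y)) * (- (2 * \<sigma> * (1 / S))) * (xc y * y) + exp (- (2 * \<sigma> * uc y)) * ((\<xi> + xc y * \<sigma>) / S * y + xc y))) (at (hinv s))"
    unfolding p_def using u x y by (auto intro!: derivative_eq_intros simp: s_def)
  also have "exp (- (2 * \<sigma> * uc y)) * (- (2 * \<sigma> * (1 / S))) * (xc y * y) + exp (- (2 * \<sigma> * uc y)) * ((\<xi> + xc y * \<sigma>) / S * y + xc y)
     = exp (- (2 * \<sigma> * uc y)) * ((\<xi> * y + xc y * \<eta>) / S)"
  proof -
    have "- (2 * \<sigma> * (1 / S)) * (xc y * y) + ((\<xi> + xc y * \<sigma>) / S * y + xc y) = (- 2 * \<sigma> * xc y * y + (\<xi> + xc y * \<sigma>) * y + xc y * S) / S"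
    proof -
      have "xc y * S / S = xc y" using S0 by simp
      then show ?thesis unfolding add_divide_distrib[of _ _ S] by (simp add: add_divide_distrib distrib_right)
    qed
    also have "- 2 * \<sigma> * xc y * y + (\<xi> + xc y * \<sigma>) * y + xc y * S = \<xi> * y + xc y * \<eta>" by (simp add: S_def algebra_simps)
    finally show ?thesis by (simp only: mult.assoc distrib_left[symmetric])
  qed
  also have "exp (- (2 * \<sigma> * uc y)) = 1 / E\<^sup>2" by (simp add: E_def exp_minus exp_double mult.assoc inverse_eq_divide)
  finally have "(p has_real_derivative 1 / E\<^sup>2 * ((\<xi> * y + xc y * \<eta>) / S)) (at (hinv s))" .
  from DERIV_chain2[OF this h] have "((\<lambda>s. p (hinv s)) has_real_derivative 1 / E\<^sup>2 * ((\<xi> * y + xc y * \<eta>) / S) * (E * (S / \<eta>))) (at s)" .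
  also have "1 / E\<^sup>2 * ((\<xi> * y + xc y * \<eta>) / S) * (E * (S / \<eta>)) = 1 / E * (\<xi> * y / \<eta> + xc y)"
  proof -
    define q where "q = \<xi> * y / \<eta> + xc y"
    have "\<xi> * y + xc y * \<eta> = \<eta> * q" using \<eta>0 by (simp add: q_def distrib_left)
    then show ?thesis using E0 S0 \<eta>0 unfolding q_def[symmetric] by (simp add: power2_eq_square)
  qed
  also have "1 / E = exp (- (\<sigma> * uc y))" by (simp add: E_def exp_minus inverse_eq_divide)
  finally have D: "((\<lambda>s. p (hinv s)) has_real_derivative exp (- (\<sigma> * uc y)) * (\<xi> * y / \<eta> + xc y)) (at s)" .
  show "((\<lambda>s. s\<^sup>2 * (xc (hinv s) / hinv s)) has_real_derivative exp (- (\<sigma> * uc y)) * (\<xi> * y / \<eta> + xc y)) (at s)"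
  proof (rule has_field_derivative_transform_within_open[OF D])
    show "open {0<..<hc (2 * y)}" by simp
    show "s \<in> {0<..<hc (2 * y)}" using hc_pos hc_strict_mono[of y "2*y"] y by (auto simp: s_def)
    fix r assume "r \<in> {0<..<hc (2 * y)}"
    then obtain t where t: "t > 0" "hc t = r" using hc_surj[of "2*y" r] y by auto
    have "(hc t)\<^sup>2 = t\<^sup>2 * exp (- (2 * \<sigma> * uc t))"
      unfolding hc_def power_mult_distrib exp_double[symmetric] by (simp add: \<sigma>_def)
    then show "p (hinv r) = r\<^sup>2 * (xc (hinv r) / hinv r)"
      using t by (auto simp: p_def power2_eq_square)
  qed
qed

lemma norm_zc: "y > 0 \<Longrightarrow> (cmod (zc y))\<^sup>2 = y\<^sup>2 * (1 + (xc y / y)\<^sup>2)"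
  by (simp add: cmod_power2 power_divide distrib_left)

lemma y_eq_hc: "y = exp (1 / (real n + 1) * uc y) * hc y"
proof -
  have "exp (1 / (real n + 1) * uc y) * exp (- (uc y / (real n + 1))) = 1" by (simp add: exp_minus)
  then have "y * (exp (1 / (real n + 1) * uc y) * exp (- (uc y / (real n + 1)))) = y" by simp
  then show ?thesis unfolding hc_def by (simp only: mult.left_commute)
qed

end

text \<open>Equal parameters s belong to different heights y and y1. Substituting y = s exp (sigma
  u) in the drift bounds makes (u, x / y) for a a subsolution of the cooperative system; for b both
  bounds are equalities, so its pair is a solution.\<close>

lemma curve_comparison:
  fixes a b :: "'m::finite \<Rightarrow> real"
  assumes A: "centred_unit a n" and B: "centred_unit b n"
    and ext: "\<And>z. Im z > 0 \<Longrightarrow> centred_unit.drift b n z = of_real ((real n - 1) / sqrt (real n * (real n + 1))) - 1 / z"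
    and y: "y > 0" "y1 > 0" and eq: "centred_unit.hc a n y = centred_unit.hc b n y1"
  shows "centred_unit.uc a y \<le> centred_unit.uc b y1 \<and> \<bar>centred_unit.xc a y / y\<bar> \<le> centred_unit.xc b y1 / y1"
proof -
  interpret A: centred_unit a n by fact
  interpret B: centred_unit b n by fact
  define \<sigma> where "\<sigma> = 1 / (real n + 1)"
  define \<beta> where "\<beta> = (real n - 1) / sqrt (real n * (real n + 1))"
  define T where "T = A.hc y"
  have \<beta>: "\<beta> \<ge> 0" using A.n by (simp add: \<beta>_def)
  have T: "T > 0" using A.hc_pos[OF y(1)] by (simp add: T_def)
  have Asurj: "\<exists>t. 0 < t \<and> t \<le> y \<and> s = A.hc t" if "0 < s" "s \<le> T" for s
    using A.hc_surj[OF y(1), of s] that by (auto simp: T_def)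
  have Bsurj: "\<exists>t. 0 < t \<and> t \<le> y1 \<and> s = B.hc t" if "0 < s" "s \<le> T" for s
    using B.hc_surj[OF y(2), of s] that by (auto simp: T_def eq)
  obtain RA where RA: "\<And>t. 0 < t \<Longrightarrow> t \<le> y \<Longrightarrow> \<bar>A.xc t / t\<bar> \<le> RA" using A.slope_bounded[of y] by blast
  obtain RB where RB: "\<And>t. 0 < t \<Longrightarrow> t \<le> y1 \<Longrightarrow> \<bar>B.xc t / t\<bar> \<le> RB" using B.slope_bounded[of y1] by blast
  define R where "R = max (max RA RB) (max (A.uc y) (B.uc y1))"
  have Au: "A.uc t \<le> A.uc y" if "0 < t" "t \<le> y" for t using A.uc_strict_mono[of t y] that by (cases "t = y") auto
  have Bu: "B.uc t \<le> B.uc y1" if "0 < t" "t \<le> y1" for t using B.uc_strict_mono[of t y1] that by (cases "t = y1") auto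
  have "A.uc (A.hinv T) \<le> B.uc (B.hinv T) \<and> \<bar>A.xc (A.hinv T) / A.hinv T\<bar> \<le> B.xc (B.hinv T) / B.hinv T"
  proof (rule cooperative_comparison[where \<sigma> = \<sigma> and b = \<beta> and T = T and R = R
        and u = "\<lambda>s. A.uc (A.hinv s)" and v = "\<lambda>s. A.xc (A.hinv s) / A.hinv s"
        and U = "\<lambda>s. B.uc (B.hinv s)" and V = "\<lambda>s. B.xc (B.hinv s) / B.hinv s"
        and u' = "\<lambda>s. exp (\<sigma> * A.uc (A.hinv s)) / Im (A.drift (A.zc (A.hinv s)))"
        and w = "\<lambda>s. exp (- (\<sigma> * A.uc (A.hinv s))) * (Re (A.drift (A.zc (A.hinv s))) * A.hinv s / Im (A.drift (A.zc (A.hinv s))) + A.xc (A.hinv s))"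
        and U' = "\<lambda>s. exp (\<sigma> * B.uc (B.hinv s)) / Im (B.drift (B.zc (B.hinv s)))"
        and W = "\<lambda>s. exp (- (\<sigma> * B.uc (B.hinv s))) * (Re (B.drift (B.zc (B.hinv s))) * B.hinv s / Im (B.drift (B.zc (B.hinv s))) + B.xc (B.hinv s))"])
    show "((\<lambda>s. A.uc (A.hinv s)) \<longlongrightarrow> 0) (at_right 0)" by (rule filterlim_compose[OF A.uc_tendsto_0 A.hinv_tendsto])
    show "((\<lambda>s. B.uc (B.hinv s)) \<longlongrightarrow> 0) (at_right 0)" by (rule filterlim_compose[OF B.uc_tendsto_0 B.hinv_tendsto])
    fix s assume s: "0 < s" "s \<le> T"
    obtain t where t: "0 < t" "t \<le> y" "s = A.hc t" using Asurj[OF s] by blast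
    obtain r where r: "0 < r" "r \<le> y1" "s = B.hc r" using Bsurj[OF s] by blast
    have ht: "A.hinv s = t" using A.hinv_hc[OF t(1)] t(3) by simp
    have hr: "B.hinv s = r" using B.hinv_hc[OF r(1)] r(3) by simp
    show "((\<lambda>s. A.uc (A.hinv s)) has_real_derivative exp (\<sigma> * A.uc (A.hinv s)) / Im (A.drift (A.zc (A.hinv s)))) (at s)"
      using A.curve_system(1)[OF t(1)] unfolding ht unfolding \<sigma>_def t(3) .
    show "((\<lambda>s. B.uc (B.hinv s)) has_real_derivative exp (\<sigma> * B.uc (B.hinv s)) / Im (B.drift (B.zc (B.hinv s)))) (at s)"
      using B.curve_system(1)[OF r(1)] unfolding hr unfolding \<sigma>_def r(3) .
    show "((\<lambda>s. s\<^sup>2 * (A.xc (A.hinv s) / A.hinv s)) has_real_derivative exp (- (\<sigma> * A.uc (A.hinv s))) * (Re (A.drift (A.zc (A.hinv s))) * A.hinv s / Im (A.drift (A.zc (A.hinv s))) + A.xc (A.hinv s))) (at s)"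
      using A.curve_system(2)[OF t(1)] unfolding ht unfolding \<sigma>_def t(3) .
    show "((\<lambda>s. s\<^sup>2 * (B.xc (B.hinv s) / B.hinv s)) has_real_derivative exp (- (\<sigma> * B.uc (B.hinv s))) * (Re (B.drift (B.zc (B.hinv s))) * B.hinv s / Im (B.drift (B.zc (B.hinv s))) + B.xc (B.hinv s))) (at s)"
      using B.curve_system(2)[OF r(1)] unfolding hr unfolding \<sigma>_def r(3) .
    define E where "E = exp (\<sigma> * A.uc t)"
    define F where "F = exp (\<sigma> * B.uc r)"
    have E: "E > 0" "exp (- (\<sigma> * A.uc t)) = 1 / E" "exp (2 * \<sigma> * A.uc t) = E * E" and F: "F > 0" "exp (- (\<sigma> * B.uc r)) = 1 / F" "exp (2 * \<sigma> * B.uc r) = F * F"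
      by (simp_all add: E_def F_def exp_minus inverse_eq_divide mult.assoc exp_double power2_eq_square)
    have tE: "t = E * s" using A.y_eq_hc[of t] by (simp add: E_def \<sigma>_def t)
    have rF: "r = F * s" using B.y_eq_hc[of r] by (simp add: F_def \<sigma>_def r)
    define nt where "nt = (cmod (A.zc t))\<^sup>2"
    define nr where "nr = (cmod (B.zc r))\<^sup>2"
    have nt: "nt = t\<^sup>2 * (1 + (A.xc t / t)\<^sup>2)" using A.norm_zc[OF t(1)] by (simp add: nt_def)
    have nr: "nr = r\<^sup>2 * (1 + (B.xc r / r)\<^sup>2)" using B.norm_zc[OF r(1)] by (simp add: nr_def)
    have nt0: "nt > 0" unfolding nt using t(1) by (intro mult_pos_pos add_pos_nonneg) auto
    have nr0: "nr > 0" unfolding nr using r(1) by (intro mult_pos_pos add_pos_nonneg) auto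
    define \<eta> where "\<eta> = Im (A.drift (A.zc t))"
    have \<eta>: "\<eta> > 0" "t / nt \<le> \<eta>" using A.drift_Im_pos[of "A.zc t"] A.drift_facts(2)[of "A.zc t"] t by (auto simp: \<eta>_def nt_def)
    have "1 / \<eta> \<le> nt / t" using \<eta> nt0 t(1) by (simp add: field_simps)
    then have "E / \<eta> \<le> E * (nt / t)" using E mult_left_mono[of "1 / \<eta>" "nt / t" E] by simp
    also have "nt / t = t * (1 + (A.xc t / t)\<^sup>2)" using t(1) by (simp add: nt power2_eq_square)
    also have "E * (t * (1 + (A.xc t / t)\<^sup>2)) = E * E * s * (1 + (A.xc t / t)\<^sup>2)" by (subst tE) (simp add: mult.assoc)
    finally show "exp (\<sigma> * A.uc (A.hinv s)) / Im (A.drift (A.zc (A.hinv s))) \<le> exp (2 * \<sigma> * A.uc (A.hinv s)) * s * (1 + (A.xc (A.hinv s) / A.hinv s)\<^sup>2)"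
      unfolding ht E(3) E_def[symmetric] \<eta>_def[symmetric] .
    define \<xi> where "\<xi> = Re (A.drift (A.zc t))"
    have \<xi>: "c * (t * \<xi>) \<le> (\<beta> * nt - c * A.xc t) * \<eta>" if "\<bar>c\<bar> = 1" for c
      using A.drift_facts(3)[of "A.zc t", OF _ that] t by (simp add: \<xi>_def \<eta>_def nt_def \<beta>_def)
    have "c * (\<xi> * t / \<eta> + A.xc t) \<le> \<beta> * nt" if "\<bar>c\<bar> = 1" for c
      using \<xi>[OF that] \<eta>(1) by (simp add: field_simps)
    \<comment> \<open>The two signs in the third drift bound together control the derivative of s^2
      v in absolute value.\<close>
    from this[of 1] this[of "-1"] have "\<bar>\<xi> * t / \<eta> + A.xc t\<bar> \<le> \<beta> * nt" by (simp add: abs_le_iff)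
    then have "\<bar>1 / E * (\<xi> * t / \<eta> + A.xc t)\<bar> \<le> 1 / E * (\<beta> * nt)"
      unfolding abs_mult using E by (intro mult_mono) auto
    also have "\<dots> = \<beta> * s\<^sup>2 * E * (1 + (A.xc t / t)\<^sup>2)"
    proof -
      have "1 / E * t\<^sup>2 = s\<^sup>2 * E" unfolding tE using E(1) by (simp add: power2_eq_square)
      moreover have "1 / E * (\<beta> * nt) = \<beta> * (1 / E * t\<^sup>2) * (1 + (A.xc t / t)\<^sup>2)" unfolding nt by simp
      ultimately show ?thesis by (simp only: mult.assoc)
    qed
    finally show "\<bar>exp (- (\<sigma> * A.uc (A.hinv s))) * (Re (A.drift (A.zc (A.hinv s))) * A.hinv s / Im (A.drift (A.zc (A.hinv s))) + A.xc (A.hinv s))\<bar>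
        \<le> \<beta> * s\<^sup>2 * exp (\<sigma> * A.uc (A.hinv s)) * (1 + (A.xc (A.hinv s) / A.hinv s)\<^sup>2)"
      unfolding ht E(2) E_def[symmetric] \<eta>_def[symmetric] \<xi>_def[symmetric] .
    have dB: "B.drift (B.zc r) = of_real \<beta> - 1 / B.zc r" using ext[of "B.zc r"] r by (simp add: \<beta>_def)
    have ImB: "Im (B.drift (B.zc r)) = r / nr" unfolding dB by (simp add: Im_divide nr_def cmod_power2)
    have ReB: "Re (B.drift (B.zc r)) = \<beta> - B.xc r / nr" unfolding dB by (simp add: Re_divide nr_def cmod_power2)
    have "nr / r = r * (1 + (B.xc r / r)\<^sup>2)" using r(1) by (simp add: nr power2_eq_square)
    then have "F / (r / nr) = F * (r * (1 + (B.xc r / r)\<^sup>2))"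
      by (metis divide_divide_eq_right times_divide_eq_right)
    also have "\<dots> = F * F * s * (1 + (B.xc r / r)\<^sup>2)" by (subst rF) (simp add: mult.assoc)
    finally show "exp (\<sigma> * B.uc (B.hinv s)) / Im (B.drift (B.zc (B.hinv s))) = exp (2 * \<sigma> * B.uc (B.hinv s)) * s * (1 + (B.xc (B.hinv s) / B.hinv s)\<^sup>2)"
      unfolding hr F(3) F_def[symmetric] ImB .
    have "(\<beta> - B.xc r / nr) * r / (r / nr) + B.xc r = \<beta> * nr" using r(1) nr0 by (simp add: field_simps)
    moreover have "1 / F * (\<beta> * nr) = \<beta> * s\<^sup>2 * F * (1 + (B.xc r / r)\<^sup>2)"
    proof -
      have "1 / F * r\<^sup>2 = s\<^sup>2 * F" unfolding rF using F(1) by (simp add: power2_eq_square)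
      moreover have "1 / F * (\<beta> * nr) = \<beta> * (1 / F * r\<^sup>2) * (1 + (B.xc r / r)\<^sup>2)" unfolding nr by simp
      ultimately show ?thesis by (simp only: mult.assoc)
    qed
    ultimately have "1 / F * ((\<beta> - B.xc r / nr) * r / (r / nr) + B.xc r) = \<beta> * s\<^sup>2 * F * (1 + (B.xc r / r)\<^sup>2)" by simp
    then show "exp (- (\<sigma> * B.uc (B.hinv s))) * (Re (B.drift (B.zc (B.hinv s))) * B.hinv s / Im (B.drift (B.zc (B.hinv s))) + B.xc (B.hinv s))
        = \<beta> * s\<^sup>2 * exp (\<sigma> * B.uc (B.hinv s)) * (1 + (B.xc (B.hinv s) / B.hinv s)\<^sup>2)"
      unfolding hr F(2) F_def[symmetric] ImB ReB .
    show "0 \<le> A.uc (A.hinv s) \<and> A.uc (A.hinv s) \<le> R \<and> 0 \<le> B.uc (B.hinv s) \<and> B.uc (B.hinv s) \<le> R \<and>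
         \<bar>A.xc (A.hinv s) / A.hinv s\<bar> \<le> R \<and> \<bar>B.xc (B.hinv s) / B.hinv s\<bar> \<le> R"
      unfolding ht hr using A.uc_nonneg[OF t(1)] B.uc_nonneg[OF r(1)] Au[OF t(1,2)] Bu[OF r(1,2)] RA[OF t(1,2)] RB[OF r(1,2)]
      unfolding R_def by linarith
  qed (use \<beta> T in \<open>auto simp: \<sigma>_def\<close>)
  moreover have "A.hinv T = y" "B.hinv T = y1" using y by (simp_all add: T_def, simp add: eq)
  ultimately show ?thesis by simp
qed

text \<open>If u were larger for a at height y, its parameter s = y exp (- u / (n + 1)) would be
  smaller than that of b, hence attained by b at some y1 <= y. There \<open>curve_comparison\<close>
  bounds u for a by u for b at y1, hence by u for b at y: a contradiction.\<close>

lemma curve_level_le: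
  fixes a b :: "'m::finite \<Rightarrow> real"
  assumes A: "centred_unit a n" and B: "centred_unit b n"
    and ext: "\<And>z. Im z > 0 \<Longrightarrow> centred_unit.drift b n z = of_real ((real n - 1) / sqrt (real n * (real n + 1))) - 1 / z"
    and y: "y > 0"
  shows "centred_unit.uc a y \<le> centred_unit.uc b y"
proof (rule ccontr)
  interpret A: centred_unit a n by fact
  interpret B: centred_unit b n by fact
  assume "\<not> ?thesis"
  then have less: "B.uc y < A.uc y" by simp
  then have "- (A.uc y / (real n + 1)) < - (B.uc y / (real n + 1))" by (simp add: divide_strict_right_mono)
  then have "A.hc y < B.hc y" unfolding A.hc_def B.hc_def using y by (intro mult_strict_left_mono) auto
  then obtain y1 where y1: "0 < y1" "y1 \<le> y" "B.hc y1 = A.hc y"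
    using B.hc_surj[OF y A.hc_pos[OF y] less_imp_le] by blast
  then have "A.uc y \<le> B.uc y1" using curve_comparison[OF A B ext y y1(1)] by simp
  also have "\<dots> \<le> B.uc y" using B.uc_strict_mono[of y1 y] y1 by (cases "y1 = y") auto
  finally show False using less by simp
qed

text \<open>Equal levels mean equal parameters, so |x_a| <= x_b. They also mean equal derivatives of
  u, so equal imaginary parts of the drift; this part is y / |z_b|^2 for b and at least y / |z_a|^2
  for a, so |z_b| <= |z_a|.\<close>

lemma curve_eq:
  fixes a b :: "'m::finite \<Rightarrow> real"
  assumes A: "centred_unit a n" and B: "centred_unit b n"
    and ext: "\<And>z. Im z > 0 \<Longrightarrow> centred_unit.drift b n z = of_real ((real n - 1) / sqrt (real n * (real n + 1))) - 1 / z"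
    and eq: "\<And>y. y > 0 \<Longrightarrow> centred_unit.uc a y = centred_unit.uc b y"
    and y: "y > 0"
  shows "\<bar>centred_unit.xc a y\<bar> = \<bar>centred_unit.xc b y\<bar>"
proof -
  interpret A: centred_unit a n by fact
  interpret B: centred_unit b n by fact
  have "A.hc y = B.hc y" using eq[OF y] by (simp add: A.hc_def B.hc_def)
  then have "\<bar>A.xc y / y\<bar> \<le> B.xc y / y" using curve_comparison[OF A B ext y y] by simp
  then have 1: "\<bar>A.xc y\<bar> \<le> B.xc y" using y by (simp add: divide_le_cancel)
  have "(A.uc has_real_derivative 1 / (Im (B.drift (B.zc y)) + y / (real n + 1))) (at y)"
  proof (rule has_field_derivative_transform_within_open[OF B.curve_DERIV(1)[OF y]])
    show "open {0 :: real<..}" "y \<in> {0<..}" using y by auto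
    show "B.uc t = A.uc t" if "t \<in> {0<..}" for t using eq[of t] that by simp
  qed
  then have "1 / (Im (B.drift (B.zc y)) + y / (real n + 1)) = 1 / (Im (A.drift (A.zc y)) + y / (real n + 1))"
    using A.curve_DERIV(1)[OF y] by (rule DERIV_unique)
  then have "Im (B.drift (B.zc y)) = Im (A.drift (A.zc y))"
    by (simp only: divide_cancel_left one_neq_zero simp_thms add_right_cancel)
  moreover have "Im (B.drift (B.zc y)) = y / (cmod (B.zc y))\<^sup>2"
    using ext[of "B.zc y"] y by (simp add: Im_divide cmod_power2)
  ultimately have "y / (cmod (A.zc y))\<^sup>2 \<le> y / (cmod (B.zc y))\<^sup>2"
    using A.drift_facts(2)[of "A.zc y"] y by simp
  moreover have "(cmod (A.zc y))\<^sup>2 > 0" "(cmod (B.zc y))\<^sup>2 > 0" using y by (auto simp: cmod_power2 intro!: add_nonneg_pos)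
  ultimately have "(cmod (B.zc y))\<^sup>2 \<le> (cmod (A.zc y))\<^sup>2"
    using y divide_strict_left_mono[of "(cmod (A.zc y))\<^sup>2" "(cmod (B.zc y))\<^sup>2" y] by (meson linorder_not_le mult_pos_pos)
  then have "(B.xc y)\<^sup>2 \<le> (A.xc y)\<^sup>2" by (simp add: cmod_power2)
  then have "\<bar>B.xc y\<bar> \<le> \<bar>A.xc y\<bar>" by (simp only: abs_le_square_iff)
  with 1 show ?thesis by simp
qed

section \<open>The integral along the imaginary axis\<close>

text \<open>Polynomials that agree at infinitely many points are equal, and then so are their
  multisets of roots.\<close>

lemma prod_linear_eq_imp_permutes:
  fixes a b :: "'m::finite \<Rightarrow> real"
  assumes inf: "infinite {w :: complex. (\<Prod>j\<in>UNIV. w - of_real (a j)) = (\<Prod>j\<in>UNIV. w - of_real (b j))}"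
  shows "\<exists>\<pi>. \<pi> permutes (UNIV :: 'm set) \<and> (\<forall>j. a j = b (\<pi> j))"
proof -
  define p where "p c = (\<Prod>j\<in>UNIV. [:- complex_of_real (c j), 1:])" for c :: "'m \<Rightarrow> real"
  have pev: "poly (p c) w = (\<Prod>j\<in>UNIV. w - of_real (c j))" for c w
    unfolding p_def by (simp add: poly_prod)
  have "p a - p b = 0"
  proof (rule ccontr)
    assume "p a - p b \<noteq> 0"
    then have "finite {w. poly (p a - p b) w = 0}" by (rule poly_roots_finite)
    moreover have "{w. (\<Prod>j\<in>UNIV. w - of_real (a j)) = (\<Prod>j\<in>UNIV. w - of_real (b j))} = {w. poly (p a - p b) w = 0}"
      by (simp add: pev)
    ultimately show False using inf by simp
  qed
  then have "p a = p b" by simp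
  have pr: "proots (p c) = image_mset (\<lambda>j. complex_of_real (c j)) (mset_set UNIV)" for c
    unfolding p_def
    by (subst proots_prod) (simp_all add: sum_unfold_sum_mset)
  have eq: "image_mset (\<lambda>j. complex_of_real (a j)) (mset_set UNIV) = image_mset (\<lambda>j. complex_of_real (b j)) (mset_set UNIV)"
    unfolding pr[symmetric] \<open>p a = p b\<close> by (rule refl)
  obtain \<pi> where "\<pi> permutes (UNIV :: 'm set)" "\<forall>x\<in>UNIV. complex_of_real (a x) = complex_of_real (b (\<pi> x))"
    by (rule image_mset_eq_implies_permutes[OF finite eq])
  then show ?thesis by auto
qed

section \<open>Deformation of the contour\<close>

context centred_unit
begin

definition char_fun :: "complex \<Rightarrow> complex" where
  "char_fun z = 1 / (\<Prod>j\<in>UNIV. 1 - of_real (a j) * z)"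

lemma char_fun_eq: "z \<in> slit \<Longrightarrow> char_fun z = exp (- llog z)"
  by (simp add: char_fun_def exp_minus exp_llog inverse_eq_divide)

lemma char_fun_zc: "y > 0 \<Longrightarrow> char_fun (zc y) = of_real (exp (- uc y))"
  by (simp add: char_fun_eq upper_slit llog_zc flip: exp_of_real)

lemma open_slit: "open slit"
proof -
  have eq: "slit = {z. Im z < 0} \<union> {z. Im z > 0} \<union> ({z. Re z < 1} \<inter> {z. Re z > - 1})"
    by (auto simp: slit_def abs_less_iff)
  show ?thesis
    unfolding eq by (intro open_Un open_Int open_halfspace_Im_lt open_halfspace_Im_gt open_halfspace_Re_lt open_halfspace_Re_gt)
qed

lemma starlike_slit: "starlike slit"
  unfolding starlike_def
proof (intro bexI ballI subsetI)
  fix z w assume z: "z \<in> slit" and "w \<in> closed_segment 0 z"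
  then obtain t where t: "0 \<le> t" "t \<le> 1" "w = t *\<^sub>R z" by (auto simp: closed_segment_def)
  show "w \<in> slit"
  proof (cases "t = 0 \<or> Im z = 0")
    case True
    have "\<bar>t * Re z\<bar> < 1" if "\<bar>Re z\<bar> < 1"
      using t that mult_left_le_one_le[of "\<bar>Re z\<bar>" t] by (simp add: abs_mult)
    then show ?thesis using True z t by (auto simp: slit_def)
  qed (use t in \<open>auto simp: slit_def\<close>)
qed (auto simp: slit_def)

text \<open>\<open>slit\<close> is starlike about 0 and 1 / P is holomorphic there. Increments of a
  primitive stand in for contour integrals, so path independence is built in.\<close>

lemma ex_primitive: "\<exists>G. \<forall>z\<in>slit. (G has_field_derivative char_fun z) (at z)"
proof (rule holomorphic_starlike_primitive)
  show D: "char_fun field_differentiable at x" if "x \<in> slit - {}" for x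
  proof -
    have x: "x \<in> slit" using that by simp
    have "((\<lambda>z. exp (- llog z)) has_field_derivative exp (- llog x) * - (- logd x)) (at x)"
      by (intro DERIV_chain2[OF DERIV_exp] DERIV_minus llog_DERIV x)
    then have "(char_fun has_field_derivative exp (- llog x) * - (- logd x)) (at x)"
      by (rule has_field_derivative_transform_within_open[OF _ open_slit x]) (simp add: char_fun_eq)
    then show ?thesis by (auto simp: field_differentiable_def)
  qed
  show "continuous_on slit char_fun"
    using D by (intro continuous_at_imp_continuous_on ballI field_differentiable_imp_continuous_at) auto
qed (use open_slit starlike_slit in auto)

definition prim :: "complex \<Rightarrow> complex" where
  "prim = (SOME G. \<forall>z\<in>slit. (G has_field_derivative char_fun z) (at z))"

lemma prim: "z \<in> slit \<Longrightarrow> (prim has_field_derivative char_fun z) (at z)"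
  using someI_ex[OF ex_primitive] unfolding prim_def by blast

text \<open>1 / P = exp (- u) is real on the curve, so of exp (- u) (dx + i dy) only the dy term
  reaches the imaginary part.\<close>

lemma prim_zc_DERIV: 
  assumes y: "y > 0" shows "((\<lambda>y. Im (prim (zc y))) has_real_derivative exp (- uc y)) (at y)"
proof -
  obtain d where d: "(xc has_real_derivative d) (at y)" using curve_DERIV(2)[OF y] by blast
  have zc: "zc = (\<lambda>y. of_real (xc y) + \<i> * of_real y)" by (auto simp: complex_eq_iff)
  have "(zc has_vector_derivative (of_real d + \<i>)) (at y)"
    unfolding zc using d by (auto intro!: derivative_eq_intros simp: has_real_derivative_iff_has_vector_derivative)
  then have "((prim \<circ> zc) has_vector_derivative (of_real d + \<i>) * char_fun (zc y)) (at y)"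
    by (rule field_vector_diff_chain_at) (use y in \<open>auto intro!: prim upper_slit\<close>)
  then have "((\<lambda>y. Im (prim (zc y))) has_real_derivative Im ((of_real d + \<i>) * char_fun (zc y))) (at y)"
    unfolding o_def by (rule has_real_derivative_Im)
  also have "Im ((of_real d + \<i>) * char_fun (zc y)) = exp (- uc y)" by (simp add: char_fun_zc y del: of_real_exp)
  finally show ?thesis .
qed

lemma prim_axis_integral:
  assumes "R \<ge> 0"
  shows "((\<lambda>t. Re (char_fun (\<i> * of_real t))) has_integral (Im (prim (\<i> * of_real R)) - Im (prim 0))) {0..R}"
proof -
  have "((\<lambda>t. Re (char_fun (\<i> * of_real t))) has_integral (Im (prim (\<i> * of_real R)) - Im (prim (\<i> * of_real 0)))) {0..R}"
  proof (rule fundamental_theorem_of_calculus[OF assms])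
    fix t :: real
    have "((\<lambda>t. \<i> * of_real t) has_vector_derivative \<i>) (at t)" by (auto intro!: derivative_eq_intros)
    moreover have "\<i> * of_real t \<in> slit" by (auto simp: slit_def)
    ultimately have "((prim \<circ> (\<lambda>t. \<i> * of_real t)) has_vector_derivative \<i> * char_fun (\<i> * of_real t)) (at t)"
      by (intro field_vector_diff_chain_at prim)
    then have "((\<lambda>t. Im (prim (\<i> * of_real t))) has_real_derivative Im (\<i> * char_fun (\<i> * of_real t))) (at t)"
      unfolding o_def by (rule has_real_derivative_Im)
    then show "((\<lambda>t. Im (prim (\<i> * of_real t))) has_vector_derivative Re (char_fun (\<i> * of_real t))) (at t within {0..R})"
      by (simp add: has_real_derivative_iff_has_vector_derivative has_vector_derivative_at_within)
  qed
  then show ?thesis by simp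
qed

lemma prim_zc_tendsto_0: "((\<lambda>y. Im (prim (zc y))) \<longlongrightarrow> Im (prim 0)) (at_right 0)"
proof -
  have "isCont prim 0" by (rule DERIV_isCont[OF prim]) (simp add: slit_def)
  then show ?thesis by (intro tendsto_Im isCont_tendsto_compose[OF _ zc_tendsto_0])
qed

text \<open>A nonzero vector of sum 0 has a positive and a negative coordinate; these two factors
  give the quadratic decay for every n >= 1.\<close>

lemma ex_char_fun_bound: "\<exists>C R0. R0 > 0 \<and> (\<forall>z. Im z \<ge> R0 \<longrightarrow> norm (char_fun z) \<le> C / (Im z)\<^sup>2)"
proof -
  obtain k l where k: "a k > 0" and l: "a l < 0" using ex_pos ex_neg by blast
  have kl: "k \<noteq> l" using k l by auto
  \<comment> \<open>From height \<open>R0\<close> on, |a_j| Im z >= 1 for each nonzero a_j, so every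
    factor has modulus at least 1. The summand 1 makes \<open>R0\<close> positive.\<close>
  define R0 where "R0 = 1 + (\<Sum>j\<in>UNIV. if a j = 0 then 0 else 1 / \<bar>a j\<bar>)"
  have R0: "R0 > 0" unfolding R0_def by (intro add_pos_nonneg sum_nonneg) auto
  have R0j: "1 \<le> \<bar>a j\<bar> * R0" if "a j \<noteq> 0" for j
  proof -
    have "(if a j = 0 then 0 else 1 / \<bar>a j\<bar>) \<le> (\<Sum>j\<in>UNIV. if a j = 0 then 0 else 1 / \<bar>a j\<bar>)"
      by (rule member_le_sum) auto
    then have "1 / \<bar>a j\<bar> \<le> R0" using that unfolding R0_def by (simp only: if_False)
    then show ?thesis using that by (simp add: pos_divide_le_eq mult.commute)
  qed
  have "norm (char_fun z) \<le> (1 / (\<bar>a k\<bar> * \<bar>a l\<bar>)) / (Im z)\<^sup>2" if z: "Im z \<ge> R0" for z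
  proof -
    have Im: "\<bar>a j\<bar> * Im z \<le> norm (1 - of_real (a j) * z)" for j
      using abs_Im_le_cmod[of "1 - of_real (a j) * z"] z R0 by (simp add: abs_mult)
    have ge1: "1 \<le> norm (1 - of_real (a j) * z)" for j
    proof (cases "a j = 0")
      case False
      have "1 \<le> \<bar>a j\<bar> * R0" by (rule R0j[OF False])
      also have "\<dots> \<le> \<bar>a j\<bar> * Im z" using z by (intro mult_left_mono) auto
      finally show ?thesis using Im[of j] by linarith
    qed simp
    have "(\<bar>a k\<bar> * Im z) * (\<bar>a l\<bar> * Im z) \<le> norm (1 - of_real (a k) * z) * norm (1 - of_real (a l) * z)"
      using z R0 by (intro mult_mono Im) auto
    also have "\<dots> = (\<Prod>j\<in>{k,l}. norm (1 - of_real (a j) * z))" using kl by simp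
    also have "\<dots> \<le> (\<Prod>j\<in>UNIV. norm (1 - of_real (a j) * z))"
      by (rule prod_mono2) (auto intro: ge1)
    finally have "(\<bar>a k\<bar> * \<bar>a l\<bar>) * (Im z)\<^sup>2 \<le> norm (\<Prod>j\<in>UNIV. 1 - of_real (a j) * z)"
      by (simp only: prod_norm power2_eq_square mult_ac)
    moreover have pos: "(\<bar>a k\<bar> * \<bar>a l\<bar>) * (Im z)\<^sup>2 > 0" using k l z R0 by (intro mult_pos_pos) auto
    ultimately have "1 / norm (\<Prod>j\<in>UNIV. 1 - of_real (a j) * z) \<le> 1 / ((\<bar>a k\<bar> * \<bar>a l\<bar>) * (Im z)\<^sup>2)"
      by (intro divide_left_mono mult_pos_pos[OF _ pos]) linarith+
    then show ?thesis by (simp add: char_fun_def norm_divide)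
  qed
  then show ?thesis using R0 by blast
qed

text \<open>The segment joining the axis to the curve at height R has length at most n R, and 1 / P
  is O(1 / R^2) on it.\<close>

lemma prim_zc_minus_axis: "((\<lambda>R. Im (prim (zc R)) - Im (prim (\<i> * of_real R))) \<longlongrightarrow> 0) at_top"
proof -
  obtain C R0 where R0: "R0 > 0" and C: "\<And>z. Im z \<ge> R0 \<Longrightarrow> norm (char_fun z) \<le> C / (Im z)\<^sup>2"
    using ex_char_fun_bound by blast
  obtain Y where Y: "\<And>y. y \<ge> Y \<Longrightarrow> \<bar>xc y\<bar> \<le> real n * y" using xc_large by auto
  have bd: "norm (Im (prim (zc R)) - Im (prim (\<i> * of_real R))) \<le> C * real n / R" if R: "R \<ge> max R0 Y" for R
  proof -
    have R': "R \<ge> R0" "R \<ge> Y" "R > 0" using R R0 by auto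
    have "norm (prim (zc R) - prim (\<i> * of_real R)) \<le> C / R\<^sup>2 * norm (zc R - \<i> * of_real R)"
    proof (rule field_differentiable_bound[of "{z. Im z = R}" prim char_fun])
      have "{z. Im z = R} = {z. R \<le> Im z} \<inter> {z. Im z \<le> R}" by auto
      then show "convex {z. Im z = R}" by (simp only: convex_Int convex_halfspace_Im_ge convex_halfspace_Im_le)
      fix z assume "z \<in> {z. Im z = R}"
      then have z: "Im z = R" by simp
      show "(prim has_field_derivative char_fun z) (at z within {z. Im z = R})"
        using z R' by (intro has_field_derivative_at_within[OF prim] upper_slit) auto
      show "norm (char_fun z) \<le> C / R\<^sup>2" using C[of z] z R' by simp
    qed auto
    also have "zc R - \<i> * of_real R = of_real (xc R)" by (simp add: complex_eq_iff)
    also have "C / R\<^sup>2 * norm (of_real (xc R) :: complex) \<le> C / R\<^sup>2 * (real n * R)"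
    proof (rule mult_left_mono)
      show "norm (of_real (xc R) :: complex) \<le> real n * R" using Y[of R] R'(2) by (simp only: norm_of_real)
      have "0 \<le> norm (char_fun (\<i> * of_real R))" by simp
      also have "\<dots> \<le> C / R\<^sup>2" using C[of "\<i> * of_real R"] R' by simp
      finally show "0 \<le> C / R\<^sup>2" .
    qed
    also have "\<dots> = C * real n / R" using R' by (simp add: power2_eq_square)
    finally have "norm (prim (zc R) - prim (\<i> * of_real R)) \<le> C * real n / R" .
    moreover have "norm (Im (prim (zc R)) - Im (prim (\<i> * of_real R))) \<le> norm (prim (zc R) - prim (\<i> * of_real R))"
      using abs_Im_le_cmod[of "prim (zc R) - prim (\<i> * of_real R)"] by (simp only: minus_complex.sel real_norm_def)
    ultimately show ?thesis by (rule order_trans[rotated])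
  qed
  show ?thesis
  proof (rule Lim_null_comparison)
    show "eventually (\<lambda>R. norm (Im (prim (zc R)) - Im (prim (\<i> * of_real R))) \<le> C * real n / R) at_top"
      using eventually_ge_at_top[of "max R0 Y"] by eventually_elim (rule bd)
    show "((\<lambda>R. C * real n / R) \<longlongrightarrow> 0) at_top"
      by (rule tendsto_divide_0[OF tendsto_const filterlim_at_top_imp_at_infinity[OF filterlim_ident]])
  qed
qed

lemma prim_zc_limit:
  assumes "((\<lambda>R. integral {0..R} (\<lambda>t. Re (char_fun (\<i> * of_real t)))) \<longlongrightarrow> l) at_top"
  shows "((\<lambda>R. Im (prim (zc R)) - Im (prim 0)) \<longlongrightarrow> l) at_top"
proof -
  have "eventually (\<lambda>R. integral {0..R} (\<lambda>t. Re (char_fun (\<i> * of_real t))) = Im (prim (\<i> * of_real R)) - Im (prim 0)) at_top"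
    using eventually_ge_at_top[of 0] by eventually_elim (rule integral_unique[OF prim_axis_integral])
  then have "((\<lambda>R. Im (prim (\<i> * of_real R)) - Im (prim 0)) \<longlongrightarrow> l) at_top"
    using assms by (rule Lim_transform_eventually[rotated])
  from tendsto_add[OF prim_zc_minus_axis this] show ?thesis by simp
qed

end

text \<open>At each height the two curves coincide or are mirror images, and one of these cases
  occurs at infinitely many heights. There P for a, or for - a in the mirrored case, takes the same
  values as P for b.\<close>

lemma level_curve_rigidity:
  fixes a b :: "'m::finite \<Rightarrow> real"
  assumes A: "centred_unit a n" and B: "centred_unit b n"
    and eq: "\<And>y. y > 0 \<Longrightarrow> centred_unit.uc a y = centred_unit.uc b y \<and> \<bar>centred_unit.xc a y\<bar> = \<bar>centred_unit.xc b y\<bar>"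
  shows "\<exists>\<pi> s. \<pi> permutes (UNIV :: 'm set) \<and> s \<in> {1, -1 :: real} \<and> (\<forall>j. a j = s * b (\<pi> j))"
proof -
  interpret A: centred_unit a n by fact
  interpret B: centred_unit b n by fact
  have AP: "(\<Prod>j\<in>UNIV. 1 - of_real (a j) * A.zc y) = of_real (exp (A.uc y))" if "y > 0" for y
    using A.exp_llog[OF A.upper_slit, of "A.zc y"] that by (simp add: A.llog_zc flip: exp_of_real)
  have BP: "(\<Prod>j\<in>UNIV. 1 - of_real (b j) * B.zc y) = of_real (exp (B.uc y))" if "y > 0" for y
    using B.exp_llog[OF B.upper_slit, of "B.zc y"] that by (simp add: B.llog_zc flip: exp_of_real)
  have key: "\<exists>\<pi>. \<pi> permutes (UNIV :: 'm set) \<and> (\<forall>j. c j = b (\<pi> j))"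
    if inf: "infinite S" and S: "\<And>y. y \<in> S \<Longrightarrow> y > 0 \<and> (\<Prod>j\<in>UNIV. 1 - of_real (c j) * B.zc y) = of_real (exp (B.uc y))" for c S
  proof (rule prod_linear_eq_imp_permutes)
    \<comment> \<open>In the variable 1 / z, P becomes a monic polynomial of degree
      \<open>CARD('m)\<close>, in which coordinates equal to 0 are still visible as roots.\<close>
    have "inj_on (\<lambda>y. 1 / B.zc y) S"
    proof (rule inj_onI)
      fix y y' assume "1 / B.zc y = 1 / B.zc y'"
      then have "B.zc y = B.zc y'" by simp
      then show "y = y'" by (metis B.Im_zc)
    qed
    then have "infinite ((\<lambda>y. 1 / B.zc y) ` S)" using inf finite_image_iff by blast
    moreover have "(\<lambda>y. 1 / B.zc y) ` S \<subseteq> {w. (\<Prod>j\<in>UNIV. w - of_real (c j)) = (\<Prod>j\<in>UNIV. w - of_real (b j))}"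
    proof safe
      fix y assume y: "y \<in> S"
      have z0: "B.zc y \<noteq> 0" using S[OF y] by (metis B.Im_zc less_irrefl zero_complex.simps(2))
      have *: "(\<Prod>j\<in>UNIV. 1 / B.zc y - of_real (d j)) = (1 / B.zc y) ^ CARD('m) * (\<Prod>j\<in>UNIV. 1 - of_real (d j) * B.zc y)" for d :: "'m \<Rightarrow> real"
      proof -
        have "1 / B.zc y - of_real (d j) = (1 / B.zc y) * (1 - of_real (d j) * B.zc y)" for j
          using z0 by (simp add: field_simps)
        then show ?thesis by (simp only: prod.distrib prod_constant)
      qed
      show "(\<Prod>j\<in>UNIV. 1 / B.zc y - of_real (c j)) = (\<Prod>j\<in>UNIV. 1 / B.zc y - of_real (b j))"
        using S[OF y] BP[of y] by (simp only: *)
    qed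
    ultimately show "infinite {w. (\<Prod>j\<in>UNIV. w - of_real (c j)) = (\<Prod>j\<in>UNIV. w - of_real (b j) :: complex)}"
      using finite_subset by blast
  qed
  let ?S = "{y. y > 0 \<and> A.xc y = B.xc y}" and ?S' = "{y. y > 0 \<and> A.xc y = - B.xc y}"
  have "{0<..} \<subseteq> ?S \<union> ?S'" using eq by (auto simp: abs_eq_iff)
  then have "infinite (?S \<union> ?S')" using finite_subset infinite_Ioi by blast
  then consider "infinite ?S" | "infinite ?S'" by auto
  then show ?thesis
  proof cases
    case 1
    have "\<exists>\<pi>. \<pi> permutes (UNIV :: 'm set) \<and> (\<forall>j. a j = b (\<pi> j))"
    proof (rule key[OF 1])
      fix y assume y: "y \<in> ?S"
      then have "B.zc y = A.zc y" by (simp add: A.zc_def B.zc_def)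
      then show "y > 0 \<and> (\<Prod>j\<in>UNIV. 1 - of_real (a j) * B.zc y) = of_real (exp (B.uc y))"
        using AP[of y] eq[of y] y by simp
    qed
    then obtain \<pi> where "\<pi> permutes (UNIV :: 'm set)" "\<forall>j. a j = b (\<pi> j)" by blast
    then have "\<pi> permutes UNIV \<and> 1 \<in> {1, -1 :: real} \<and> (\<forall>j. a j = 1 * b (\<pi> j))" by simp
    then show ?thesis by blast
  next
    case 2
    have "\<exists>\<pi>. \<pi> permutes (UNIV :: 'm set) \<and> (\<forall>j. - a j = b (\<pi> j))"
    proof (rule key[OF 2])
      fix y assume y: "y \<in> ?S'"
      \<comment> \<open>Mirror images: P for - a at the point of b is the conjugate of P for a at
        its own point, and the latter value is real.\<close>
      then have "- B.zc y = cnj (A.zc y)" by (simp add: A.zc_def B.zc_def complex_eq_iff)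
      then have "1 - of_real (- a j) * B.zc y = cnj (1 - of_real (a j) * A.zc y)" for j
        by (simp flip: \<open>- B.zc y = cnj (A.zc y)\<close>)
      then have "(\<Prod>j\<in>UNIV. 1 - of_real (- a j) * B.zc y) = cnj (\<Prod>j\<in>UNIV. 1 - of_real (a j) * A.zc y)"
        by (simp only: cnj_prod)
      also have "\<dots> = of_real (exp (A.uc y))" using AP[of y] y by simp
      finally have "(\<Prod>j\<in>UNIV. 1 - of_real (- a j) * B.zc y) = of_real (exp (A.uc y))" .
      then show "y > 0 \<and> (\<Prod>j\<in>UNIV. 1 - of_real (- a j) * B.zc y) = of_real (exp (B.uc y))"
        using eq[of y] y by simp
    qed
    then obtain \<pi> where "\<pi> permutes (UNIV :: 'm set)" "\<forall>j. - a j = b (\<pi> j)" by blast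
    then have "\<pi> permutes UNIV \<and> -1 \<in> {1, -1 :: real} \<and> (\<forall>j. a j = -1 * b (\<pi> j))"
      by (metis insertI1 insertI2 minus_minus mult_minus1)
    then show ?thesis by blast
  qed
qed

lemma axis_integral_extremal:
  fixes a b :: "'m::finite \<Rightarrow> real"
  assumes A: "centred_unit a n" and B: "centred_unit b n"
    and ext: "\<And>z. Im z > 0 \<Longrightarrow> centred_unit.drift b n z = of_real ((real n - 1) / sqrt (real n * (real n + 1))) - 1 / z"
    and la: "((\<lambda>R. integral {0..R} (\<lambda>t. Re (centred_unit.char_fun a (\<i> * of_real t)))) \<longlongrightarrow> la) at_top"
    and lb: "((\<lambda>R. integral {0..R} (\<lambda>t. Re (centred_unit.char_fun b (\<i> * of_real t)))) \<longlongrightarrow> lb) at_top"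
  shows "lb \<le> la"
    and "la = lb \<Longrightarrow> \<exists>\<pi> s. \<pi> permutes (UNIV :: 'm set) \<and> s \<in> {1, -1 :: real} \<and> (\<forall>j. a j = s * b (\<pi> j))"
proof -
  interpret A: centred_unit a n by fact
  interpret B: centred_unit b n by fact
  \<comment> \<open>The integral of exp (- u) over heights up to y, for a minus for b. It starts at
    0, is nondecreasing by \<open>curve_level_le\<close>, and tends to la - lb; if la = lb it
    vanishes identically and the levels agree.\<close>
  define f where "f y = (Im (A.prim (A.zc y)) - Im (A.prim 0)) - (Im (B.prim (B.zc y)) - Im (B.prim 0))" for y
  have ftop: "(f \<longlongrightarrow> la - lb) at_top"
    unfolding f_def by (intro tendsto_diff A.prim_zc_limit[OF la] B.prim_zc_limit[OF lb])
  have "(f \<longlongrightarrow> (Im (A.prim 0) - Im (A.prim 0)) - (Im (B.prim 0) - Im (B.prim 0))) (at_right 0)"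
    unfolding f_def by (intro tendsto_diff A.prim_zc_tendsto_0 B.prim_zc_tendsto_0 tendsto_const)
  then have f0: "(f \<longlongrightarrow> 0) (at_right 0)" by simp
  have D: "(f has_real_derivative exp (- A.uc y) - exp (- B.uc y)) (at y)" if "y > 0" for y
    unfolding f_def
    using DERIV_diff[OF DERIV_diff[OF A.prim_zc_DERIV[OF that] DERIV_const] DERIV_diff[OF B.prim_zc_DERIV[OF that] DERIV_const]]
    by (simp only: diff_zero)
  have D0: "exp (- A.uc y) - exp (- B.uc y) \<ge> 0" if "y > 0" for y
    using curve_level_le[OF A B ext that] by simp
  have mono: "f y \<le> f y'" if "0 < y" "y \<le> y'" for y y'
  proof (rule DERIV_nonneg_imp_nondecreasing[of y y' f])
    fix x assume "y \<le> x"
    then have "x > 0" using that by simp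
    then show "\<exists>d. (f has_real_derivative d) (at x) \<and> 0 \<le> d"
      using D[OF \<open>x > 0\<close>] D0[OF \<open>x > 0\<close>] by blast
  qed (use that in auto)
  have fpos: "f y \<ge> 0" if y: "y > 0" for y
  proof -
    have "eventually (\<lambda>r. f r \<le> f y) (at_right 0)"
      using eventually_at_right_real[OF y]
    proof (rule eventually_mono)
      show "f r \<le> f y" if "r \<in> {0<..<y}" for r using mono[of r y] that by simp
    qed
    then show ?thesis by (intro tendsto_upperbound[OF f0]) simp_all
  qed
  have fle: "f y \<le> la - lb" if y: "y > 0" for y
  proof (rule tendsto_lowerbound[OF ftop])
    show "eventually (\<lambda>r. f y \<le> f r) at_top"
      using eventually_ge_at_top[of y] by eventually_elim (use mono y in auto)
  qed auto
  show "lb \<le> la" using fpos[of 1] fle[of 1] by simp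
  assume l: "la = lb"
  have f00: "f y = 0" if "y > 0" for y using fpos[OF that] fle[OF that] l by simp
  have u: "A.uc y = B.uc y" if y: "y > 0" for y
  proof -
    have "((\<lambda>y. 0) has_real_derivative exp (- A.uc y) - exp (- B.uc y)) (at y)"
    proof (rule has_field_derivative_transform_within_open[OF D[OF y]])
      show "open {0 :: real<..}" "y \<in> {0<..}" using y by auto
      show "f t = 0" if "t \<in> {0<..}" for t using f00[of t] that by simp
    qed
    then have "exp (- A.uc y) - exp (- B.uc y) = 0" using DERIV_unique DERIV_const by blast
    then show ?thesis by simp
  qed
  show "\<exists>\<pi> s. \<pi> permutes (UNIV :: 'm set) \<and> s \<in> {1, -1 :: real} \<and> (\<forall>j. a j = s * b (\<pi> j))"
    by (rule level_curve_rigidity[OF A B]) (use u curve_eq[OF A B ext u] in auto)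
qed

section \<open>Hausdorff measure and Lebesgue measure\<close>

abbreviation (input) hcover :: "real \<Rightarrow> 'a::metric_space set \<Rightarrow> (nat \<Rightarrow> 'a set) \<Rightarrow> bool" where
  "hcover \<delta> S U \<equiv> S \<subseteq> (\<Union>i. U i) \<and> (\<forall>i. bounded (U i) \<and> diameter (U i) \<le> \<delta>)"

lemma hausdorff_premeasure_le:
  "hcover \<delta> S U \<Longrightarrow> hausdorff_premeasure d \<delta> S \<le> (\<Sum>i. hausdorff_weight d (U i))"
  unfolding hausdorff_premeasure_def by (intro INF_lower) simp

lemma hausdorff_premeasure_greatest:
  "(\<And>U. hcover \<delta> S U \<Longrightarrow> c \<le> (\<Sum>i. hausdorff_weight d (U i))) \<Longrightarrow> c \<le> hausdorff_premeasure d \<delta> S"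
  unfolding hausdorff_premeasure_def by (intro INF_greatest) simp

lemma hausdorff_premeasure_mono: "S \<subseteq> T \<Longrightarrow> hausdorff_premeasure d \<delta> S \<le> hausdorff_premeasure d \<delta> T"
  by (rule hausdorff_premeasure_greatest, rule hausdorff_premeasure_le) auto

lemma hausdorff_premeasure_le_measure: "0 < \<delta> \<Longrightarrow> hausdorff_premeasure d \<delta> S \<le> hausdorff_measure d S"
  unfolding hausdorff_measure_def by (intro SUP_upper) simp

lemma hausdorff_measure_least:
  "(\<And>\<delta>. 0 < \<delta> \<Longrightarrow> hausdorff_premeasure d \<delta> S \<le> c) \<Longrightarrow> hausdorff_measure d S \<le> c"
  unfolding hausdorff_measure_def by (intro SUP_least) simp

lemma hausdorff_measure_mono: "S \<subseteq> T \<Longrightarrow> hausdorff_measure d S \<le> hausdorff_measure d T"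
  by (intro hausdorff_measure_least order_trans[OF hausdorff_premeasure_mono hausdorff_premeasure_le_measure])

lemma hausdorff_weight_empty [simp]: "hausdorff_weight d {} = 0"
  by (simp add: hausdorff_weight_def)

lemma hausdorff_measure_empty [simp]: "hausdorff_measure d {} = 0"
proof -
  have "hausdorff_measure d {} \<le> 0"
  proof (rule hausdorff_measure_least)
    fix \<delta> :: real assume "0 < \<delta>"
    then show "hausdorff_premeasure d \<delta> {} \<le> 0"
      using hausdorff_premeasure_le[of "{}" "\<lambda>_. {}" \<delta> d] by simp
  qed
  then show ?thesis by simp
qed

lemma hausdorff_premeasure_subadditive:
  "hausdorff_premeasure d \<delta> (\<Union>i. S i) \<le> (\<Sum>i::nat. hausdorff_premeasure d \<delta> (S i))"
proof (rule ennreal_le_epsilon)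
  fix e :: real
  assume fin: "(\<Sum>i. hausdorff_premeasure d \<delta> (S i)) < top" and e: "0 < e"
  have "\<exists>U. hcover \<delta> (S i) U \<and> (\<Sum>j. hausdorff_weight d (U j)) \<le> hausdorff_premeasure d \<delta> (S i) + ennreal (e * (1/2) ^ Suc i)" for i
  proof -
    have "hausdorff_premeasure d \<delta> (S i) < top" using fin by (rule ennreal_suminf_lessD)
    then obtain r where r: "r \<ge> 0" "hausdorff_premeasure d \<delta> (S i) = ennreal r"
      by (cases "hausdorff_premeasure d \<delta> (S i)") auto
    have "e * (1/2) ^ Suc i > 0" using e by simp
    then have "ennreal r < ennreal (r + e * (1/2) ^ Suc i)" using r by (intro ennreal_lessI) linarith+
    then have "hausdorff_premeasure d \<delta> (S i) < hausdorff_premeasure d \<delta> (S i) + ennreal (e * (1/2) ^ Suc i)"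
      unfolding r(2) using r(1) \<open>e * (1/2) ^ Suc i > 0\<close> by (subst ennreal_plus[symmetric]) linarith+
    then have "\<not> hausdorff_premeasure d \<delta> (S i) + ennreal (e * (1/2) ^ Suc i) \<le> hausdorff_premeasure d \<delta> (S i)"
      by (simp only: not_le)
    then have "\<not> (\<forall>U. hcover \<delta> (S i) U \<longrightarrow> hausdorff_premeasure d \<delta> (S i) + ennreal (e * (1/2) ^ Suc i) \<le> (\<Sum>j. hausdorff_weight d (U j)))"
      using hausdorff_premeasure_greatest[of "S i" \<delta> "hausdorff_premeasure d \<delta> (S i) + ennreal (e * (1/2) ^ Suc i)" d] by blast
    then show ?thesis by (meson linorder_le_cases)
  qed
  then obtain U where U: "\<And>i. hcover \<delta> (S i) (U i)"
    and Ule: "\<And>i. (\<Sum>j. hausdorff_weight d (U i j)) \<le> hausdorff_premeasure d \<delta> (S i) + ennreal (e * (1/2) ^ Suc i)"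
    by metis
  have "hausdorff_premeasure d \<delta> (\<Union>i. S i) \<le> (\<Sum>k. hausdorff_weight d (case prod_decode k of (i, j) \<Rightarrow> U i j))"
  proof (rule hausdorff_premeasure_le, intro conjI)
    show "(\<Union>i. S i) \<subseteq> (\<Union>k. case prod_decode k of (i, j) \<Rightarrow> U i j)"
    proof
      fix x assume "x \<in> (\<Union>i. S i)"
      then obtain i where "x \<in> S i" by blast
      moreover have "S i \<subseteq> (\<Union>j. U i j)" using U[of i] by simp
      ultimately obtain j where "x \<in> U i j" by blast
      then show "x \<in> (\<Union>k. case prod_decode k of (i, j) \<Rightarrow> U i j)"
        by (intro UN_I[of "prod_encode (i, j)"]) simp_all
    qed
    show "\<forall>k. bounded (case prod_decode k of (i, j) \<Rightarrow> U i j) \<and> diameter (case prod_decode k of (i, j) \<Rightarrow> U i j) \<le> \<delta>"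
    proof
      fix k
      obtain i j where ij: "prod_decode k = (i, j)" by (cases "prod_decode k")
      show "bounded (case prod_decode k of (i, j) \<Rightarrow> U i j) \<and> diameter (case prod_decode k of (i, j) \<Rightarrow> U i j) \<le> \<delta>"
        using U[of i] unfolding ij by simp
    qed
  qed
  also have "\<dots> = (\<Sum>k. (\<lambda>(i, j). hausdorff_weight d (U i j)) (prod_decode k))"
    by (intro suminf_cong) (auto split: prod.split)
  also have "\<dots> = (\<Sum>i. \<Sum>j. hausdorff_weight d (U i j))"
    by (rule suminf_ennreal_2dimen) simp
  also have "\<dots> \<le> (\<Sum>i. hausdorff_premeasure d \<delta> (S i) + ennreal (e * (1/2) ^ Suc i))"
    by (intro suminf_le Ule) auto
  also have "\<dots> = (\<Sum>i. hausdorff_premeasure d \<delta> (S i)) + (\<Sum>i. ennreal (e * (1/2) ^ Suc i))"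
    by (rule suminf_add[symmetric]) auto
  also have "(\<Sum>i. ennreal (e * (1/2) ^ Suc i)) = ennreal e"
  proof -
    have "(\<lambda>i. e * (1/2) ^ Suc i) sums (e * 1)" by (intro sums_mult power_half_series)
    then have "(\<lambda>i. e * (1/2) ^ Suc i) sums e" by simp
    moreover have "e * (1/2) ^ Suc i \<ge> 0" for i using e by simp
    ultimately have "(\<lambda>i. ennreal (e * (1/2) ^ Suc i)) sums ennreal e"
      using e by (subst sums_ennreal) (simp_all only: less_imp_le)
    then show ?thesis by (rule sums_unique[symmetric])
  qed
  finally show "hausdorff_premeasure d \<delta> (\<Union>i. S i) \<le> (\<Sum>i. hausdorff_premeasure d \<delta> (S i)) + ennreal e" .
qed

lemma hausdorff_measure_subadditive:
  "hausdorff_measure d (\<Union>i. S i) \<le> (\<Sum>i::nat. hausdorff_measure d (S i))"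
proof (rule hausdorff_measure_least)
  fix \<delta> :: real assume \<delta>: "0 < \<delta>"
  show "hausdorff_premeasure d \<delta> (\<Union>i. S i) \<le> (\<Sum>i. hausdorff_measure d (S i))"
    by (rule order_trans[OF hausdorff_premeasure_subadditive])
      (intro suminf_le hausdorff_premeasure_le_measure \<delta>, auto)
qed

lemma hausdorff_measure_Un: "hausdorff_measure d (S \<union> T) \<le> hausdorff_measure d S + hausdorff_measure d T"
proof -
  define X where "X i = (if i = 0 then S else if i = Suc 0 then T else {})" for i :: nat
  have "S \<union> T = (\<Union>i. X i)" by (auto simp: X_def split: if_splits)
  then have "hausdorff_measure d (S \<union> T) \<le> (\<Sum>i. hausdorff_measure d (X i))"
    using hausdorff_measure_subadditive[of d X] by simp
  also have "\<dots> = (\<Sum>i\<in>{0, Suc 0}. hausdorff_measure d (X i))"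
    by (rule suminf_finite) (auto simp: X_def)
  finally show ?thesis by (simp add: X_def)
qed

text \<open>A cover of S at scale delta / r becomes a cover of the image at scale delta. Its members
  are first cut down to S, because f is controlled only there.\<close>

lemma hausdorff_measure_lipschitz_image:
  fixes f :: "'a::euclidean_space \<Rightarrow> 'b::euclidean_space"
  assumes r: "r > 0" and f: "\<And>x y. x \<in> S \<Longrightarrow> y \<in> S \<Longrightarrow> dist (f x) (f y) \<le> r * dist x y"
  shows "hausdorff_measure d (f ` S) \<le> ennreal (r ^ d) * hausdorff_measure d S"
proof (rule hausdorff_measure_least)
  fix \<delta> :: real assume \<delta>: "0 < \<delta>"
  have *: "bounded (f ` (S \<inter> U)) \<and> diameter (f ` (S \<inter> U)) \<le> r * diameter U"
    if U: "bounded U" for U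
  proof -
    have le: "dist (f x) (f y) \<le> r * diameter U" if "x \<in> S \<inter> U" "y \<in> S \<inter> U" for x y
    proof -
      have "dist (f x) (f y) \<le> r * dist x y" using f that by auto
      also have "\<dots> \<le> r * diameter U" using r that U by (intro mult_left_mono diameter_bounded_bound) auto
      finally show ?thesis .
    qed
    have "diameter U \<ge> 0" by (rule diameter_ge_0[OF U])
    then have "diameter (f ` (S \<inter> U)) \<le> r * diameter U"
      using r le by (intro diameter_le) (auto simp: dist_norm)
    moreover have "bounded (f ` (S \<inter> U))"
        unfolding bounded_two_points by (intro exI[of _ "r * diameter U"] ballI) (use le in auto)
    ultimately show ?thesis by blast
  qed
  have "hausdorff_premeasure d \<delta> (f ` S) \<le> ennreal (r ^ d) * (\<Sum>i. hausdorff_weight d (U i))"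
    if U: "hcover (\<delta> / r) S U" for U
  proof -
    have "hausdorff_premeasure d \<delta> (f ` S) \<le> (\<Sum>i. hausdorff_weight d (f ` (S \<inter> U i)))"
    proof (rule hausdorff_premeasure_le, intro conjI allI)
      show "f ` S \<subseteq> (\<Union>i. f ` (S \<inter> U i))" using U by blast
      fix i
      have "diameter (U i) \<le> \<delta> / r" using U by blast
      then have "r * diameter (U i) \<le> \<delta>" using r by (simp add: field_simps)
      then show "diameter (f ` (S \<inter> U i)) \<le> \<delta>" using *[of "U i"] U by force
      show "bounded (f ` (S \<inter> U i))" using *[of "U i"] U by blast
    qed
    also have "\<dots> \<le> (\<Sum>i. ennreal (r ^ d) * hausdorff_weight d (U i))"
    proof (intro suminf_le allI)
      fix i
      show "hausdorff_weight d (f ` (S \<inter> U i)) \<le> ennreal (r ^ d) * hausdorff_weight d (U i)"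
      proof (cases "S \<inter> U i = {}")
        case False
        have b: "bounded (U i)" using U by blast
        have "diameter (f ` (S \<inter> U i)) ^ d \<le> (r * diameter (U i)) ^ d"
          using *[OF b] by (intro power_mono diameter_ge_0) auto
        then show ?thesis using False r diameter_ge_0[OF b]
          by (auto simp: hausdorff_weight_def power_mult_distrib simp flip: ennreal_mult intro!: ennreal_leI)
      qed simp
    qed auto
    finally show ?thesis by simp
  qed
  then have "hausdorff_premeasure d \<delta> (f ` S) / ennreal (r ^ d) \<le> hausdorff_premeasure d (\<delta> / r) S"
    using r by (intro hausdorff_premeasure_greatest divide_le_posI_ennreal) (simp_all only: mult.commute zero_less_power ennreal_zero_less_mult_iff ennreal_less_zero_iff ennreal_eq_0_iff)
  then have "hausdorff_premeasure d \<delta> (f ` S) / ennreal (r ^ d) \<le> hausdorff_measure d S"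
    using \<delta> r by (auto intro: order_trans[OF _ hausdorff_premeasure_le_measure])
  then have "ennreal (r ^ d) * (hausdorff_premeasure d \<delta> (f ` S) / ennreal (r ^ d)) \<le> ennreal (r ^ d) * hausdorff_measure d S"
    by (rule mult_left_mono) simp
  moreover have "ennreal (r ^ d) * (hausdorff_premeasure d \<delta> (f ` S) / ennreal (r ^ d)) = hausdorff_premeasure d \<delta> (f ` S)"
  proof -
    have "ennreal (r ^ d) * (hausdorff_premeasure d \<delta> (f ` S) / ennreal (r ^ d)) = hausdorff_premeasure d \<delta> (f ` S) * ennreal (r ^ d) / ennreal (r ^ d)"
      by (simp only: ennreal_times_divide mult.commute)
    also have "\<dots> = hausdorff_premeasure d \<delta> (f ` S)"
      using r by (intro ennreal_mult_divide_eq) auto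
    finally show ?thesis .
  qed
  ultimately show "hausdorff_premeasure d \<delta> (f ` S) \<le> ennreal (r ^ d) * hausdorff_measure d S" by simp
qed

lemma hausdorff_measure_isometry_image:
  fixes f :: "'a::euclidean_space \<Rightarrow> 'b::euclidean_space"
  assumes f: "\<And>x y. x \<in> S \<Longrightarrow> y \<in> S \<Longrightarrow> dist (f x) (f y) = dist x y"
  shows "hausdorff_measure d (f ` S) = hausdorff_measure d S"
proof (rule antisym)
  show "hausdorff_measure d (f ` S) \<le> hausdorff_measure d S"
    using hausdorff_measure_lipschitz_image[of 1 S f d] f by simp
  have inj: "inj_on f S" using f by (metis (no_types) dist_eq_0_iff inj_onI)
  have "hausdorff_measure d (inv_into S f ` f ` S) \<le> ennreal (1 ^ d) * hausdorff_measure d (f ` S)"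
    by (rule hausdorff_measure_lipschitz_image) (auto simp: inj f)
  then show "hausdorff_measure d S \<le> hausdorff_measure d (f ` S)" using inj by simp
qed

section \<open>Coordinate subspaces, thickenings and the measure of the unit cube\<close>

definition coord_proj :: "'a::euclidean_space set \<Rightarrow> 'a \<Rightarrow> 'a" where
  "coord_proj D x = (\<Sum>i\<in>Basis. (if i \<in> D then x \<bullet> i else 0) *\<^sub>R i)"

text \<open>For S in the span of D this is the product of S with the open unit cube in the remaining
  coordinate directions. Its Lebesgue measure is therefore the \<open>card D\<close>-dimensional
  volume of S, expressed by a measure on the whole space.\<close>

definition thicken :: "'a::euclidean_space set \<Rightarrow> 'a set \<Rightarrow> 'a set" where
  "thicken D S = {x. coord_proj D x \<in> S \<and> (\<forall>i\<in>Basis - D. 0 < x \<bullet> i \<and> x \<bullet> i < 1)}"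

definition coord_box :: "'a::euclidean_space set \<Rightarrow> ('a \<Rightarrow> real) \<Rightarrow> ('a \<Rightarrow> real) \<Rightarrow> 'a set" where
  "coord_box D l u = {x. (\<forall>i\<in>D. l i \<le> x \<bullet> i \<and> x \<bullet> i \<le> u i) \<and> (\<forall>i\<in>Basis - D. x \<bullet> i = 0)}"

lemma coord_proj_inner [simp]: "i \<in> Basis \<Longrightarrow> coord_proj D x \<bullet> i = (if i \<in> D then x \<bullet> i else 0)"
  by (simp add: coord_proj_def)

lemma borel_measurable_coord_proj [measurable]: "coord_proj D \<in> borel_measurable borel"
  unfolding coord_proj_def
proof (intro borel_measurable_continuous_onI continuous_intros)
  show "continuous_on UNIV (\<lambda>x. if i \<in> D then x \<bullet> i else 0)" for i :: 'a
    by (cases "i \<in> D") (auto intro!: continuous_intros)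
qed

lemma borel_thicken [measurable]:
  assumes "S \<in> sets borel" shows "thicken D S \<in> sets borel"
proof -
  have "thicken D S = (coord_proj D -` S \<inter> space borel) \<inter> {x. \<forall>i\<in>Basis - D. 0 < x \<bullet> i \<and> x \<bullet> i < 1}"
    by (auto simp: thicken_def)
  also have "\<dots> \<in> sets borel"
    by (intro sets.Int measurable_sets[OF borel_measurable_coord_proj assms]) measurable
  finally show ?thesis .
qed

lemma prod_Basis_if:
  fixes p q :: real
  assumes "D \<subseteq> (Basis :: 'a::euclidean_space set)"
  shows "(\<Prod>i\<in>(Basis :: 'a set). if i \<in> D then p else q) = p ^ card D * q ^ card (Basis - D)"
proof -
  have "Basis \<inter> {i. i \<in> D} = D" "Basis \<inter> - {i. i \<in> D} = Basis - D" using assms by auto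
  then show ?thesis by (simp add: prod.If_cases)
qed

lemma emeasure_cbox_if:
  fixes l u :: "'a::euclidean_space"
  assumes D: "D \<subseteq> Basis" and p: "0 \<le> p" "\<And>i. i \<in> D \<Longrightarrow> u \<bullet> i - l \<bullet> i = p" and q: "0 \<le> q" "\<And>i. i \<in> Basis - D \<Longrightarrow> u \<bullet> i - l \<bullet> i = q"
  shows "emeasure lborel (cbox l u) = ennreal (p ^ card D * q ^ card (Basis - D))"
    and "emeasure lborel (box l u) = ennreal (p ^ card D * q ^ card (Basis - D))"
proof -
  have le: "l \<bullet> i \<le> u \<bullet> i" if "i \<in> Basis" for i
    using p q that by (cases "i \<in> D") (smt (verit) DiffI)+
  have "(\<Prod>b\<in>Basis. (u - l) \<bullet> b) = (\<Prod>i\<in>Basis. if i \<in> D then p else q)"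
    using p q by (intro prod.cong refl) (auto simp: inner_diff_left)
  then have pr: "(\<Prod>b\<in>Basis. (u - l) \<bullet> b) = p ^ card D * q ^ card (Basis - D)"
    by (simp only: prod_Basis_if[OF D])
  show "emeasure lborel (cbox l u) = ennreal (p ^ card D * q ^ card (Basis - D))"
    by (subst emeasure_lborel_cbox) (simp_all add: le pr)
  show "emeasure lborel (box l u) = ennreal (p ^ card D * q ^ card (Basis - D))"
    by (subst emeasure_lborel_box) (simp_all add: le pr)
qed

lemma unit_cube_coord_box:
  assumes "D \<subseteq> Basis"
  shows "cbox 0 (\<Sum>D) = coord_box D (\<lambda>_. 0) (\<lambda>_. 1)"
proof -
  have fin: "finite D" using assms finite_Basis finite_subset by blast
  have "(\<Sum>D) \<bullet> i = (if i \<in> D then 1 else 0)" if "i \<in> Basis" for i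
  proof -
    have "(\<Sum>D) \<bullet> i = (\<Sum>j\<in>D. if j = i then 1 else 0)"
      unfolding inner_sum_left using assms that by (intro sum.cong refl) (auto simp: inner_Basis)
    then show ?thesis using fin by simp
  qed
  then show ?thesis using assms unfolding coord_box_def cbox_def by (auto split: if_splits)
qed

lemma hausdorff_coord_cube_le:
  assumes D: "D \<subseteq> Basis" and r: "r > 0"
  shows "hausdorff_measure d (coord_box D l (\<lambda>i. l i + r)) \<le> ennreal (r ^ d) * hausdorff_measure d (coord_box D (\<lambda>_. 0) (\<lambda>_. 1))"
proof -
  let ?f = "\<lambda>x. (\<Sum>i\<in>Basis. (if i \<in> D then l i else 0) *\<^sub>R i) + r *\<^sub>R x"
  have "coord_box D l (\<lambda>i. l i + r) \<subseteq> ?f ` coord_box D (\<lambda>_. 0) (\<lambda>_. 1)"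
  proof
    fix x assume x: "x \<in> coord_box D l (\<lambda>i. l i + r)"
    define w where "w = (1 / r) *\<^sub>R (x - (\<Sum>i\<in>Basis. (if i \<in> D then l i else 0) *\<^sub>R i))"
    have "x = ?f w" using r by (simp add: w_def)
    moreover have "w \<in> coord_box D (\<lambda>_. 0) (\<lambda>_. 1)"
      unfolding coord_box_def mem_Collect_eq
    proof (intro conjI ballI)
      fix i assume i: "i \<in> D"
      then have "i \<in> Basis" using D by auto
      then have "w \<bullet> i = (x \<bullet> i - l i) / r" using i by (simp add: w_def inner_diff_left)
      moreover have "l i \<le> x \<bullet> i" "x \<bullet> i \<le> l i + r" using x i by (auto simp: coord_box_def)
      ultimately show "0 \<le> w \<bullet> i" "w \<bullet> i \<le> 1" using r by simp_all
    next
      fix i assume i: "i \<in> Basis - D"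
      then show "w \<bullet> i = 0" using x by (auto simp: w_def inner_diff_left coord_box_def)
    qed
    ultimately show "x \<in> ?f ` coord_box D (\<lambda>_. 0) (\<lambda>_. 1)" by blast
  qed
  then have "hausdorff_measure d (coord_box D l (\<lambda>i. l i + r)) \<le> hausdorff_measure d (?f ` coord_box D (\<lambda>_. 0) (\<lambda>_. 1))"
    by (rule hausdorff_measure_mono)
  also have "\<dots> \<le> ennreal (r ^ d) * hausdorff_measure d (coord_box D (\<lambda>_. 0) (\<lambda>_. 1))"
    using r by (intro hausdorff_measure_lipschitz_image) (auto simp: dist_norm simp flip: scaleR_diff_right)
  finally show ?thesis .
qed

text \<open>A set of diameter rho fits into a box with sides 2 rho in the directions of D. With unit
  sides in the other directions these boxes cover the open unit box of volume 1, so the weights add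
  up to at least 2^(- card D).\<close>

lemma hausdorff_unit_cube_pos:
  assumes D: "D \<subseteq> (Basis :: 'a::euclidean_space set)"
  shows "hausdorff_measure (card D) (coord_box D (\<lambda>_. 0) (\<lambda>_. 1)) > 0"
proof -
  let ?Q = "coord_box D (\<lambda>_. 0) (\<lambda>_. 1) :: 'a set"
  have "ennreal (1 / 2 ^ card D) \<le> hausdorff_premeasure (card D) 1 ?Q"
  proof (rule hausdorff_premeasure_greatest)
    fix U assume U: "hcover 1 ?Q U"
    define p where "p i = (SOME x. x \<in> U i)" for i
    define \<rho> where "\<rho> i = diameter (U i)" for i
    define L where "L i = (\<Sum>j\<in>Basis. (if j \<in> D then p i \<bullet> j - \<rho> i else 0) *\<^sub>R j)" for i
    define R where "R i = (\<Sum>j\<in>Basis. (if j \<in> D then p i \<bullet> j + \<rho> i else 1) *\<^sub>R j)" for i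
    \<comment> \<open>The empty set needs its own case: for \<open>card D = 0\<close> the box around
      it would have volume 1, while its weight is 0.\<close>
    define W where "W i = (if U i = {} then {} else cbox (L i) (R i))" for i
    have \<rho>: "\<rho> i \<ge> 0" for i using U diameter_ge_0[of "U i"] by (simp add: \<rho>_def)
    have W: "emeasure lborel (W i) = ennreal (2 ^ card D) * hausdorff_weight (card D) (U i)" for i
    proof (cases "U i = {}")
      case False
      have "emeasure lborel (cbox (L i) (R i)) = ennreal ((2 * \<rho> i) ^ card D * 1 ^ card (Basis - D))"
        using D \<rho>[of i] by (intro emeasure_cbox_if) (auto simp: L_def R_def)
      then show ?thesis using False \<rho>[of i]
        by (simp add: W_def hausdorff_weight_def \<rho>_def[symmetric] power_mult_distrib ennreal_mult)
    qed (simp add: W_def)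
    have "box 0 (\<Sum>j\<in>Basis. j) \<subseteq> (\<Union>i. W i)"
    proof
      fix x :: 'a assume x: "x \<in> box 0 (\<Sum>j\<in>Basis. j)"
      have x01: "0 < x \<bullet> j \<and> x \<bullet> j < 1" if "j \<in> Basis" for j
        using x that by (auto simp: box_def inner_sum_left_Basis inner_sum_left inner_Basis if_distrib cong: if_cong)
      have "coord_proj D x \<in> ?Q" unfolding coord_box_def using D x01 by (auto simp: subset_iff less_imp_le)
      then obtain i where i: "coord_proj D x \<in> U i" using U by blast
      then have "p i \<in> U i" unfolding p_def by (rule someI)
      have "bounded (U i)" using U by blast
      then have "dist (coord_proj D x) (p i) \<le> \<rho> i" unfolding \<rho>_def by (rule diameter_bounded_bound) fact+
      then have *: "\<bar>coord_proj D x \<bullet> j - p i \<bullet> j\<bar> \<le> \<rho> i" if "j \<in> Basis" for j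
        using Basis_le_norm[OF that, of "coord_proj D x - p i"] by (simp add: dist_norm inner_diff_left)
      have "x \<in> cbox (L i) (R i)"
        unfolding cbox_def mem_Collect_eq
      proof
        fix j :: 'a assume j: "j \<in> Basis"
        show "L i \<bullet> j \<le> x \<bullet> j \<and> x \<bullet> j \<le> R i \<bullet> j"
          using *[OF j] x01[OF j] j unfolding L_def R_def by (cases "j \<in> D") (auto simp: abs_le_iff)
      qed
      then have "x \<in> W i" using i by (auto simp: W_def)
      then show "x \<in> (\<Union>i. W i)" by blast
    qed
    then have "emeasure lborel (box 0 (\<Sum>j\<in>Basis. j) :: 'a set) \<le> emeasure lborel (\<Union>i. W i)"
      by (intro emeasure_mono) (auto simp: W_def)
    also have "\<dots> \<le> (\<Sum>i. emeasure lborel (W i))"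
      by (intro emeasure_subadditive_countably) (auto simp: W_def)
    also have "\<dots> = ennreal (2 ^ card D) * (\<Sum>i. hausdorff_weight (card D) (U i))"
      by (simp only: W ennreal_suminf_cmult)
    also have "emeasure lborel (box 0 (\<Sum>j\<in>Basis. j) :: 'a set) = 1"
      by (subst emeasure_lborel_box) (simp_all add: inner_sum_left inner_Basis if_distrib cong: if_cong)
    finally have "1 / ennreal (2 ^ card D) \<le> (\<Sum>i. hausdorff_weight (card D) (U i))"
      by (intro divide_le_posI_ennreal) (simp_all add: mult.commute)
    then show "ennreal (1 / 2 ^ card D) \<le> (\<Sum>i. hausdorff_weight (card D) (U i))"
      by (simp add: divide_ennreal[symmetric])
  qed
  also have "\<dots> \<le> hausdorff_measure (card D) ?Q" by (rule hausdorff_premeasure_le_measure) simp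
  finally show ?thesis by (rule less_le_trans[rotated]) (simp add: ennreal_less_zero_iff)
qed

text \<open>The grid of k^d cubes of side 1 / k has total weight at most k^d (d / k)^d = d^d,
  independently of k; k is chosen so large that the diameters are at most delta.\<close>

lemma hausdorff_unit_cube_finite:
  assumes D: "D \<subseteq> (Basis :: 'a::euclidean_space set)"
  shows "hausdorff_measure (card D) (coord_box D (\<lambda>_. 0) (\<lambda>_. 1)) < \<infinity>"
proof -
  let ?Q = "coord_box D (\<lambda>_. 0) (\<lambda>_. 1) :: 'a set"
  define d where "d = card D"
  have finD: "finite D" using D finite_Basis finite_subset by blast
  have "hausdorff_measure d ?Q \<le> ennreal (real d ^ d)"
  proof (rule hausdorff_measure_least)
    fix \<delta> :: real assume \<delta>: "\<delta> > 0"
    obtain k :: nat where k: "k > d / \<delta>" "k > 0"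
      using reals_Archimedean2[of "max 1 (d / \<delta>)"] by (auto simp: max_less_iff_conj)
    have k0: "real k > 0" using k by simp
    define F where "F = D \<rightarrow>\<^sub>E {..<k}"
    have finF: "finite F" unfolding F_def using finD by (intro finite_PiE) auto
    have cardF: "card F = k ^ d" unfolding F_def using finD by (simp add: card_PiE d_def)
    define C where "C f = coord_box D (\<lambda>i. real (f i) / k) (\<lambda>i. (real (f i) + 1) / k)" for f :: "'a \<Rightarrow> nat"
    have diam: "bounded (C f) \<and> diameter (C f) \<le> d / k" for f
    proof -
      have le: "norm (x - y) \<le> d / k" if "x \<in> C f" "y \<in> C f" for x y
      proof -
        have "norm (x - y) \<le> (\<Sum>i\<in>Basis. \<bar>(x - y) \<bullet> i\<bar>)" by (rule norm_le_l1)
        also have "\<dots> = (\<Sum>i\<in>D. \<bar>(x - y) \<bullet> i\<bar>)"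
          using that by (intro sum.mono_neutral_right D finite_Basis) (auto simp: C_def coord_box_def inner_diff_left)
        also have "\<dots> \<le> (\<Sum>i\<in>D. 1 / k)"
        proof (rule sum_mono)
          fix i assume "i \<in> D"
          then have "real (f i) / k \<le> x \<bullet> i" "x \<bullet> i \<le> (real (f i) + 1) / k" "real (f i) / k \<le> y \<bullet> i" "y \<bullet> i \<le> (real (f i) + 1) / k"
            using that by (auto simp: C_def coord_box_def)
          moreover have "(real (f i) + 1) / k = real (f i) / k + 1 / k" by (rule add_divide_distrib)
          ultimately show "\<bar>(x - y) \<bullet> i\<bar> \<le> 1 / k" unfolding inner_diff_left by linarith
        qed
        also have "\<dots> = d / k" by (simp add: d_def)
        finally show ?thesis .
      qed
      have "bounded (C f)" unfolding bounded_two_points dist_norm by (intro exI[of _ "d / k"] ballI le)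
      moreover have "diameter (C f) \<le> d / k" using le by (intro diameter_le) auto
      ultimately show ?thesis by blast
    qed
    have cover: "?Q \<subseteq> (\<Union>f\<in>F. C f)"
    proof
      fix x assume x: "x \<in> ?Q"
      \<comment> \<open>The cap k - 1 puts points with a coordinate 1 into the last cube of the
        grid.\<close>
      define f where "f = restrict (\<lambda>i. min (nat \<lfloor>k * (x \<bullet> i)\<rfloor>) (k - 1)) D"
      have "f \<in> F" using k by (auto simp: f_def F_def)
      moreover have "x \<in> C f"
        unfolding C_def coord_box_def mem_Collect_eq
      proof (intro conjI ballI)
        fix i assume i: "i \<in> D"
        then have xi: "0 \<le> x \<bullet> i" "x \<bullet> i \<le> 1" using x by (auto simp: coord_box_def)
        define t where "t = k * (x \<bullet> i)"
        have t: "0 \<le> t" "t \<le> k" using xi k0 by (auto simp: t_def mult_left_le)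
        have xt: "x \<bullet> i = t / k" using k0 by (simp add: t_def)
        have fi: "f i = min (nat \<lfloor>t\<rfloor>) (k - 1)" using i by (simp add: f_def t_def)
        have "real (f i) \<le> t" unfolding fi using t by linarith
        then show "real (f i) / k \<le> x \<bullet> i" unfolding xt using k0 by (intro divide_right_mono) auto
        have "t \<le> real (f i) + 1"
        proof (cases "nat \<lfloor>t\<rfloor> \<le> k - 1")
          case True
          then show ?thesis unfolding fi using t by (simp add: min_def)
        next
          case False
          then have "f i = k - 1" by (simp add: fi)
          then show ?thesis using t k by simp
        qed
        then show "x \<bullet> i \<le> (real (f i) + 1) / k" unfolding xt using k0 by (intro divide_right_mono) auto
      next
        fix i assume "i \<in> Basis - D"
        then show "x \<bullet> i = 0" using x by (auto simp: coord_box_def)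
      qed
      ultimately show "x \<in> (\<Union>f\<in>F. C f)" by blast
    qed
    obtain h where h: "bij_betw h {0..<card F} F" using ex_bij_betw_nat_finite[OF finF] by blast
    define U where "U i = (if i < card F then C (h i) else {})" for i
    have "hausdorff_premeasure d \<delta> ?Q \<le> (\<Sum>i. hausdorff_weight d (U i))"
    proof (rule hausdorff_premeasure_le, intro conjI allI)
      show "?Q \<subseteq> (\<Union>i. U i)"
      proof
        fix x assume "x \<in> ?Q"
        then obtain f where f: "f \<in> F" "x \<in> C f" using cover by auto
        then obtain i where "i \<in> {0..<card F}" "h i = f" using h by (metis bij_betw_imp_surj_on imageE)
        then have "x \<in> U i" using f by (simp add: U_def)
        then show "x \<in> (\<Union>i. U i)" by (rule UN_I[OF UNIV_I])
      qed
      fix i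
      have "d / k \<le> \<delta>" using k \<delta> k0 by (simp add: field_simps)
      then show "bounded (U i)" "diameter (U i) \<le> \<delta>" using diam[of "h i"] \<delta> by (auto simp: U_def)
    qed
    also have "\<dots> = (\<Sum>i<card F. hausdorff_weight d (U i))" by (rule suminf_finite) (auto simp: U_def)
    also have "\<dots> \<le> (\<Sum>i<card F. ennreal ((d / k) ^ d))"
    proof (rule sum_mono)
      fix i
      have "diameter (U i) ^ d \<le> (d / k) ^ d" if "U i \<noteq> {}"
        using that diam[of "h i"] by (intro power_mono diameter_ge_0) (auto simp: U_def split: if_splits)
      then show "hausdorff_weight d (U i) \<le> ennreal ((d / k) ^ d)"
        by (auto simp: hausdorff_weight_def intro: ennreal_leI)
    qed
    also have "\<dots> = ennreal (real (card F) * (d / k) ^ d)" by (simp add: ennreal_mult ennreal_of_nat_eq_real_of_nat)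
    also have "real (card F) * (d / k) ^ d = real d ^ d" using k0 by (simp add: cardF power_divide)
    finally show "hausdorff_premeasure d \<delta> ?Q \<le> ennreal (real d ^ d)" .
  qed
  also have "\<dots> < \<infinity>" by simp
  finally show ?thesis by (simp add: d_def)
qed

text \<open>Averaging: the weight of the cubes met by the slice at offset x, integrated over x in
  the unit cube of the directions outside D, is at most the total volume of the boxes, hence at most
  m. So the weight cannot exceed m + e on every slice.\<close>

lemma thicken_cover_slice:
  fixes K :: "nat \<Rightarrow> 'a::euclidean_space set"
  assumes D: "D \<subseteq> Basis" and M: "M > 0"
    and K: "\<And>i. i \<in> I \<Longrightarrow> K i = cbox (u i) (v i) \<and> K i \<noteq> {} \<and>
       (\<forall>j\<in>Basis. v i \<bullet> j - u i \<bullet> j = (if j \<in> D then 2 * M else 1) / 2 ^ k i)"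
    and K0: "\<And>i. i \<notin> I \<Longrightarrow> K i = {}"
    and sum: "(\<Sum>i. emeasure lborel (K i)) \<le> ennreal m" and m: "m \<ge> 0" and e: "e > 0"
  shows "\<exists>x. (\<forall>j\<in>Basis - D. 0 < x \<bullet> j \<and> x \<bullet> j < 1) \<and>
     (\<Sum>i. ennreal ((2 * M / 2 ^ k i) ^ card D) * indicator {x. i \<in> I \<and> (\<forall>j\<in>Basis - D. u i \<bullet> j \<le> x \<bullet> j \<and> x \<bullet> j \<le> v i \<bullet> j)} x) \<le> ennreal (m + e)"
proof (rule ccontr)
  define d where "d = card D"
  define c where "c = card (Basis - D)"
  define P where "P i = {x. i \<in> I \<and> (\<forall>j\<in>Basis - D. u i \<bullet> j \<le> x \<bullet> j \<and> x \<bullet> j \<le> v i \<bullet> j)}" for i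
  define \<Phi> where "\<Phi> x = (\<Sum>i. ennreal ((2 * M / 2 ^ k i) ^ d) * indicator (P i) x)" for x
  define a0 where "a0 = (\<Sum>j\<in>Basis. (if j \<in> D then - M else 0) *\<^sub>R j)"
  define b0 where "b0 = (\<Sum>j\<in>Basis. (if j \<in> D then M else 1) *\<^sub>R j)"
  \<comment> \<open>The weight of a slice depends only on the directions outside D.
    \<open>?B\<close> gives the directions of D the extent 2 M, so the average is an integral over
    the whole space and both sides carry the same factor \<open>(2 * M) ^ d\<close>.\<close>
  let ?B = "box a0 b0"
  assume contra: "\<not> ?thesis"
  have neg: "ennreal (m + e) < \<Phi> x" if "\<forall>j\<in>Basis - D. 0 < x \<bullet> j \<and> x \<bullet> j < 1" for x
  proof -
    have "\<not> \<Phi> x \<le> ennreal (m + e)" using contra that unfolding \<Phi>_def P_def d_def by blast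
    then show ?thesis by (simp only: not_le)
  qed
  have P: "P i \<in> sets borel" for i
  proof -
    have "{x. \<forall>j\<in>Basis - D. u i \<bullet> j \<le> x \<bullet> j \<and> x \<bullet> j \<le> v i \<bullet> j} \<in> sets borel" by measurable
    then show ?thesis by (cases "i \<in> I") (auto simp: P_def)
  qed
  have PB: "emeasure lborel (P i \<inter> ?B) \<le> ennreal ((2 * M) ^ d * (1 / 2 ^ k i) ^ c)" if i: "i \<in> I" for i
  proof -
    define l where "l = (\<Sum>j\<in>Basis. (if j \<in> D then - M else u i \<bullet> j) *\<^sub>R j)"
    define r where "r = (\<Sum>j\<in>Basis. (if j \<in> D then M else v i \<bullet> j) *\<^sub>R j)"
    have "P i \<inter> ?B \<subseteq> cbox l r"
      by (auto simp: P_def box_def cbox_def l_def r_def a0_def b0_def less_imp_le)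
    then have "emeasure lborel (P i \<inter> ?B) \<le> emeasure lborel (cbox l r)" by (intro emeasure_mono) auto
    also have "\<dots> = ennreal ((2 * M) ^ card D * (1 / 2 ^ k i) ^ card (Basis - D))"
      using M K[OF i] D by (intro emeasure_cbox_if) (auto simp: l_def r_def)
    finally show ?thesis by (simp add: d_def c_def)
  qed
  have Kvol: "emeasure lborel (K i) = ennreal ((2 * M / 2 ^ k i) ^ d * (1 / 2 ^ k i) ^ c)" if i: "i \<in> I" for i
    unfolding d_def c_def using K[OF i] M D by (simp only:) (intro emeasure_cbox_if, auto)
  have "(\<integral>\<^sup>+x. \<Phi> x * indicator ?B x \<partial>lborel) = (\<integral>\<^sup>+x. (\<Sum>i. ennreal ((2 * M / 2 ^ k i) ^ d) * indicator (P i \<inter> ?B) x) \<partial>lborel)"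
    unfolding \<Phi>_def by (intro nn_integral_cong) (auto simp: indicator_def)
  also have "\<dots> = (\<Sum>i. \<integral>\<^sup>+x. ennreal ((2 * M / 2 ^ k i) ^ d) * indicator (P i \<inter> ?B) x \<partial>lborel)"
    using P by (intro nn_integral_suminf) auto
  also have "\<dots> = (\<Sum>i. ennreal ((2 * M / 2 ^ k i) ^ d) * emeasure lborel (P i \<inter> ?B))"
    using P by (intro suminf_cong nn_integral_cmult_indicator) auto
  also have "\<dots> \<le> (\<Sum>i. ennreal ((2 * M) ^ d) * emeasure lborel (K i))"
  proof (intro suminf_le allI)
    fix i
    show "ennreal ((2 * M / 2 ^ k i) ^ d) * emeasure lborel (P i \<inter> ?B) \<le> ennreal ((2 * M) ^ d) * emeasure lborel (K i)"
    proof (cases "i \<in> I")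
      case True
      have "ennreal ((2 * M / 2 ^ k i) ^ d) * emeasure lborel (P i \<inter> ?B) \<le> ennreal ((2 * M / 2 ^ k i) ^ d) * ennreal ((2 * M) ^ d * (1 / 2 ^ k i) ^ c)"
        by (intro mult_left_mono PB True) auto
      also have "\<dots> = ennreal ((2 * M) ^ d) * ennreal ((2 * M / 2 ^ k i) ^ d * (1 / 2 ^ k i) ^ c)"
      proof -
        have "0 \<le> (2 * M / 2 ^ k i) ^ d" "0 \<le> (2 * M) ^ d" "0 \<le> (1 / 2 ^ k i :: real) ^ c" using M by simp_all
        then show ?thesis by (simp only: ennreal_mult mult_nonneg_nonneg mult.left_commute)
      qed
      finally show ?thesis by (simp add: Kvol[OF True])
    qed (simp add: P_def)
  qed auto
  also have "\<dots> \<le> ennreal ((2 * M) ^ d) * ennreal m" using sum by (simp add: mult_left_mono)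
  finally have up: "(\<integral>\<^sup>+x. \<Phi> x * indicator ?B x \<partial>lborel) \<le> ennreal ((2 * M) ^ d) * ennreal m" .
  have "ennreal (m + e) * emeasure lborel ?B = (\<integral>\<^sup>+x. ennreal (m + e) * indicator ?B x \<partial>lborel)"
    by (rule nn_integral_cmult_indicator[symmetric]) auto
  also have "\<dots> \<le> (\<integral>\<^sup>+x. \<Phi> x * indicator ?B x \<partial>lborel)"
  proof (rule nn_integral_mono)
    fix x
    have "ennreal (m + e) \<le> \<Phi> x" if "x \<in> ?B"
      using that D by (intro less_imp_le neg) (auto simp: box_def a0_def b0_def)
    then show "ennreal (m + e) * indicator ?B x \<le> \<Phi> x * indicator ?B x" by (auto simp: indicator_def)
  qed
  also have "emeasure lborel ?B = ennreal ((2 * M) ^ card D * 1 ^ card (Basis - D))"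
    using M D by (intro emeasure_cbox_if(2)) (auto simp: a0_def b0_def)
  finally have "ennreal (m + e) * ennreal ((2 * M) ^ d) \<le> ennreal ((2 * M) ^ d) * ennreal m" using up by (simp add: d_def)
  moreover have "ennreal (m + e) * ennreal ((2 * M) ^ d) = ennreal ((m + e) * (2 * M) ^ d)"
    "ennreal ((2 * M) ^ d) * ennreal m = ennreal ((2 * M) ^ d * m)"
    using m e M by (simp_all only: ennreal_mult[symmetric] add_nonneg_nonneg less_imp_le zero_le_power mult_nonneg_nonneg zero_le_numeral)
  ultimately have "ennreal ((m + e) * (2 * M) ^ d) \<le> ennreal ((2 * M) ^ d * m)" by (simp only:)
  moreover have "0 \<le> (2 * M) ^ d * m" using m M by simp
  ultimately have "(m + e) * (2 * M) ^ d \<le> (2 * M) ^ d * m" by (simp only: ennreal_le_iff)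
  then have "(m + e) * (2 * M) ^ d \<le> m * (2 * M) ^ d" by (simp only: mult.commute)
  then show False using M e by simp
qed

text \<open>Cover the thickened set by dyadic boxes of almost the right total volume and take a
  slice of small weight. It covers S by cubes, and a cube of side r has measure at most r^d times
  that of the unit cube, so the constant comes out exactly.\<close>

lemma hausdorff_le_lborel_thicken:
  fixes S :: "'a::euclidean_space set"
  assumes D: "D \<subseteq> Basis" and M: "M > 0" and S: "S \<in> sets borel" "S \<subseteq> coord_box D (\<lambda>_. - M) (\<lambda>_. M)"
  shows "hausdorff_measure (card D) S \<le> hausdorff_measure (card D) (coord_box D (\<lambda>_. 0) (\<lambda>_. 1) :: 'a set) * emeasure lborel (thicken D S)"
proof -
  define d where "d = card D"
  define H where "H = hausdorff_measure d (coord_box D (\<lambda>_. 0) (\<lambda>_. 1) :: 'a set)"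
  \<comment> \<open>The sides of the enclosing box in the directions of D all have length 2 M, so
    every dyadic piece is sliced in a cube.\<close>
  define a0 where "a0 = (\<Sum>j\<in>Basis. (if j \<in> D then - M else 0) *\<^sub>R j)"
  define b0 where "b0 = (\<Sum>j\<in>Basis. (if j \<in> D then M else 1) *\<^sub>R j)"
  have sub: "thicken D S \<subseteq> cbox a0 b0"
  proof
    fix x assume x: "x \<in> thicken D S"
    then have *: "coord_proj D x \<in> coord_box D (\<lambda>_. - M) (\<lambda>_. M)" using S by (auto simp: thicken_def)
    show "x \<in> cbox a0 b0" unfolding cbox_def mem_Collect_eq
    proof
      fix i :: 'a assume i: "i \<in> Basis"
      show "a0 \<bullet> i \<le> x \<bullet> i \<and> x \<bullet> i \<le> b0 \<bullet> i"
        using * x i by (cases "i \<in> D") (auto simp: coord_box_def thicken_def a0_def b0_def less_imp_le)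
    qed
  qed
  have lm: "thicken D S \<in> lmeasurable"
    using sub borel_thicken[OF S(1)] by (intro bounded_set_imp_lmeasurable bounded_subset[OF bounded_cbox sub]) auto
  define m where "m = measure lebesgue (thicken D S)"
  have m0: "m \<ge> 0" by (simp add: m_def)
  have em: "emeasure lborel (thicken D S) = ennreal m"
  proof -
    have "emeasure lborel (thicken D S) = emeasure lebesgue (thicken D S)"
      using borel_thicken[OF S(1)] by simp
    also have "\<dots> = ennreal m" unfolding m_def by (rule emeasure_eq_measure2[OF lm])
    finally show ?thesis .
  qed
  have bne: "box a0 b0 \<noteq> {}" using M by (auto simp: box_ne_empty a0_def b0_def)
  have step: "hausdorff_measure d S \<le> H * ennreal (m + e)" if e: "e > 0" for e
  proof -
    obtain \<D> where \<D>: "countable \<D>" "\<And>K. K \<in> \<D> \<Longrightarrow> K \<subseteq> cbox a0 b0 \<and> K \<noteq> {} \<and> (\<exists>c d. K = cbox c d)"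
        "pairwise (\<lambda>A B. interior A \<inter> interior B = {}) \<D>"
        "\<And>u v. cbox u v \<in> \<D> \<Longrightarrow> \<exists>n. \<forall>i \<in> Basis. v \<bullet> i - u \<bullet> i = (b0 \<bullet> i - a0 \<bullet> i)/2^n"
        "\<And>K. \<lbrakk>K \<in> \<D>; box a0 b0 \<noteq> {}\<rbrakk> \<Longrightarrow> interior K \<noteq> {}"
        "thicken D S \<subseteq> \<Union>\<D>" "\<Union>\<D> \<in> lmeasurable" "measure lebesgue (\<Union>\<D>) \<le> measure lebesgue (thicken D S) + e / 2"
      by (rule measurable_outer_intervals_bounded[OF lm sub half_gt_zero[OF e]], rule that)
    define I where "I = to_nat_on \<D> ` \<D>"
    define K where "K i = (if i \<in> I then from_nat_into \<D> i else {})" for i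
    have Knat: "K (to_nat_on \<D> A) = A" if "A \<in> \<D>" for A
      using that from_nat_into_to_nat_on[OF \<D>(1) that] unfolding K_def I_def by simp
    have KD: "K i \<in> \<D>" if i: "i \<in> I" for i
    proof -
      obtain A where "A \<in> \<D>" "i = to_nat_on \<D> A" using i unfolding I_def by blast
      then show ?thesis using Knat[of A] by simp
    qed
    have UK: "\<Union>\<D> = (\<Union>i. K i)"
    proof
      show "\<Union>\<D> \<subseteq> (\<Union>i. K i)"
      proof
        fix x assume "x \<in> \<Union>\<D>"
        then obtain A where A: "A \<in> \<D>" "x \<in> A" by blast
        then have "x \<in> K (to_nat_on \<D> A)" using Knat by simp
        then show "x \<in> (\<Union>i. K i)" by (rule UN_I[OF UNIV_I])
      qed
      show "(\<Union>i. K i) \<subseteq> \<Union>\<D>"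
      proof
        fix x assume "x \<in> (\<Union>i. K i)"
        then obtain i where i: "x \<in> K i" by blast
        then have "i \<in> I" unfolding K_def by (cases "i \<in> I") simp_all
        then show "x \<in> \<Union>\<D>" using KD i by blast
      qed
    qed
    have Kdisj: "interior (K i) \<inter> interior (K j) = {}" if "i \<noteq> j" for i j
    proof (cases "i \<in> I \<and> j \<in> I")
      case True
      then obtain A B where AB: "A \<in> \<D>" "B \<in> \<D>" "i = to_nat_on \<D> A" "j = to_nat_on \<D> B"
        unfolding I_def by blast
      then have "A \<noteq> B" using that by blast
      then show ?thesis using pairwiseD[OF \<D>(3) AB(1,2)] Knat[OF AB(1)] Knat[OF AB(2)] AB(3,4) by simp
    next
      case False
      then have "K i = {} \<or> K j = {}" unfolding K_def by auto
      then show ?thesis by auto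
    qed
    have "\<exists>u v k. K i = cbox u v \<and> (\<forall>j\<in>Basis. v \<bullet> j - u \<bullet> j = (if j \<in> D then 2 * M else 1) / 2 ^ k)" if i: "i \<in> I" for i
    proof -
      obtain u v where uv: "K i = cbox u v" using \<D>(2)[OF KD[OF i]] by blast
      then obtain k where "\<forall>j\<in>Basis. v \<bullet> j - u \<bullet> j = (b0 \<bullet> j - a0 \<bullet> j) / 2 ^ k"
        using \<D>(4)[of u v] KD[OF i] by auto
      then have "\<forall>j\<in>Basis. v \<bullet> j - u \<bullet> j = (if j \<in> D then 2 * M else 1) / 2 ^ k" by (auto simp: a0_def b0_def)
      then show ?thesis using uv by blast
    qed
    then obtain u v k where K: "\<And>i. i \<in> I \<Longrightarrow> K i = cbox (u i) (v i) \<and> (\<forall>j\<in>Basis. v i \<bullet> j - u i \<bullet> j = (if j \<in> D then 2 * M else 1) / 2 ^ k i)"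
      by metis
    have Kint: "emeasure lborel (K i) = emeasure lborel (interior (K i))" for i
    proof (cases "i \<in> I")
      case True
      have le: "u i \<bullet> j \<le> v i \<bullet> j" if "j \<in> Basis" for j
      proof -
        have "0 \<le> v i \<bullet> j - u i \<bullet> j" using K[OF True] that M by simp
        then show ?thesis by simp
      qed
      then show ?thesis using K[OF True] by (simp add: interior_cbox)
    qed (simp add: K_def)
    \<comment> \<open>The pieces overlap only in their boundaries, which are null sets; their
      interiors are disjoint and add up.\<close>
    have "(\<Sum>i. emeasure lborel (K i)) = (\<Sum>i. emeasure lborel (interior (K i)))" by (simp only: Kint)
    also have "\<dots> = emeasure lborel (\<Union>i. interior (K i))"
      using Kdisj by (intro suminf_emeasure) (auto simp: disjoint_family_on_def)
    also have "\<dots> \<le> emeasure lebesgue (\<Union>\<D>)"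
    proof -
      have "emeasure lborel (\<Union>i. interior (K i)) = emeasure lebesgue (\<Union>i. interior (K i))"
        by simp
      also have "\<dots> \<le> emeasure lebesgue (\<Union>\<D>)"
        unfolding UK using \<D>(7) interior_subset by (intro emeasure_mono) (auto simp: UK fmeasurableD)
      finally show ?thesis .
    qed
    also have "\<dots> = ennreal (measure lebesgue (\<Union>\<D>))"
      using \<D>(7) by (simp add: emeasure_eq_measure2)
    also have "\<dots> \<le> ennreal (m + e / 2)" using \<D>(8) by (intro ennreal_leI) (simp add: m_def)
    finally have sum: "(\<Sum>i. emeasure lborel (K i)) \<le> ennreal (m + e / 2)" .
    have "\<exists>x. (\<forall>j\<in>Basis - D. 0 < x \<bullet> j \<and> x \<bullet> j < 1) \<and>
     (\<Sum>i. ennreal ((2 * M / 2 ^ k i) ^ card D) * indicator {x. i \<in> I \<and> (\<forall>j\<in>Basis - D. u i \<bullet> j \<le> x \<bullet> j \<and> x \<bullet> j \<le> v i \<bullet> j)} x) \<le> ennreal ((m + e / 2) + e / 2)"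
    proof (rule thicken_cover_slice[OF D M _ _ sum])
      show "K i = cbox (u i) (v i) \<and> K i \<noteq> {} \<and> (\<forall>j\<in>Basis. v i \<bullet> j - u i \<bullet> j = (if j \<in> D then 2 * M else 1) / 2 ^ k i)" if "i \<in> I" for i
        using K[OF that] \<D>(2)[OF KD[OF that]] by blast
      show "K i = {}" if "i \<notin> I" for i using that by (simp add: K_def)
    qed (use m0 e in simp_all)
    then obtain x where x: "\<forall>j\<in>Basis - D. 0 < x \<bullet> j \<and> x \<bullet> j < 1"
      "(\<Sum>i. ennreal ((2 * M / 2 ^ k i) ^ d) * indicator {x. i \<in> I \<and> (\<forall>j\<in>Basis - D. u i \<bullet> j \<le> x \<bullet> j \<and> x \<bullet> j \<le> v i \<bullet> j)} x) \<le> ennreal (m + e)"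
      unfolding d_def add.assoc field_sum_of_halves by (elim exE conjE)
    define C where "C i = (if i \<in> I \<and> (\<forall>j\<in>Basis - D. u i \<bullet> j \<le> x \<bullet> j \<and> x \<bullet> j \<le> v i \<bullet> j)
       then coord_box D (\<lambda>j. u i \<bullet> j) (\<lambda>j. u i \<bullet> j + 2 * M / 2 ^ k i) else {})" for i
    have "S \<subseteq> (\<Union>i. C i)"
    proof
      fix p assume p: "p \<in> S"
      then have pb: "p \<in> coord_box D (\<lambda>_. - M) (\<lambda>_. M)" using S by blast
      \<comment> \<open>The point of the thickened set that lies over \<open>p\<close> at the chosen
        offset \<open>x\<close>.\<close>
      define q where "q = (\<Sum>j\<in>Basis. (if j \<in> D then p \<bullet> j else x \<bullet> j) *\<^sub>R j)"
      have qj: "q \<bullet> j = (if j \<in> D then p \<bullet> j else x \<bullet> j)" if "j \<in> Basis" for j using that by (simp add: q_def)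
      have "coord_proj D q = p" 
        by (rule euclidean_eqI) (use pb in \<open>auto simp: qj coord_box_def\<close>)
      then have "q \<in> thicken D S" using p x(1) by (auto simp: thicken_def qj)
      then have "q \<in> (\<Union>i. K i)" using \<D>(6) UK by blast
      then obtain i where i: "q \<in> K i" by blast
      then have iI: "i \<in> I" unfolding K_def by (cases "i \<in> I") simp_all
      then have q: "\<And>j. j \<in> Basis \<Longrightarrow> u i \<bullet> j \<le> q \<bullet> j \<and> q \<bullet> j \<le> v i \<bullet> j" using i K[OF iI] by (simp add: mem_box)
      have 1: "\<forall>j\<in>Basis - D. u i \<bullet> j \<le> x \<bullet> j \<and> x \<bullet> j \<le> v i \<bullet> j" 
      proof
        fix j assume "j \<in> Basis - D"
        then show "u i \<bullet> j \<le> x \<bullet> j \<and> x \<bullet> j \<le> v i \<bullet> j" using q[of j] qj[of j] by simp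
      qed
      have "p \<in> coord_box D (\<lambda>j. u i \<bullet> j) (\<lambda>j. u i \<bullet> j + 2 * M / 2 ^ k i)"
        unfolding coord_box_def mem_Collect_eq
      proof (intro conjI ballI)
        fix j assume j: "j \<in> D"
        then have jB: "j \<in> Basis" using D by auto
        have "v i \<bullet> j - u i \<bullet> j = 2 * M / 2 ^ k i" using K[OF iI] jB j by simp
        then show "u i \<bullet> j \<le> p \<bullet> j" "p \<bullet> j \<le> u i \<bullet> j + 2 * M / 2 ^ k i" using q[OF jB] qj[OF jB] j by auto
      next
        fix j assume "j \<in> Basis - D"
        then show "p \<bullet> j = 0" using pb by (auto simp: coord_box_def)
      qed
      then have "p \<in> C i" using 1 iI by (simp add: C_def)
      then show "p \<in> (\<Union>i. C i)" by (rule UN_I[OF UNIV_I])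
    qed
    then have "hausdorff_measure d S \<le> hausdorff_measure d (\<Union>i. C i)" by (rule hausdorff_measure_mono)
    also have "\<dots> \<le> (\<Sum>i. hausdorff_measure d (C i))" by (rule hausdorff_measure_subadditive)
    also have "\<dots> \<le> (\<Sum>i. H * (ennreal ((2 * M / 2 ^ k i) ^ d) * indicator {x. i \<in> I \<and> (\<forall>j\<in>Basis - D. u i \<bullet> j \<le> x \<bullet> j \<and> x \<bullet> j \<le> v i \<bullet> j)} x))"
    proof (intro suminf_le allI)
      fix i
      have "hausdorff_measure d (coord_box D (\<lambda>j. u i \<bullet> j) (\<lambda>j. u i \<bullet> j + 2 * M / 2 ^ k i)) \<le> ennreal ((2 * M / 2 ^ k i) ^ d) * H"
        unfolding H_def using M by (intro hausdorff_coord_cube_le[OF D]) simp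
      then show "hausdorff_measure d (C i) \<le> H * (ennreal ((2 * M / 2 ^ k i) ^ d) * indicator {x. i \<in> I \<and> (\<forall>j\<in>Basis - D. u i \<bullet> j \<le> x \<bullet> j \<and> x \<bullet> j \<le> v i \<bullet> j)} x)"
        by (auto simp: C_def mult.commute)
    qed auto
    also have "\<dots> = H * (\<Sum>i. ennreal ((2 * M / 2 ^ k i) ^ d) * indicator {x. i \<in> I \<and> (\<forall>j\<in>Basis - D. u i \<bullet> j \<le> x \<bullet> j \<and> x \<bullet> j \<le> v i \<bullet> j)} x)"
      by (rule ennreal_suminf_cmult)
    also have "\<dots> \<le> H * ennreal (m + e)" by (intro mult_left_mono x(2)) simp
    finally show ?thesis .
  qed
  have Hfin: "H < \<infinity>" unfolding H_def d_def by (rule hausdorff_unit_cube_finite[OF D])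
  then obtain h where h: "h \<ge> 0" "H = ennreal h" by (cases H) auto
  have "hausdorff_measure d S \<le> ennreal (h * m)"
  proof (rule ennreal_le_epsilon)
    fix e :: real assume e: "e > 0"
    \<comment> \<open>Dividing by \<open>h + 1\<close> covers the case \<open>h = 0\<close> as
      well.\<close>
    have "h * e \<le> e * (h + 1)" using h e by (simp add: distrib_left mult.commute)
    then have "h * (e / (h + 1)) \<le> e" using h by (simp add: pos_divide_le_eq)
    have "hausdorff_measure d S \<le> ennreal h * ennreal (m + e / (h + 1))" using step[of "e / (h + 1)"] e h by simp
    also have "\<dots> = ennreal (h * m + h * (e / (h + 1)))" using h m0 e by (subst ennreal_mult[symmetric]) (simp_all add: distrib_left)
    also have "\<dots> \<le> ennreal (h * m + e)" using \<open>h * (e / (h + 1)) \<le> e\<close> by (intro ennreal_leI) simp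
    also have "\<dots> = ennreal (h * m) + ennreal e" using h m0 e by (intro ennreal_plus) auto
    finally show "hausdorff_measure d S \<le> ennreal (h * m) + ennreal e" .
  qed
  also have "\<dots> = H * ennreal m" using h m0 by (simp add: ennreal_mult)
  finally show ?thesis by (simp add: H_def d_def em)
qed

text \<open>The lower bound comes from the complement in a cube Q of side 2 M: scaling bounds the
  measure of Q from below exactly, and Q - S takes at most its share by the upper bound already
  proved. All terms subtracted are finite, so at least its share is left for S.\<close>

lemma hausdorff_eq_lborel_thicken:
  fixes S :: "'a::euclidean_space set"
  assumes D: "D \<subseteq> Basis" and M: "M > 0" and S: "S \<in> sets borel" "S \<subseteq> coord_box D (\<lambda>_. - M) (\<lambda>_. M)"
  shows "hausdorff_measure (card D) S = hausdorff_measure (card D) (coord_box D (\<lambda>_. 0) (\<lambda>_. 1) :: 'a set) * emeasure lborel (thicken D S)"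
    and "emeasure lborel (thicken D S) < \<infinity>"
proof -
  define d where "d = card D"
  define H where "H = hausdorff_measure d (coord_box D (\<lambda>_. 0) (\<lambda>_. 1) :: 'a set)"
  let ?Q = "coord_box D (\<lambda>_. - M) (\<lambda>_. M) :: 'a set"
  have Q: "?Q \<in> sets borel"
  proof -
    have "?Q = {x. \<forall>i\<in>D. - M \<le> x \<bullet> i \<and> x \<bullet> i \<le> M} \<inter> {x. \<forall>i\<in>Basis - D. x \<bullet> i = 0}" by (auto simp: coord_box_def)
    moreover have "{x :: 'a. \<forall>i\<in>Basis \<inter> D. - M \<le> x \<bullet> i \<and> x \<bullet> i \<le> M} \<in> sets borel" by measurable
    then have "{x :: 'a. \<forall>i\<in>D. - M \<le> x \<bullet> i \<and> x \<bullet> i \<le> M} \<in> sets borel" using D by (simp only: Int_absorb1)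
    moreover have "{x :: 'a. \<forall>i\<in>Basis - D. x \<bullet> i = 0} \<in> sets borel" by measurable
    ultimately show ?thesis by auto
  qed
  have "ennreal ((2 * M) ^ d) = emeasure lborel (thicken D ?Q)"
  proof -
    define a0 where "a0 = (\<Sum>j\<in>Basis. (if j \<in> D then - M else 0) *\<^sub>R j)"
    define b0 where "b0 = (\<Sum>j\<in>Basis. (if j \<in> D then M else 1) *\<^sub>R j)"
    have 1: "emeasure lborel (cbox a0 b0) = ennreal ((2 * M) ^ card D * 1 ^ card (Basis - D))"
      and 2: "emeasure lborel (box a0 b0) = ennreal ((2 * M) ^ card D * 1 ^ card (Basis - D))"
      using M D by (intro emeasure_cbox_if; auto simp: a0_def b0_def)+
    have in_thicken: "x \<in> thicken D ?Q \<longleftrightarrow> (\<forall>i\<in>D. - M \<le> x \<bullet> i \<and> x \<bullet> i \<le> M) \<and> (\<forall>i\<in>Basis - D. 0 < x \<bullet> i \<and> x \<bullet> i < 1)" for x :: 'a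
      using D by (auto simp: thicken_def coord_box_def subset_iff)
    \<comment> \<open>The thickened cube is closed in the directions of D and open in the others, so
      it is caught between an open and a closed box of equal volume.\<close>
    have "box a0 b0 \<subseteq> thicken D ?Q" using D by (auto simp: in_thicken box_def a0_def b0_def subset_iff less_imp_le)
    then have "emeasure lborel (box a0 b0) \<le> emeasure lborel (thicken D ?Q)" using borel_thicken[OF Q] by (intro emeasure_mono) auto
    moreover have "thicken D ?Q \<subseteq> cbox a0 b0" using D by (auto simp: in_thicken cbox_def a0_def b0_def subset_iff less_imp_le)
    then have "emeasure lborel (thicken D ?Q) \<le> emeasure lborel (cbox a0 b0)" by (intro emeasure_mono) auto
    ultimately show ?thesis unfolding 1 2 by (simp add: d_def)
  qed
  also have "thicken D ?Q = thicken D S \<union> thicken D (?Q - S)" using S by (auto simp: thicken_def)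
  also have "emeasure lborel \<dots> = emeasure lborel (thicken D S) + emeasure lborel (thicken D (?Q - S))"
    using S Q by (intro plus_emeasure[symmetric]) (auto simp: thicken_def intro!: borel_thicken)
  finally have sum: "emeasure lborel (thicken D S) + emeasure lborel (thicken D (?Q - S)) = ennreal ((2 * M) ^ d)" ..
  have "emeasure lborel (thicken D S) \<le> ennreal ((2 * M) ^ d)" "emeasure lborel (thicken D (?Q - S)) \<le> ennreal ((2 * M) ^ d)"
    unfolding sum[symmetric] by simp_all
  then have fin: "emeasure lborel (thicken D S) < \<infinity>" and fin2: "emeasure lborel (thicken D (?Q - S)) < \<infinity>"
    by (auto intro: le_less_trans)
  show "emeasure lborel (thicken D S) < \<infinity>" by (rule fin)
  have Hfin: "H < \<infinity>" unfolding H_def d_def by (rule hausdorff_unit_cube_finite[OF D])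
  have "H \<le> ennreal ((1 / (2 * M)) ^ d) * hausdorff_measure d ?Q"
  proof -
    let ?f = "\<lambda>x :: 'a. (\<Sum>i\<in>Basis. (if i \<in> D then 1 / 2 else 0) *\<^sub>R i) + (1 / (2 * M)) *\<^sub>R x"
    have "coord_box D (\<lambda>_. 0) (\<lambda>_. 1) \<subseteq> ?f ` ?Q"
    proof
      fix x :: 'a assume x: "x \<in> coord_box D (\<lambda>_. 0) (\<lambda>_. 1)"
      define w where "w = (2 * M) *\<^sub>R (x - (\<Sum>i\<in>Basis. (if i \<in> D then 1 / 2 else 0) *\<^sub>R i))"
      have "x = ?f w" using M by (simp add: w_def)
      moreover have "w \<in> ?Q"
        unfolding coord_box_def mem_Collect_eq
      proof (intro conjI ballI)
        fix i assume i: "i \<in> D"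
        then have "i \<in> Basis" using D by auto
        then have w: "w \<bullet> i = (2 * M) * (x \<bullet> i) - M" using i by (simp add: w_def inner_diff_left algebra_simps)
        have "0 \<le> x \<bullet> i" "x \<bullet> i \<le> 1" using x i by (auto simp: coord_box_def)
        then have "0 \<le> (2 * M) * (x \<bullet> i)" "(2 * M) * (x \<bullet> i) \<le> (2 * M) * 1" using M by (auto intro!: mult_left_mono)
        then show "- M \<le> w \<bullet> i" "w \<bullet> i \<le> M" unfolding w by linarith+
      next
        fix i assume "i \<in> Basis - D"
        then show "w \<bullet> i = 0" using x by (auto simp: w_def inner_diff_left coord_box_def)
      qed
      ultimately show "x \<in> ?f ` ?Q" by blast
    qed
    then have "H \<le> hausdorff_measure d (?f ` ?Q)" unfolding H_def by (rule hausdorff_measure_mono)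
    also have "\<dots> \<le> ennreal ((1 / (2 * M)) ^ d) * hausdorff_measure d ?Q"
      using M by (intro hausdorff_measure_lipschitz_image) (auto simp: dist_norm simp flip: scaleR_diff_right)
    finally show ?thesis .
  qed
  then have "ennreal ((2 * M) ^ d) * H \<le> ennreal ((2 * M) ^ d) * (ennreal ((1 / (2 * M)) ^ d) * hausdorff_measure d ?Q)"
    by (rule mult_left_mono) simp
  also have "\<dots> = hausdorff_measure d ?Q"
    using M by (simp add: mult.assoc[symmetric] power_one_over flip: ennreal_mult)
  also have "\<dots> \<le> hausdorff_measure d (S \<union> (?Q - S))" by (rule hausdorff_measure_mono) auto
  also have "\<dots> \<le> hausdorff_measure d S + hausdorff_measure d (?Q - S)" by (rule hausdorff_measure_Un)
  also have "hausdorff_measure d (?Q - S) \<le> H * emeasure lborel (thicken D (?Q - S))"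
    unfolding H_def d_def using S Q by (intro hausdorff_le_lborel_thicken[OF D M]) auto
  finally have "ennreal ((2 * M) ^ d) * H \<le> hausdorff_measure d S + H * emeasure lborel (thicken D (?Q - S))"
    by (simp add: add_left_mono)
  then have "H * emeasure lborel (thicken D S) + H * emeasure lborel (thicken D (?Q - S)) \<le> hausdorff_measure d S + H * emeasure lborel (thicken D (?Q - S))"
    by (simp only: sum[symmetric] distrib_right mult.commute[of H])
  moreover have "H * emeasure lborel (thicken D (?Q - S)) < \<infinity>" using Hfin fin2 by (simp add: ennreal_mult_less_top)
  ultimately have "H * emeasure lborel (thicken D S) \<le> hausdorff_measure d S"
    by (auto simp: ennreal_add_left_cancel_le add.commute)
  moreover have "hausdorff_measure d S \<le> H * emeasure lborel (thicken D S)"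
    unfolding H_def d_def by (rule hausdorff_le_lborel_thicken[OF D M S])
  ultimately show "hausdorff_measure (card D) S = hausdorff_measure (card D) (coord_box D (\<lambda>_. 0) (\<lambda>_. 1) :: 'a set) * emeasure lborel (thicken D S)"
    unfolding H_def d_def by (rule antisym[rotated])
qed

section \<open>Isometry invariance of Lebesgue measure\<close>

lemma thicken_Basis [simp]: "thicken Basis S = S"
  by (auto simp: thicken_def coord_proj_def euclidean_representation)

lemma lborel_distr_orthogonal:
  fixes f :: "'a::euclidean_space \<Rightarrow> 'a"
  assumes f: "orthogonal_transformation f"
  shows "distr lborel borel f = (lborel :: 'a measure)"
proof (rule lborel_eqI[symmetric])
  have lin: "linear f" using f by (rule orthogonal_transformation_linear)
  have meas: "f \<in> borel_measurable borel"
    by (intro borel_measurable_continuous_onI linear_continuous_on linear_conv_bounded_linear[THEN iffD1] lin)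
  have dist: "dist (f x) (f y) = dist x y" for x y
    using f by (metis dist_norm lin linear_diff orthogonal_transformation_norm)
  have bij: "bij f" using f by (rule orthogonal_transformation_bij)
  fix l u :: 'a assume le: "\<And>b. b \<in> Basis \<Longrightarrow> l \<bullet> b \<le> u \<bullet> b"
  let ?A = "f -` box l u"
  have A: "?A \<in> sets borel" using measurable_sets[OF meas, of "box l u"] by simp
  have im: "f ` ?A = box l u" using bij by (simp add: bij_is_surj surj_image_vimage_eq)
  have bd: "bounded ?A"
  proof -
    obtain R where R: "\<And>y. y \<in> box l u \<Longrightarrow> norm y \<le> R" using bounded_box[of l u] unfolding bounded_iff by blast
    have "norm x \<le> R" if "x \<in> ?A" for x using R[of "f x"] that orthogonal_transformation_norm[OF f, of x] by simp
    then show ?thesis unfolding bounded_iff by blast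
  qed
  have "\<exists>M>0. X \<subseteq> coord_box Basis (\<lambda>_. - M) (\<lambda>_. M)" if "bounded X" for X :: "'a set"
  proof -
    obtain R where R: "R > 0" "\<And>x. x \<in> X \<Longrightarrow> norm x \<le> R" using \<open>bounded X\<close> unfolding bounded_pos by blast
    have "\<bar>x \<bullet> i\<bar> \<le> R" if "x \<in> X" "i \<in> Basis" for x i using R(2)[OF that(1)] Basis_le_norm[OF that(2), of x] by linarith
    then have "X \<subseteq> coord_box Basis (\<lambda>_. - R) (\<lambda>_. R)" unfolding coord_box_def by (auto simp: abs_le_iff minus_le_iff)
    then show ?thesis using R(1) by blast
  qed
  note M = this
  let ?H = "hausdorff_measure (card (Basis :: 'a set)) (coord_box Basis (\<lambda>_. 0) (\<lambda>_. 1) :: 'a set)"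
  obtain M1 where M1: "M1 > 0" "?A \<subseteq> coord_box Basis (\<lambda>_. - M1) (\<lambda>_. M1)" using M[OF bd] by blast
  obtain M2 where M2: "M2 > 0" "box l u \<subseteq> coord_box Basis (\<lambda>_. - M2) (\<lambda>_. M2)" using M[OF bounded_box] by blast
  have "?H * emeasure lborel (box l u) = hausdorff_measure (card (Basis :: 'a set)) (f ` ?A)"
    unfolding im by (rule hausdorff_eq_lborel_thicken(1)[OF subset_refl M2(1) _ M2(2), unfolded thicken_Basis, symmetric]) simp
  also have "\<dots> = hausdorff_measure (card (Basis :: 'a set)) ?A" by (rule hausdorff_measure_isometry_image) (rule dist)
  also have "\<dots> = ?H * emeasure lborel ?A"
    using hausdorff_eq_lborel_thicken(1)[OF subset_refl M1(1) A M1(2)] by simp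
  finally have "?H * emeasure lborel (box l u) = ?H * emeasure lborel ?A" .
  \<comment> \<open>Cancellation is legitimate because the Hausdorff measure of the unit cube is
    neither 0 nor infinite.\<close>
  then have "emeasure lborel (box l u) = emeasure lborel ?A"
    using hausdorff_unit_cube_pos[OF subset_refl, where 'a='a] hausdorff_unit_cube_finite[OF subset_refl, where 'a='a]
    by (subst (asm) ennreal_mult_cancel_left) auto
  then show "emeasure (distr lborel borel f) (box l u) = (\<Prod>b\<in>Basis. (u - l) \<bullet> b)"
    using le by (simp add: emeasure_distr meas)
qed simp

section \<open>Sections of the simplex and the exponential distribution\<close>

lemma emeasure_thicken_scale:
  fixes S :: "'a::euclidean_space set"
  assumes D: "D \<subseteq> Basis" and c: "c > 0" and S: "S \<in> sets borel"
  shows "emeasure lborel (thicken D {x. (1 / c) *\<^sub>R x \<in> S}) = ennreal (c ^ card D) * emeasure lborel (thicken D S)"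
proof -
  define k where "k j = (if j \<in> D then c else 1)" for j :: 'a
  \<comment> \<open>Scales the directions of D alone, with determinant c^(card D); the unit cube in
    the other directions stays as it is.\<close>
  define T where "T x = 0 + (\<Sum>j\<in>Basis. (k j * (x \<bullet> j)) *\<^sub>R j)" for x :: 'a
  have Tj: "T x \<bullet> j = k j * (x \<bullet> j)" if "j \<in> Basis" for x j using that by (simp add: T_def)
  have lb: "lborel = density (distr lborel borel T) (\<lambda>_. ennreal (\<Prod>j\<in>Basis. \<bar>k j\<bar>))"
    unfolding T_def using c by (intro lborel_affine_euclidean) (simp add: k_def)
  have "(\<Prod>j\<in>Basis. \<bar>k j\<bar>) = (\<Prod>j\<in>(Basis :: 'a set). if j \<in> D then c else 1)"
    using c by (intro prod.cong) (auto simp: k_def)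
  then have pr: "(\<Prod>j\<in>Basis. \<bar>k j\<bar>) = c ^ card D" using prod_Basis_if[OF D, of c 1] by simp
  have T: "T \<in> borel_measurable borel"
    unfolding T_def by (intro borel_measurable_continuous_onI continuous_intros)
  let ?X = "thicken D {x. (1 / c) *\<^sub>R x \<in> S}"
  have "{x. (1 / c) *\<^sub>R x \<in> S} = (\<lambda>x. (1 / c) *\<^sub>R x) -` S \<inter> space borel" by auto
  also have "\<dots> \<in> sets borel" by (rule measurable_sets[OF _ S]) measurable
  finally have X: "?X \<in> sets borel" by (rule borel_thicken)
  have TX: "T -` ?X = thicken D S"
  proof (rule set_eqI)
    fix x
    have "(1 / c) *\<^sub>R coord_proj D (T x) = coord_proj D x"
      by (rule euclidean_eqI) (use c in \<open>auto simp: Tj k_def\<close>)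
    moreover have "T x \<bullet> i = x \<bullet> i" if "i \<in> Basis - D" for i using that by (simp add: Tj k_def)
    ultimately show "x \<in> T -` ?X \<longleftrightarrow> x \<in> thicken D S" by (simp add: thicken_def)
  qed
  have "emeasure lborel ?X = emeasure (density (distr lborel borel T) (\<lambda>_. ennreal (c ^ card D))) ?X"
    by (subst lb) (simp add: pr)
  also have "\<dots> = ennreal (c ^ card D) * emeasure (distr lborel borel T) ?X"
    using X by (subst emeasure_density) (auto simp: nn_integral_cmult_indicator)
  also have "emeasure (distr lborel borel T) ?X = emeasure lborel (thicken D S)"
    using X T by (subst emeasure_distr) (auto simp: TX)
  finally show ?thesis .
qed

lemma emeasure_lborel_Times:
  assumes "X \<in> sets borel" "Y \<in> sets borel"
  shows "emeasure lborel (X \<times> Y) = emeasure lborel X * emeasure lborel Y"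
  using assms by (subst lborel_prod[symmetric]) (simp add: lborel.emeasure_pair_measure_Times)

text \<open>The span of D is not a type of its own, so y runs through the whole space.
  \<open>coord_proj\<close> forgets its coordinates outside D, and the indicator confines these to
  the open unit cube, of measure 1.\<close>

lemma lborel_split_two:
  fixes D :: "'a::euclidean_space set"
  assumes D: "D \<subseteq> Basis" and b: "Basis - D = {b0, b1}" "b0 \<noteq> b1"
    and F: "F \<in> borel_measurable borel"
  shows "(\<integral>\<^sup>+x. F x \<partial>lborel) =
    (\<integral>\<^sup>+(s, t, y). F (s *\<^sub>R b0 + t *\<^sub>R b1 + coord_proj D y) * indicator {y. \<forall>i\<in>Basis - D. 0 < y \<bullet> i \<and> y \<bullet> i < 1} y
       \<partial>(lborel :: (real \<times> real \<times> 'a) measure))"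
proof -
  define A where "A = {y :: 'a. \<forall>i\<in>Basis - D. 0 < y \<bullet> i \<and> y \<bullet> i < 1}"
  define A' where "A' = (UNIV :: real set) \<times> (UNIV :: real set) \<times> A"
  define \<Psi> where "\<Psi> = (\<lambda>(s, t, y). s *\<^sub>R b0 + t *\<^sub>R b1 + coord_proj D y)"
  have A: "A \<in> sets borel" unfolding A_def by measurable
  have A': "A' \<in> sets borel" unfolding A'_def using A by (simp add: borel_prod[symmetric])
  have \<Psi>: "\<Psi> \<in> borel_measurable borel"
  proof -
    have "\<Psi> = (\<lambda>p. fst p *\<^sub>R b0 + fst (snd p) *\<^sub>R b1 + coord_proj D (snd (snd p)))" by (auto simp: \<Psi>_def)
    moreover have "(\<lambda>p. fst p *\<^sub>R b0 + fst (snd p) *\<^sub>R b1 + coord_proj D (snd (snd p))) \<in> borel_measurable (borel \<Otimes>\<^sub>M (borel \<Otimes>\<^sub>M borel) :: (real \<times> real \<times> 'a) measure)"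
      by measurable
    ultimately show ?thesis by (simp add: borel_prod)
  qed
  have bB: "b0 \<in> Basis" "b1 \<in> Basis" "b0 \<notin> D" "b1 \<notin> D" using b by auto
  have Basis: "(Basis :: 'a set) = insert b0 (insert b1 D)" using b D by auto
  have finD: "finite D" using D finite_Basis finite_subset by blast
  have \<Psi>0: "\<Psi> (s, t, y) \<bullet> b0 = s" and \<Psi>1: "\<Psi> (s, t, y) \<bullet> b1 = t" and \<Psi>D: "i \<in> D \<Longrightarrow> \<Psi> (s, t, y) \<bullet> i = y \<bullet> i" for s t y i
    using bB b(2) D by (auto simp: \<Psi>_def inner_add_left inner_Basis subset_iff)
  have "lborel = distr (density lborel (indicator A')) borel \<Psi>"
  proof (rule lborel_eqI)
    fix l u :: 'a assume le: "\<And>i. i \<in> Basis \<Longrightarrow> l \<bullet> i \<le> u \<bullet> i"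
    define l' where "l' = (\<Sum>i\<in>Basis. (if i \<in> D then l \<bullet> i else 0) *\<^sub>R i)"
    define u' where "u' = (\<Sum>i\<in>Basis. (if i \<in> D then u \<bullet> i else 1) *\<^sub>R i)"
    have le': "l' \<bullet> i \<le> u' \<bullet> i" if "i \<in> Basis" for i using le that by (simp add: l'_def u'_def)
    have pre: "\<Psi> -` box l u \<inter> A' = {l \<bullet> b0<..<u \<bullet> b0} \<times> ({l \<bullet> b1<..<u \<bullet> b1} \<times> box l' u')"
    proof (rule set_eqI)
      fix p :: "real \<times> real \<times> 'a"
      obtain s t y where p: "p = (s, t, y)" by (cases p)
      have 1: "\<Psi> (s, t, y) \<in> box l u \<longleftrightarrow> l \<bullet> b0 < s \<and> s < u \<bullet> b0 \<and> l \<bullet> b1 < t \<and> t < u \<bullet> b1 \<and> (\<forall>i\<in>D. l \<bullet> i < y \<bullet> i \<and> y \<bullet> i < u \<bullet> i)"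
        unfolding mem_box Basis by (simp add: \<Psi>0 \<Psi>1 \<Psi>D)
      have 2: "y \<in> box l' u' \<longleftrightarrow> (\<forall>i\<in>D. l \<bullet> i < y \<bullet> i \<and> y \<bullet> i < u \<bullet> i) \<and> y \<in> A"
      proof -
        have "l' \<bullet> i = (if i \<in> D then l \<bullet> i else 0) \<and> u' \<bullet> i = (if i \<in> D then u \<bullet> i else 1)" if "i \<in> Basis" for i
          using that by (simp add: l'_def u'_def)
        then show ?thesis using D unfolding mem_box A_def by (auto simp: subset_iff)
      qed
      show "p \<in> \<Psi> -` box l u \<inter> A' \<longleftrightarrow> p \<in> {l \<bullet> b0<..<u \<bullet> b0} \<times> ({l \<bullet> b1<..<u \<bullet> b1} \<times> box l' u')"
        unfolding p using 1 2 by (auto simp: A'_def)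
    qed
    have "emeasure (distr (density lborel (indicator A')) borel \<Psi>) (box l u) = emeasure (density lborel (indicator A')) (\<Psi> -` box l u)"
      using \<Psi> by (subst emeasure_distr) auto
    also have "\<dots> = emeasure lborel (\<Psi> -` box l u \<inter> A')"
      using measurable_sets[OF \<Psi>, of "box l u"] A'
      by (subst emeasure_density) (auto simp: indicator_inter_arith[symmetric] Int_commute intro!: nn_integral_indicator)
    also have "\<dots> = emeasure lborel {l \<bullet> b0<..<u \<bullet> b0} * (emeasure lborel {l \<bullet> b1<..<u \<bullet> b1} * emeasure lborel (box l' u'))"
      unfolding pre by (simp add: emeasure_lborel_Times borel_Times)
    also have "\<dots> = ennreal ((u - l) \<bullet> b0) * (ennreal ((u - l) \<bullet> b1) * ennreal (\<Prod>i\<in>Basis. (u' - l') \<bullet> i))"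
      using le[OF bB(1)] le[OF bB(2)] le' by (simp add: inner_diff_left)
    also have "(\<Prod>i\<in>Basis. (u' - l') \<bullet> i) = (\<Prod>i\<in>D. (u - l) \<bullet> i)"
    proof -
      have "(\<Prod>i\<in>Basis. (u' - l') \<bullet> i) = (\<Prod>i\<in>Basis. if i \<in> D then (u - l) \<bullet> i else 1)"
        by (intro prod.cong refl) (auto simp: l'_def u'_def inner_diff_left)
      also have "\<dots> = (\<Prod>i\<in>D. (u - l) \<bullet> i)" using D by (subst prod.inter_restrict[symmetric]) (auto simp: Int_absorb1)
      finally show ?thesis .
    qed
    also have "ennreal ((u - l) \<bullet> b0) * (ennreal ((u - l) \<bullet> b1) * ennreal (\<Prod>i\<in>D. (u - l) \<bullet> i)) = ennreal (\<Prod>i\<in>Basis. (u - l) \<bullet> i)"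
    proof -
      have nn: "0 \<le> (u - l) \<bullet> i" if "i \<in> Basis" for i using le[OF that] by (simp add: inner_diff_left)
      have "0 \<le> (\<Prod>i\<in>D. (u - l) \<bullet> i)" using nn D by (intro prod_nonneg) auto
      moreover have "(\<Prod>i\<in>Basis. (u - l) \<bullet> i) = ((u - l) \<bullet> b0) * (((u - l) \<bullet> b1) * (\<Prod>i\<in>D. (u - l) \<bullet> i))"
        unfolding Basis using finD bB b(2) by simp
      ultimately show ?thesis using nn[OF bB(1)] nn[OF bB(2)] by (simp only: ennreal_mult mult_nonneg_nonneg)
    qed
    finally show "emeasure (distr (density lborel (indicator A')) borel \<Psi>) (box l u) = ennreal (\<Prod>i\<in>Basis. (u - l) \<bullet> i)" .
  qed simp
  then have "(\<integral>\<^sup>+x. F x \<partial>lborel) = (\<integral>\<^sup>+x. F x \<partial>distr (density lborel (indicator A')) borel \<Psi>)" by simp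
  also have "\<dots> = (\<integral>\<^sup>+p. F (\<Psi> p) \<partial>density lborel (indicator A'))"
    using \<Psi> F by (intro nn_integral_distr) auto
  also have "\<dots> = (\<integral>\<^sup>+p. indicator A' p * F (\<Psi> p) \<partial>lborel)"
    using \<Psi> F A' by (intro nn_integral_density) (auto intro: measurable_compose)
  also have "\<dots> = (\<integral>\<^sup>+(s, t, y). F (s *\<^sub>R b0 + t *\<^sub>R b1 + coord_proj D y) * indicator A y \<partial>lborel)"
    by (intro nn_integral_cong) (auto simp: \<Psi>_def A'_def indicator_def split: prod.split)
  finally show ?thesis unfolding A_def .
qed

text \<open>For distinct x and y, the reflection in the hyperplane orthogonal to x - y; vectors with
  the same inner product with x and y lie in that hyperplane.\<close>

lemma ex_reflection:
  fixes x y :: "'a::euclidean_space"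
  assumes "norm x = norm y"
  shows "\<exists>f. orthogonal_transformation f \<and> f x = y \<and> (\<forall>z. z \<bullet> x = z \<bullet> y \<longrightarrow> f z = z)"
proof (cases "x = y")
  case True
  then show ?thesis by (intro exI[of _ "\<lambda>z. z"]) (simp add: orthogonal_transformation_def linear_ident)
next
  case False
  define w where "w = x - y"
  have w: "w \<bullet> w \<noteq> 0" using False by (simp add: w_def)
  define f where "f z = z - (2 * (z \<bullet> w) / (w \<bullet> w)) *\<^sub>R w" for z
  define k where "k z = 2 * (z \<bullet> w) / (w \<bullet> w)" for z
  have fk: "f z = z - k z *\<^sub>R w" for z by (simp only: f_def k_def)
  have kw: "k z * (w \<bullet> w) = 2 * (z \<bullet> w)" for z using w by (simp add: k_def)
  have "linear f"
  proof (rule linearI)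
    have "k (u + v) = k u + k v" for u v by (simp only: k_def inner_add_left distrib_left add_divide_distrib)
    then show "f (u + v) = f u + f v" for u v by (simp only: fk scaleR_left_distrib) simp
    have "k (r *\<^sub>R u) = r * k u" for r u by (simp add: k_def)
    then show "f (r *\<^sub>R u) = r *\<^sub>R f u" for r u by (simp only: fk scaleR_right_diff_distrib scaleR_scaleR)
  qed
  moreover have "f u \<bullet> f v = u \<bullet> v" for u v
  proof -
    have "f u \<bullet> f v = u \<bullet> v - k v * (u \<bullet> w) - k u * (v \<bullet> w) + k v * (k u * (w \<bullet> w))"
      unfolding fk by (simp only: inner_diff_left inner_diff_right inner_scaleR_left inner_scaleR_right inner_commute[of w v]) (simp add: algebra_simps)
    also have "\<dots> = u \<bullet> v + k v * (u \<bullet> w) - k u * (v \<bullet> w)" unfolding kw by simp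
    also have "k v * (u \<bullet> w) = k u * (v \<bullet> w)" by (simp add: k_def)
    finally show ?thesis by simp
  qed
  ultimately have "orthogonal_transformation f" by (auto simp: orthogonal_transformation_def)
  moreover have "f x = y"
  proof -
    have "x \<bullet> x = y \<bullet> y" using assms by (simp add: norm_eq)
    then have "2 * (x \<bullet> w) = w \<bullet> w" by (simp add: w_def inner_diff_left inner_diff_right inner_commute)
    then have "f x = x - w" using w by (simp add: f_def)
    then show ?thesis by (simp add: w_def)
  qed
  moreover have "f z = z" if "z \<bullet> x = z \<bullet> y" for z
    using that by (simp add: f_def w_def inner_diff_right)
  ultimately show ?thesis by blast
qed

text \<open>Two reflections: the first takes b0 to a, the second takes the image of b1 to e and
  fixes a, which is orthogonal to both.\<close>

lemma ex_orthogonal_two: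
  fixes a e b0 b1 :: "'a::euclidean_space"
  assumes "norm a = 1" "norm e = 1" "a \<bullet> e = 0" "norm b0 = 1" "norm b1 = 1" "b0 \<bullet> b1 = 0"
  shows "\<exists>f. orthogonal_transformation f \<and> f b0 = a \<and> f b1 = e"
proof -
  obtain f where f: "orthogonal_transformation f" "f b0 = a" using ex_reflection[of b0 a] assms by auto
  have fb1: "norm (f b1) = 1" "a \<bullet> f b1 = 0"
    using orthogonal_transformation_norm[OF f(1), of b1] f assms
    by (auto simp: orthogonal_transformation_def)
  obtain g where g: "orthogonal_transformation g" "g (f b1) = e" "\<forall>z. z \<bullet> f b1 = z \<bullet> e \<longrightarrow> g z = z"
    using ex_reflection[of "f b1" e] fb1 assms by auto
  have "g a = a" using g(3) fb1 assms by simp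
  then show ?thesis using f g orthogonal_transformation_compose[OF g(1) f(1)]
    by (intro exI[of _ "g \<circ> f"]) auto
qed

lemma std_simplex_eq: "std_simplex = {x :: real ^ 'm. (\<forall>j. 0 \<le> x $ j) \<and> (\<Sum>j\<in>UNIV. x $ j) = 1}"
proof
  show "std_simplex \<subseteq> {x :: real ^ 'm. (\<forall>j. 0 \<le> x $ j) \<and> (\<Sum>j\<in>UNIV. x $ j) = 1}"
    unfolding std_simplex_def
  proof (rule hull_minimal)
    show "range (\<lambda>i :: 'm. axis i (1::real)) \<subseteq> {x. (\<forall>j. 0 \<le> x $ j) \<and> (\<Sum>j\<in>UNIV. x $ j) = 1}"
      by (auto simp: axis_def)
    show "convex {x :: real ^ 'm. (\<forall>j. 0 \<le> x $ j) \<and> (\<Sum>j\<in>UNIV. x $ j) = 1}"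
      unfolding convex_def by (auto simp: sum.distrib simp flip: sum_distrib_left)
  qed
  show "{x :: real ^ 'm. (\<forall>j. 0 \<le> x $ j) \<and> (\<Sum>j\<in>UNIV. x $ j) = 1} \<subseteq> std_simplex"
  proof
    fix x :: "real ^ 'm" assume x: "x \<in> {x. (\<forall>j. 0 \<le> x $ j) \<and> (\<Sum>j\<in>UNIV. x $ j) = 1}"
    have "(\<Sum>j\<in>UNIV. (x $ j) *\<^sub>R axis j 1) \<in> std_simplex"
      unfolding std_simplex_def by (rule convex_sum) (use x in \<open>auto intro: hull_inc\<close>)
    also have "(\<Sum>j\<in>UNIV. (x $ j) *\<^sub>R axis j 1) = x"
      using basis_expansion[of x] by (simp only: scalar_mult_eq_scaleR)
    finally show "x \<in> std_simplex" .
  qed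
qed

text \<open>The section is cut out by the unit normals a and (1, ..., 1) / sqrt (n + 1). An
  orthogonal map sends two coordinate vectors to them, so the section becomes a subset of the span
  of D shifted by 1 / sqrt (n + 1) along b1, the distance from the origin to the hyperplane of the
  simplex.\<close>

lemma V_eq_lborel:
  fixes a :: "real ^ 'm"
  assumes card: "CARD('m) = n + 1" and n: "n \<ge> 1" and a: "norm a = 1" "(\<Sum>j\<in>UNIV. a $ j) = 0"
  shows "\<exists>D b0 b1 f. D \<subseteq> (Basis :: (real ^ 'm) set) \<and> card D = n - 1 \<and> Basis - D = {b0, b1} \<and> b0 \<noteq> b1 \<and> orthogonal_transformation f \<and>
     f b0 = a \<and> f b1 = (\<chi> j. 1 / sqrt (real n + 1)) \<and>
     ennreal (V a) = emeasure lborel (thicken D {y. \<forall>j. 0 \<le> f ((1 / sqrt (real n + 1)) *\<^sub>R b1 + coord_proj D y) $ j})"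
proof -
  define N where "N = real n + 1"
  have N: "N > 0" by (simp add: N_def)
  define e :: "real ^ 'm" where "e = (\<chi> j. 1 / sqrt N)"
  \<comment> \<open>The very choice made in \<open>unit_cube\<close>, so that the denominator of
    \<open>Vol\<close> is the cube over this \<open>D\<close>.\<close>
  define D :: "(real ^ 'm) set" where "D = (SOME D. D \<subseteq> Basis \<and> card D = n - 1)"
  have dim: "card (Basis :: (real ^ 'm) set) = n + 1" using card by simp
  have "n - 1 \<le> card (Basis :: (real ^ 'm) set)" unfolding dim by simp
  then obtain D' where "D' \<subseteq> (Basis :: (real ^ 'm) set)" "card D' = n - 1"
    by (rule obtain_subset_with_card_n)
  then have "\<exists>D. D \<subseteq> (Basis :: (real ^ 'm) set) \<and> card D = n - 1" by blast
  from someI_ex[OF this] have D: "D \<subseteq> Basis" "card D = n - 1" unfolding D_def by blast+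
  have finD: "finite D" using D finite_Basis finite_subset by blast
  have "card (Basis - D) = 2" using D dim n finD by (simp add: card_Diff_subset)
  then obtain b0 b1 where b: "Basis - D = {b0, b1}" "b0 \<noteq> b1" by (auto simp: card_2_iff)
  have bB: "b0 \<in> Basis" "b1 \<in> Basis" "b0 \<notin> D" "b1 \<notin> D" using b by auto
  have esq: "(1 / sqrt N) * (1 / sqrt N) = 1 / N" using N by simp
  have ex: "e \<bullet> x = (1 / sqrt N) * (\<Sum>j\<in>UNIV. x $ j)" for x
    by (simp add: e_def inner_vec_def sum_distrib_left)
  have "e \<bullet> e = 1" 
  proof -
    have "(\<Sum>j\<in>UNIV. e $ j) = N * (1 / sqrt N)" by (simp add: e_def card N_def)
    then have "e \<bullet> e = (1 / sqrt N) * (N * (1 / sqrt N))" unfolding ex[of e] by (rule arg_cong)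
    also have "\<dots> = N * ((1 / sqrt N) * (1 / sqrt N))" by (rule mult.left_commute)
    finally have "e \<bullet> e = N * ((1 / sqrt N) * (1 / sqrt N))" .
    then have "e \<bullet> e = N * (1 / N)" unfolding esq .
    then show ?thesis using N by simp
  qed
  then have e: "norm e = 1" by (simp add: norm_eq_1)
  have ae: "a \<bullet> e = 0" using a by (simp add: inner_commute[of a] ex)
  obtain f where f: "orthogonal_transformation f" "f b0 = a" "f b1 = e"
  proof -
    have "norm b0 = 1" "norm b1 = 1" "b0 \<bullet> b1 = 0" using bB b(2) by (auto simp: inner_Basis)
    then show ?thesis using ex_orthogonal_two[OF a(1) e ae] that by blast
  qed
  have lin: "linear f" using f by (simp add: orthogonal_transformation_linear)
  have inn: "f x \<bullet> f y = x \<bullet> y" for x y using f(1) by (simp add: orthogonal_transformation_def)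
  define c where "c = 1 / sqrt N"
  define S where "S = {y. (\<forall>i\<in>Basis - D. y \<bullet> i = 0) \<and> (\<forall>j. 0 \<le> f (c *\<^sub>R b1 + y) $ j)}"
  have contf: "continuous_on UNIV (\<lambda>y. f (c *\<^sub>R b1 + y) $ j)" for j
    by (intro continuous_on_component linear_continuous_on_compose[OF _ lin] continuous_on_add continuous_on_const continuous_on_id)
  have "S = (\<Inter>i\<in>Basis - D. {y. y \<bullet> i = 0}) \<inter> (\<Inter>j. {y. 0 \<le> f (c *\<^sub>R b1 + y) $ j})"
    by (auto simp: S_def)
  moreover have "closed {y. 0 \<le> f (c *\<^sub>R b1 + y) $ j}" for j
    by (rule closed_Collect_le[OF continuous_on_const contf])
  moreover have "closed {y :: real ^ 'm. y \<bullet> i = 0}" for i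
    by (intro closed_Collect_eq continuous_intros)
  ultimately have "closed S" by (simp only:) (intro closed_Int closed_INT, auto)
  then have S: "S \<in> sets borel" by (rule borel_closed)
  have sum1: "(\<Sum>j\<in>UNIV. f (c *\<^sub>R b1 + y) $ j) = 1" and perp: "a \<bullet> f (c *\<^sub>R b1 + y) = 0" if "y \<bullet> b0 = 0" "y \<bullet> b1 = 0" for y
  proof -
    have "e \<bullet> f (c *\<^sub>R b1 + y) = b1 \<bullet> (c *\<^sub>R b1 + y)" unfolding f(3)[symmetric] by (rule inn)
    also have "\<dots> = c" using that bB by (simp add: inner_add_right inner_Basis inner_commute)
    finally have "(1 / sqrt N) * (\<Sum>j\<in>UNIV. f (c *\<^sub>R b1 + y) $ j) = 1 / sqrt N" unfolding ex c_def .
    then show "(\<Sum>j\<in>UNIV. f (c *\<^sub>R b1 + y) $ j) = 1" using N by simp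
    have "a \<bullet> f (c *\<^sub>R b1 + y) = b0 \<bullet> (c *\<^sub>R b1 + y)" unfolding f(2)[symmetric] by (rule inn)
    also have "\<dots> = 0" using that bB b(2) by (simp add: inner_add_right inner_Basis inner_commute)
    finally show "a \<bullet> f (c *\<^sub>R b1 + y) = 0" .
  qed
  have im: "(\<lambda>y. f (c *\<^sub>R b1 + y)) ` S = std_simplex \<inter> {x. a \<bullet> x = 0}"
  proof
    show "(\<lambda>y. f (c *\<^sub>R b1 + y)) ` S \<subseteq> std_simplex \<inter> {x. a \<bullet> x = 0}"
      unfolding std_simplex_eq S_def b(1) using sum1 perp by auto
    show "std_simplex \<inter> {x. a \<bullet> x = 0} \<subseteq> (\<lambda>y. f (c *\<^sub>R b1 + y)) ` S"
    proof
      fix x assume "x \<in> std_simplex \<inter> {x. a \<bullet> x = 0}"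
      then have x: "\<forall>j. 0 \<le> x $ j" "(\<Sum>j\<in>UNIV. x $ j) = 1" "a \<bullet> x = 0" by (auto simp: std_simplex_eq)
      obtain z where z: "x = f z" using orthogonal_transformation_surj[OF f(1)] by (rule surjE)
      have z0: "z \<bullet> b0 = 0" using x(3) inn[of b0 z] unfolding z f(2) by (simp add: inner_commute)
      have "e \<bullet> x = c" using x(2) by (simp add: ex c_def)
      then have z1: "z \<bullet> b1 = c" using inn[of b1 z] unfolding z f(3) by (simp add: inner_commute)
      define y where "y = z - c *\<^sub>R b1"
      have "y \<bullet> b0 = 0" "y \<bullet> b1 = 0" using z0 z1 bB b(2) by (auto simp: y_def inner_diff_left inner_Basis)
      moreover have "c *\<^sub>R b1 + y = z" by (simp add: y_def)
      ultimately have "y \<in> S" using x(1) unfolding S_def z b(1) by simp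
      then show "x \<in> (\<lambda>y. f (c *\<^sub>R b1 + y)) ` S"
        by (intro image_eqI[of _ _ y]) (simp_all add: z y_def)
    qed
  qed
  have bd: "S \<subseteq> coord_box D (\<lambda>_. - 1) (\<lambda>_. 1)"
  proof
    fix y assume y: "y \<in> S"
    then have y01: "y \<bullet> b0 = 0" "y \<bullet> b1 = 0" "\<forall>j. 0 \<le> f (c *\<^sub>R b1 + y) $ j" unfolding S_def b(1) by simp_all
    have "norm (f (c *\<^sub>R b1 + y)) \<le> (\<Sum>j\<in>UNIV. \<bar>f (c *\<^sub>R b1 + y) $ j\<bar>)" by (rule norm_le_l1_cart)
    also have "\<dots> = 1" using sum1[OF y01(1,2)] y01(3) by simp
    finally have 1: "norm (c *\<^sub>R b1 + y) \<le> 1" using orthogonal_transformation_norm[OF f(1)] by simp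
    have "\<bar>y \<bullet> i\<bar> \<le> 1" if i: "i \<in> D" for i
    proof -
      have iB: "i \<in> Basis" "i \<noteq> b1" using i D bB by auto
      have "y \<bullet> i = (c *\<^sub>R b1 + y) \<bullet> i" using iB bB by (simp add: inner_add_left inner_Basis)
      then show ?thesis using Basis_le_norm[OF iB(1), of "c *\<^sub>R b1 + y"] 1 by linarith
    qed
    then show "y \<in> coord_box D (\<lambda>_. - 1) (\<lambda>_. 1)" using y by (auto simp: coord_box_def S_def abs_le_iff minus_le_iff)
  qed
  let ?Q = "coord_box D (\<lambda>_. 0) (\<lambda>_. 1)"
  have "hausdorff_measure (n - 1) (std_simplex \<inter> {x. a \<bullet> x = 0}) = hausdorff_measure (n - 1) S"
    unfolding im[symmetric]
  proof (rule hausdorff_measure_isometry_image)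
    fix x y
    have "f (c *\<^sub>R b1 + x) - f (c *\<^sub>R b1 + y) = f (x - y)"
      by (simp add: linear_diff[OF lin, symmetric])
    then show "dist (f (c *\<^sub>R b1 + x)) (f (c *\<^sub>R b1 + y)) = dist x y"
      using orthogonal_transformation_norm[OF f(1), of "x - y"] by (simp add: dist_norm)
  qed
  also have "\<dots> = hausdorff_measure (n - 1) ?Q * emeasure lborel (thicken D S)"
    using hausdorff_eq_lborel_thicken(1)[OF D(1) zero_less_one S bd] by (simp add: D(2))
  finally have H: "hausdorff_measure (n - 1) (std_simplex \<inter> {x. a \<bullet> x = 0}) = hausdorff_measure (n - 1) ?Q * emeasure lborel (thicken D S)" .
  have "CARD('m) - 2 = n - 1" using card n by simp
  then have "V a = enn2real (hausdorff_measure (n - 1) ?Q * emeasure lborel (thicken D S) / hausdorff_measure (n - 1) ?Q)"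
    unfolding V_def Vol_def unit_cube_def by (simp only: H D_def[symmetric] unit_cube_coord_box[OF D(1)])
  also have "hausdorff_measure (n - 1) ?Q * emeasure lborel (thicken D S) / hausdorff_measure (n - 1) ?Q = emeasure lborel (thicken D S)"
    using hausdorff_unit_cube_pos[OF D(1)] hausdorff_unit_cube_finite[OF D(1)]
    unfolding D(2) by (subst mult.commute, intro ennreal_mult_divide_eq) auto
  finally have "ennreal (V a) = emeasure lborel (thicken D S)"
    using hausdorff_eq_lborel_thicken(2)[OF D(1) zero_less_one S bd] by simp
  also have "thicken D S = thicken D {y. \<forall>j. 0 \<le> f (c *\<^sub>R b1 + coord_proj D y) $ j}"
  proof -
    have "coord_proj D (coord_proj D x) = coord_proj D x" for x :: "real ^ 'm" by (rule euclidean_eqI) simp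
    moreover have "\<forall>i\<in>Basis - D. coord_proj D x \<bullet> i = 0" for x :: "real ^ 'm" by simp
    ultimately show ?thesis unfolding thicken_def S_def by simp
  qed
  finally have V: "ennreal (V a) = emeasure lborel (thicken D {y. \<forall>j. 0 \<le> f (c *\<^sub>R b1 + coord_proj D y) $ j})" .
  show ?thesis
    by (rule exI[of _ D], rule exI[of _ b0], rule exI[of _ b1], rule exI[of _ f])
      (intro conjI D b f[unfolded e_def N_def] V[unfolded c_def N_def])
qed

section \<open>Thin slabs next to the hyperplane\<close>

lemma nn_integral_lborel_scale_fst:
  fixes \<phi> :: "real \<times> 'a::euclidean_space \<Rightarrow> ennreal"
  assumes \<phi>: "\<phi> \<in> borel_measurable borel" and c: "c > 0"
  shows "(\<integral>\<^sup>+p. \<phi> p \<partial>lborel) = ennreal c * (\<integral>\<^sup>+p. \<phi> (c * fst p, snd p) \<partial>lborel)"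
proof -
  have m: "\<phi> \<in> borel_measurable (lborel \<Otimes>\<^sub>M lborel)" using \<phi> by (simp add: lborel_prod)
  have [measurable]: "\<phi> \<in> borel_measurable (borel \<Otimes>\<^sub>M borel)" using \<phi> by (simp add: borel_prod)
  have m2: "(\<lambda>p. \<phi> (c * fst p, snd p)) \<in> borel_measurable (lborel \<Otimes>\<^sub>M lborel)" by measurable
  have "(\<integral>\<^sup>+p. \<phi> p \<partial>lborel) = (\<integral>\<^sup>+q. \<integral>\<^sup>+s. \<phi> (s, q) \<partial>lborel \<partial>lborel)"
    using lborel_pair.nn_integral_snd[OF m] by (simp add: lborel_prod)
  also have "\<dots> = (\<integral>\<^sup>+q. ennreal c * (\<integral>\<^sup>+s. \<phi> (c * s, q) \<partial>lborel) \<partial>lborel)"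
  proof (rule nn_integral_cong)
    fix q
    have "(\<lambda>s. \<phi> (s, q)) \<in> borel_measurable borel" by measurable
    then show "(\<integral>\<^sup>+s. \<phi> (s, q) \<partial>lborel) = ennreal c * (\<integral>\<^sup>+s. \<phi> (c * s, q) \<partial>lborel)"
      using c by (subst nn_integral_real_affine[of _ c 0]) auto
  qed
  also have "\<dots> = ennreal c * (\<integral>\<^sup>+q. \<integral>\<^sup>+s. \<phi> (c * s, q) \<partial>lborel \<partial>lborel)"
    by (rule nn_integral_cmult) measurable
  also have "(\<integral>\<^sup>+q. \<integral>\<^sup>+s. \<phi> (c * s, q) \<partial>lborel \<partial>lborel) = (\<integral>\<^sup>+p. \<phi> (c * fst p, snd p) \<partial>lborel)"
    using lborel_pair.nn_integral_snd[OF m2] by (simp add: lborel_prod)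
  finally show ?thesis .
qed

lemma nn_integral_lborel_iterated3:
  fixes \<phi> :: "real \<times> real \<times> 'a::euclidean_space \<Rightarrow> ennreal"
  assumes \<phi>: "\<phi> \<in> borel_measurable borel"
  shows "(\<integral>\<^sup>+p. \<phi> p \<partial>lborel) = (\<integral>\<^sup>+s. \<integral>\<^sup>+t. \<integral>\<^sup>+y. \<phi> (s, t, y) \<partial>lborel \<partial>lborel \<partial>lborel)"
proof -
  have [measurable]: "\<phi> \<in> borel_measurable (borel \<Otimes>\<^sub>M borel \<Otimes>\<^sub>M borel)" using \<phi> by (simp add: borel_prod)
  have m: "\<phi> \<in> borel_measurable (lborel \<Otimes>\<^sub>M (lborel :: (real \<times> 'a) measure))" using \<phi> by (simp add: lborel_prod)
  have "(\<integral>\<^sup>+p. \<phi> p \<partial>lborel) = (\<integral>\<^sup>+s. \<integral>\<^sup>+q. \<phi> (s, q) \<partial>lborel \<partial>lborel)"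
    using lborel.nn_integral_fst[OF m] by (simp add: lborel_prod)
  also have "\<dots> = (\<integral>\<^sup>+s. \<integral>\<^sup>+t. \<integral>\<^sup>+y. \<phi> (s, t, y) \<partial>lborel \<partial>lborel \<partial>lborel)"
  proof (rule nn_integral_cong)
    fix s
    have "(\<lambda>q. \<phi> (s, q)) \<in> borel_measurable (lborel \<Otimes>\<^sub>M (lborel :: 'a measure))" by measurable
    from lborel.nn_integral_fst[OF this] show "(\<integral>\<^sup>+q. \<phi> (s, q) \<partial>lborel) = (\<integral>\<^sup>+t. \<integral>\<^sup>+y. \<phi> (s, t, y) \<partial>lborel \<partial>lborel)"
      by (simp add: lborel_prod)
  qed
  finally show ?thesis .
qed

lemma nn_integral_power_exp_scaled:
  assumes r: "r > 0"
  shows "(\<integral>\<^sup>+t. ennreal (exp (- (r * t)) * (r * t) ^ d) * indicator {0..} t \<partial>lborel) = ennreal (fact d / r)"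
proof -
  have "ennreal (fact d) = (\<integral>\<^sup>+x. ennreal (x ^ d * exp (- x)) * indicator {0..} x \<partial>lborel)"
    by (subst nn_intergal_power_times_exp_Ici) (simp add: ennreal_of_nat_eq_real_of_nat)
  also have "\<dots> = ennreal r * (\<integral>\<^sup>+t. ennreal ((r * t) ^ d * exp (- (r * t))) * indicator {0..} (r * t) \<partial>lborel)"
    using r by (subst nn_integral_real_affine[of _ r 0]) auto
  also have "(\<integral>\<^sup>+t. ennreal ((r * t) ^ d * exp (- (r * t))) * indicator {0..} (r * t) \<partial>lborel)
     = (\<integral>\<^sup>+t. ennreal (exp (- (r * t)) * (r * t) ^ d) * indicator {0..} t \<partial>lborel)"
    using r by (intro nn_integral_cong) (auto simp: indicator_def zero_le_mult_iff mult.commute)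
  finally have "ennreal (fact d) = ennreal r * (\<integral>\<^sup>+t. ennreal (exp (- (r * t)) * (r * t) ^ d) * indicator {0..} t \<partial>lborel)" .
  then have "ennreal (1 / r) * ennreal (fact d) = ennreal (1 / r) * ennreal r * (\<integral>\<^sup>+t. ennreal (exp (- (r * t)) * (r * t) ^ d) * indicator {0..} t \<partial>lborel)"
    by (simp only: mult.assoc)
  moreover have "ennreal (1 / r) * ennreal r = 1" using r by (subst ennreal_mult[symmetric]) auto
  moreover have "ennreal (1 / r) * ennreal (fact d) = ennreal (fact d / r)" using r by (subst ennreal_mult[symmetric]) auto
  ultimately show ?thesis by simp
qed

text \<open>The kernel is a proper subspace, hence closed and negligible. This discards the points
  of the hyperplane at which the orthant indicator fails to be continuous.\<close>

lemma AE_linear_nonzero: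
  fixes L :: "'a::euclidean_space \<Rightarrow> real"
  assumes L: "linear L" and p: "L p \<noteq> 0"
  shows "AE x in lborel. L x \<noteq> 0"
proof (rule AE_I')
  have sub: "subspace {x. L x = 0}" using L by (rule linear_subspace_kernel)
  have "span {x. L x = 0} \<noteq> UNIV" using p sub by (metis (mono_tags) UNIV_I mem_Collect_eq span_eq_iff)
  then have "dim {x. L x = 0} < DIM('a)" using dim_eq_full dim_subset_UNIV by (metis order_le_less)
  then have "negligible {x. L x = 0}" by (rule negligible_lowdim)
  then have 1: "emeasure lebesgue {x. L x = 0} = 0" by (simp add: negligible_iff_null_sets null_setsD1)
  have "continuous_on UNIV L" using L by (simp add: linear_continuous_on linear_conv_bounded_linear)
  then have "closed {x. L x = 0}" by (intro closed_Collect_eq continuous_on_const)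
  then have "{x. L x = 0} \<in> sets borel" by (rule borel_closed)
  then show "{x. L x = 0} \<in> null_sets lborel" using 1 by (intro null_setsI) simp_all
qed auto

text \<open>The joint density of the independent exponential variables.\<close>

definition orthant_exp :: "real ^ 'm \<Rightarrow> real" where
  "orthant_exp x = (if \<forall>j. 0 \<le> x $ j then exp (- (\<Sum>j\<in>UNIV. x $ j)) else 0)"

lemma borel_measurable_orthant_exp [measurable]: "orthant_exp \<in> borel_measurable borel"
  unfolding orthant_exp_def by measurable

text \<open>In coordinates x = f (s b0 + t b1 + y) the slab is 0 < s <= eps and the density is exp
  (- r t) on the orthant. Replacing s by eps s makes the domain independent of eps. In the limit s
  drops out, and the orthant at height t cuts out the simplex section enlarged by r t. So V a is
  multiplied by the integral of exp (- r t) (r t)^(n - 1), which is (n - 1)! / r.\<close>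

lemma slab_limit:
  fixes a :: "real ^ 'm"
  assumes card: "CARD('m) = n + 1" and n: "n \<ge> 1" and a: "norm a = 1" "(\<Sum>j\<in>UNIV. a $ j) = 0"
  shows "(\<lambda>i. ennreal (Suc i) * (\<integral>\<^sup>+x. ennreal (orthant_exp x) * indicator {x. 0 < a \<bullet> x \<and> a \<bullet> x \<le> 1 / Suc i} x \<partial>lborel))
     \<longlonglongrightarrow> ennreal (fact (n - 1) / sqrt (real n + 1)) * ennreal (V a)"
proof -
  define r where "r = sqrt (real n + 1)"
  have r: "r > 0" by (simp add: r_def)
  obtain D b0 b1 f where D: "D \<subseteq> (Basis :: (real ^ 'm) set)" "card D = n - 1" and b: "Basis - D = {b0, b1}" "b0 \<noteq> b1"
    and f: "orthogonal_transformation f" "f b0 = a" "f b1 = (\<chi> j. 1 / r)"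
    and V: "ennreal (V a) = emeasure lborel (thicken D {y. \<forall>j. 0 \<le> f ((1 / r) *\<^sub>R b1 + coord_proj D y) $ j})"
    using V_eq_lborel[OF card n a] unfolding r_def by blast
  have lin: "linear f" using f by (simp add: orthogonal_transformation_linear)
  have inn: "f x \<bullet> f y = x \<bullet> y" for x y using f(1) by (simp add: orthogonal_transformation_def)
  have nrm: "norm (f x) = norm x" for x using orthogonal_transformation_norm[OF f(1)] by simp
  have bB: "b0 \<in> Basis" "b1 \<in> Basis" "b0 \<notin> D" "b1 \<notin> D" using b by auto
  have contf: "continuous_on UNIV f" using lin by (simp add: linear_continuous_on linear_conv_bounded_linear)
  have mf [measurable]: "f \<in> borel_measurable borel" by (rule borel_measurable_continuous_onI[OF contf])
  have mfj [measurable]: "(\<lambda>x. f x $ j) \<in> borel_measurable borel" for j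
    by (rule borel_measurable_continuous_onI[OF continuous_on_component[OF contf]])
  define Z where "Z s t y = s *\<^sub>R b0 + t *\<^sub>R b1 + coord_proj D y" for s t y
  have Z0: "Z s t y \<bullet> b0 = s" and Z1: "Z s t y \<bullet> b1 = t" and ZD: "i \<in> D \<Longrightarrow> Z s t y \<bullet> i = y \<bullet> i" for s t y i
    using bB b(2) D(1) by (auto simp: Z_def inner_add_left inner_Basis subset_iff)
  have aZ: "a \<bullet> f (Z s t y) = s" for s t y
    using inn[of b0 "Z s t y"] f(2) Z0[of s t y] by (simp add: inner_commute)
  have sumf: "(\<Sum>j\<in>UNIV. f (Z s t y) $ j) = r * t" for s t y
  proof -
    have "f b1 \<bullet> f (Z s t y) = t" using inn[of b1 "Z s t y"] Z1[of s t y] by (simp add: inner_commute)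
    then have "(1 / r) * (\<Sum>j\<in>UNIV. f (Z s t y) $ j) = t" unfolding f(3) by (simp add: inner_vec_def sum_distrib_left)
    then show ?thesis using r by (simp add: field_simps)
  qed
  have fZ: "f (Z s t y) $ j = s * a $ j + f (Z 0 t y) $ j" for s t y j
  proof -
    have "Z s t y = s *\<^sub>R b0 + Z 0 t y" by (simp add: Z_def)
    then have "f (Z s t y) = s *\<^sub>R a + f (Z 0 t y)" using lin f(2) by (simp add: linear_add linear_scale)
    then show ?thesis by simp
  qed
  define A where "A = {y :: real ^ 'm. \<forall>i\<in>Basis - D. 0 < y \<bullet> i \<and> y \<bullet> i < 1}"
  have A [measurable]: "A \<in> sets borel" unfolding A_def by measurable
  define K where "K s t y \<longleftrightarrow> (\<forall>j. 0 \<le> f (Z s t y) $ j)" for s t y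
  define h where "h s t y = ennreal (exp (- (r * t))) * (if K s t y then 1 else 0) * indicator A y" for s t y
  have mZ [measurable]: "(\<lambda>p. Z (fst p) (fst (snd p)) (snd (snd p))) \<in> borel_measurable (borel \<Otimes>\<^sub>M borel \<Otimes>\<^sub>M borel)"
    unfolding Z_def by measurable
  have mK [measurable]: "Measurable.pred (borel \<Otimes>\<^sub>M borel \<Otimes>\<^sub>M borel) (\<lambda>p. K (fst p) (fst (snd p)) (snd (snd p)))"
    unfolding K_def by measurable
  have mh [measurable]: "(\<lambda>p. h (fst p) (fst (snd p)) (snd (snd p))) \<in> borel_measurable (borel \<Otimes>\<^sub>M borel \<Otimes>\<^sub>M borel)"
    unfolding h_def by measurable
  have step: "(\<integral>\<^sup>+x. ennreal (orthant_exp x) * indicator {x. 0 < a \<bullet> x \<and> a \<bullet> x \<le> \<epsilon>} x \<partial>lborel)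
     = ennreal \<epsilon> * (\<integral>\<^sup>+p. h (\<epsilon> * fst p) (fst (snd p)) (snd (snd p)) * indicator {0<..1} (fst p) \<partial>lborel)" if \<epsilon>: "\<epsilon> > 0" for \<epsilon>
  proof -
    define F where "F x = ennreal (orthant_exp x) * indicator {x. 0 < a \<bullet> x \<and> a \<bullet> x \<le> \<epsilon>} x" for x
    have F [measurable]: "F \<in> borel_measurable borel" unfolding F_def by measurable
    have "(\<integral>\<^sup>+x. F x \<partial>lborel) = (\<integral>\<^sup>+x. F x \<partial>distr lborel borel f)" by (simp only: lborel_distr_orthogonal[OF f(1)])
    also have "\<dots> = (\<integral>\<^sup>+z. F (f z) \<partial>lborel)" by (rule nn_integral_distr) auto
    also have "\<dots> = (\<integral>\<^sup>+(s, t, y). F (f (s *\<^sub>R b0 + t *\<^sub>R b1 + coord_proj D y)) * indicator A y \<partial>lborel)"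
      unfolding A_def by (rule lborel_split_two[OF D(1) b]) measurable
    also have "\<dots> = (\<integral>\<^sup>+p. h (fst p) (fst (snd p)) (snd (snd p)) * indicator {0<..\<epsilon>} (fst p) \<partial>lborel)"
    proof (rule nn_integral_cong, clarify)
      fix s t :: real and y :: "real ^ 'm"
      have "F (f (Z s t y)) = ennreal (exp (- (r * t))) * (if K s t y then 1 else 0) * indicator {0<..\<epsilon>} s"
        unfolding F_def orthant_exp_def aZ sumf K_def by (auto simp: indicator_def aZ)
      then show "F (f (s *\<^sub>R b0 + t *\<^sub>R b1 + coord_proj D y)) * indicator A y
          = h (fst (s, t, y)) (fst (snd (s, t, y))) (snd (snd (s, t, y))) * indicator {0<..\<epsilon>} (fst (s, t, y))"
        unfolding h_def Z_def[symmetric] by (simp add: mult_ac)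
    qed
    also have "\<dots> = ennreal \<epsilon> * (\<integral>\<^sup>+p. h (\<epsilon> * fst p) (fst (snd p)) (snd (snd p)) * indicator {0<..\<epsilon>} (\<epsilon> * fst p) \<partial>lborel)"
    proof (subst nn_integral_lborel_scale_fst[OF _ \<epsilon>])
      show "(\<lambda>p. h (fst p) (fst (snd p)) (snd (snd p)) * indicator {0<..\<epsilon>} (fst p)) \<in> borel_measurable borel"
        unfolding borel_prod[symmetric] by measurable
    qed simp
    also have "(\<integral>\<^sup>+p. h (\<epsilon> * fst p) (fst (snd p)) (snd (snd p)) * indicator {0<..\<epsilon>} (\<epsilon> * fst p) \<partial>lborel)
        = (\<integral>\<^sup>+p. h (\<epsilon> * fst p) (fst (snd p)) (snd (snd p)) * indicator {0<..1} (fst p) \<partial>lborel)"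
      using \<epsilon> by (intro nn_integral_cong) (auto simp: indicator_def zero_less_mult_iff mult_le_cancel_left2)
    finally show ?thesis unfolding F_def .
  qed
  \<comment> \<open>The dominating function: on the orthant every coordinate of y in D is at most
    the norm of the point, which is at most its coordinate sum r t.\<close>
  define w where "w p = (case p of (s, t, y) \<Rightarrow> ennreal (exp (- (r * t))) * indicator {0<..1} s * indicator {0..} t *
     indicator {y. \<forall>i\<in>Basis. (if i \<in> D then \<bar>y \<bullet> i\<bar> \<le> r * t else 0 < y \<bullet> i \<and> y \<bullet> i < 1)} y)" for p :: "real \<times> real \<times> (real ^ 'm)"
  have Kb: "0 \<le> t \<and> (\<forall>i\<in>D. \<bar>y \<bullet> i\<bar> \<le> r * t)" if K: "K s t y" for s t y
  proof -
    have "norm (f (Z s t y)) \<le> (\<Sum>j\<in>UNIV. \<bar>f (Z s t y) $ j\<bar>)" by (rule norm_le_l1_cart)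
    also have "\<dots> = r * t" using K sumf[of s t y] by (simp add: K_def)
    finally have le: "norm (Z s t y) \<le> r * t" by (simp add: nrm)
    then have "0 \<le> r * t" by (rule order_trans[OF norm_ge_zero])
    then have "0 \<le> t" using r by (simp add: zero_le_mult_iff)
    moreover have "\<bar>y \<bullet> i\<bar> \<le> r * t" if "i \<in> D" for i
      using Basis_le_norm[of i "Z s t y"] ZD[OF that, of s t y] le that D(1) by auto
    ultimately show ?thesis by blast
  qed
  define g where "g i p = h (1 / Suc i * fst p) (fst (snd p)) (snd (snd p)) * indicator {0<..1} (fst p)" for i :: nat and p :: "real \<times> real \<times> (real ^ 'm)"
  define g' where "g' p = h 0 (fst (snd p)) (snd (snd p)) * indicator {0<..1} (fst p)" for p :: "real \<times> real \<times> (real ^ 'm)"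
  have mg: "g i \<in> borel_measurable borel" for i
  proof -
    have "(\<lambda>p. h (fst (1 / Suc i * fst p, snd p)) (fst (snd (1 / Suc i * fst p, snd p))) (snd (snd (1 / Suc i * fst p, snd p))) * indicator {0<..1} (fst p)) \<in> borel_measurable (borel \<Otimes>\<^sub>M borel \<Otimes>\<^sub>M borel)"
      by measurable
    then show ?thesis unfolding g_def by (simp add: borel_prod)
  qed
  have mg': "g' \<in> borel_measurable borel"
  proof -
    have "(\<lambda>p. h (fst (0::real, snd p)) (fst (snd (0::real, snd p))) (snd (snd (0::real, snd p))) * indicator {0<..1::real} (fst p)) \<in> borel_measurable (borel \<Otimes>\<^sub>M borel \<Otimes>\<^sub>M borel)"
      by measurable
    then show ?thesis unfolding g'_def by (simp add: borel_prod)
  qed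
  have mw: "w \<in> borel_measurable borel"
  proof -
    have "w \<in> borel_measurable (borel \<Otimes>\<^sub>M borel \<Otimes>\<^sub>M borel)" unfolding w_def by measurable
    then show ?thesis by (simp add: borel_prod)
  qed
  have box_le: "emeasure lborel {y :: real ^ 'm. \<forall>i\<in>Basis. (if i \<in> D then \<bar>y \<bullet> i\<bar> \<le> r * t else 0 < y \<bullet> i \<and> y \<bullet> i < 1)} \<le> ennreal (2 ^ (n - 1) * (r * t) ^ (n - 1))"
    if t: "t \<ge> 0" for t
  proof -
    define l where "l = (\<Sum>i\<in>Basis. (if i \<in> D then - (r * t) else 0) *\<^sub>R i)"
    define u where "u = (\<Sum>i\<in>Basis. (if i \<in> D then r * t else 1) *\<^sub>R i)"
    have "{y :: real ^ 'm. \<forall>i\<in>Basis. (if i \<in> D then \<bar>y \<bullet> i\<bar> \<le> r * t else 0 < y \<bullet> i \<and> y \<bullet> i < 1)} \<subseteq> cbox l u"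
      by (auto simp: cbox_def l_def u_def abs_le_iff minus_le_iff split: if_splits intro: less_imp_le)
    then have "emeasure lborel {y :: real ^ 'm. \<forall>i\<in>Basis. (if i \<in> D then \<bar>y \<bullet> i\<bar> \<le> r * t else 0 < y \<bullet> i \<and> y \<bullet> i < 1)} \<le> emeasure lborel (cbox l u)"
      by (intro emeasure_mono) auto
    also have "\<dots> = ennreal ((2 * (r * t)) ^ card D * 1 ^ card (Basis - D))"
      using r t D(1) by (intro emeasure_cbox_if) (auto simp: l_def u_def)
    finally show ?thesis by (simp add: D(2) power_mult_distrib)
  qed
  have wfin: "(\<integral>\<^sup>+p. w p \<partial>lborel) < \<infinity>"
  proof -
    have "(\<integral>\<^sup>+p. w p \<partial>lborel) = (\<integral>\<^sup>+s. \<integral>\<^sup>+t. \<integral>\<^sup>+y. w (s, t, y) \<partial>lborel \<partial>lborel \<partial>lborel)"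
      by (rule nn_integral_lborel_iterated3[OF mw])
    also have "\<dots> \<le> (\<integral>\<^sup>+s. (\<integral>\<^sup>+t. ennreal (2 ^ (n - 1)) * (ennreal (exp (- (r * t)) * (r * t) ^ (n - 1)) * indicator {0..} t) \<partial>lborel) * indicator {0<..1::real} s \<partial>lborel)"
    proof (rule nn_integral_mono)
      fix s :: real
      have "(\<integral>\<^sup>+y. w (s, t, y) \<partial>lborel) \<le> ennreal (2 ^ (n - 1)) * (ennreal (exp (- (r * t)) * (r * t) ^ (n - 1)) * indicator {0..} t) * indicator {0<..1} s" for t
      proof (cases "0 \<le> t \<and> s \<in> {0<..1}")
        case True
        let ?B = "{y :: real ^ 'm. \<forall>i\<in>Basis. (if i \<in> D then \<bar>y \<bullet> i\<bar> \<le> r * t else 0 < y \<bullet> i \<and> y \<bullet> i < 1)}"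
        have "?B \<in> sets borel" by measurable
        then have "(\<integral>\<^sup>+y. w (s, t, y) \<partial>lborel) = ennreal (exp (- (r * t))) * emeasure lborel ?B"
          using True by (simp add: w_def nn_integral_cmult_indicator)
        also have "\<dots> \<le> ennreal (exp (- (r * t))) * ennreal (2 ^ (n - 1) * (r * t) ^ (n - 1))"
          using True by (intro mult_left_mono box_le) auto
        also have "\<dots> = ennreal (2 ^ (n - 1)) * ennreal (exp (- (r * t)) * (r * t) ^ (n - 1))"
        proof -
          have nn: "0 \<le> (r * t) ^ (n - 1)" using r True by simp
          show ?thesis using nn by (simp only: ennreal_mult exp_ge_zero zero_le_power zero_le_numeral mult.left_commute)
        qed
        finally show ?thesis using True by simp
      next
        case False
        then have "w (s, t, y) = 0" for y by (auto simp: w_def)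
        then show ?thesis by simp
      qed
      then have "(\<integral>\<^sup>+t. \<integral>\<^sup>+y. w (s, t, y) \<partial>lborel \<partial>lborel) \<le> (\<integral>\<^sup>+t. ennreal (2 ^ (n - 1)) * (ennreal (exp (- (r * t)) * (r * t) ^ (n - 1)) * indicator {0..} t) * indicator {0<..1} s \<partial>lborel)"
        by (intro nn_integral_mono)
      also have "\<dots> = (\<integral>\<^sup>+t. ennreal (2 ^ (n - 1)) * (ennreal (exp (- (r * t)) * (r * t) ^ (n - 1)) * indicator {0..} t) \<partial>lborel) * indicator {0<..1} s"
        by (rule nn_integral_multc) measurable
      finally show "(\<integral>\<^sup>+t. \<integral>\<^sup>+y. w (s, t, y) \<partial>lborel \<partial>lborel) \<le> (\<integral>\<^sup>+t. ennreal (2 ^ (n - 1)) * (ennreal (exp (- (r * t)) * (r * t) ^ (n - 1)) * indicator {0..} t) \<partial>lborel) * indicator {0<..1} s" .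
    qed
    also have "\<dots> = ennreal (2 ^ (n - 1)) * ennreal (fact (n - 1) / r)"
      by (subst nn_integral_cmult) (simp_all add: nn_integral_power_exp_scaled[OF r] nn_integral_cmult)
    also have "\<dots> < \<infinity>" by (simp add: ennreal_mult_less_top)
    finally show ?thesis .
  qed
  have dom: "g i p \<le> w p" for i p
  proof -
    obtain s t y where p: "p = (s, t, y)" by (cases p)
    show ?thesis
    proof (cases "K (1 / Suc i * s) t y \<and> s \<in> {0<..1} \<and> y \<in> A")
      case True
      then have "0 \<le> t \<and> (\<forall>i\<in>D. \<bar>y \<bullet> i\<bar> \<le> r * t)" using Kb by blast
      then have "w p = ennreal (exp (- (r * t)))" using True by (auto simp: w_def p A_def)
      then show ?thesis using True by (simp add: g_def h_def p)
    next
      case False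
      then have "g i p = 0" by (auto simp: g_def h_def p)
      then show ?thesis by simp
    qed
  qed
  \<comment> \<open>The orthant indicator is continuous in s at s = 0 unless some coordinate of the
    point vanishes there.\<close>
  have AE: "AE p in (lborel :: (real \<times> real \<times> (real ^ 'm)) measure). \<forall>j. f (Z 0 (fst (snd p)) (snd (snd p))) $ j \<noteq> 0"
  proof -
    have "AE p in (lborel :: (real \<times> real \<times> (real ^ 'm)) measure). f (Z 0 (fst (snd p)) (snd (snd p))) $ j \<noteq> 0" for j
    \<comment> \<open>At this witness the point is \<open>f b1\<close>, all of whose coordinates are
      1 / r.\<close>
    proof (rule AE_linear_nonzero[of _ "(0, 1, 0)"])
      have Za: "Z 0 (t + t') (y + y') = Z 0 t y + Z 0 t' y'" for t t' y y'
        by (rule euclidean_eqI) (simp add: Z_def inner_add_left algebra_simps)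
      have Zs: "Z 0 (c * t) (c *\<^sub>R y) = c *\<^sub>R Z 0 t y" for t c y
        by (rule euclidean_eqI) (simp add: Z_def inner_add_left algebra_simps)
      show "linear (\<lambda>p. f (Z 0 (fst (snd p)) (snd (snd p))) $ j)"
        by (rule linearI) (simp_all add: Za Zs linear_add[OF lin] linear_scale[OF lin])
      have "coord_proj D 0 = 0" by (rule euclidean_eqI) simp
      then show "f (Z 0 (fst (snd (0, 1, 0))) (snd (snd (0, 1, 0)))) $ j \<noteq> 0" using r f(3) by (simp add: Z_def)
    qed
    from AE_finite_allI[OF finite_class.finite_UNIV this] show ?thesis by simp
  qed
  have conv: "AE p in lborel. (\<lambda>i. g i p) \<longlonglongrightarrow> g' p"
    using AE
  proof eventually_elim
    fix p :: "real \<times> real \<times> (real ^ 'm)"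
    assume nz: "\<forall>j. f (Z 0 (fst (snd p)) (snd (snd p))) $ j \<noteq> 0"
    obtain s t y where p: "p = (s, t, y)" by (cases p)
    define L where "L j = f (Z 0 t y) $ j" for j
    have nz: "L j \<noteq> 0" for j using nz by (simp add: p L_def)
    have lim: "(\<lambda>i. f (Z (1 / Suc i * s) t y) $ j) \<longlonglongrightarrow> L j" for j
    proof -
      have "(\<lambda>i. 1 / real (Suc i) * s * a $ j + L j) \<longlonglongrightarrow> 0 * s * a $ j + L j"
        by (intro tendsto_intros LIMSEQ_inverse_real_of_nat[unfolded inverse_eq_divide])
      then show ?thesis by (subst fZ) (simp add: L_def)
    qed
    have "eventually (\<lambda>i. K (1 / Suc i * s) t y = K 0 t y) sequentially"
    proof (cases "\<forall>j. 0 < L j")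
      case True
      have "eventually (\<lambda>i. \<forall>j. 0 < f (Z (1 / Suc i * s) t y) $ j) sequentially"
        using eventually_ball_finite[OF finite_class.finite_UNIV, of "\<lambda>i j. 0 < f (Z (1 / Suc i * s) t y) $ j" sequentially]
          True order_tendstoD(1)[OF lim] by simp
      then show ?thesis
        by eventually_elim (use True in \<open>auto simp: K_def L_def less_imp_le\<close>)
    next
      case False
      then obtain j where "L j < 0" using nz by (metis linorder_neqE_linordered_idom)
      then have "eventually (\<lambda>i. f (Z (1 / Suc i * s) t y) $ j < 0) sequentially" by (intro order_tendstoD(2)[OF lim])
      moreover have "\<not> K 0 t y" using \<open>L j < 0\<close> by (auto simp: K_def L_def not_le)
      ultimately show ?thesis
      proof (elim eventually_mono)
        fix i assume "f (Z (1 / Suc i * s) t y) $ j < 0"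
        then have "\<not> K (1 / Suc i * s) t y" unfolding K_def by (meson not_le)
        then show "K (1 / Suc i * s) t y = K 0 t y" using \<open>\<not> K 0 t y\<close> by blast
      qed
    qed
    then have "eventually (\<lambda>i. g i p = g' p) sequentially"
      by eventually_elim (simp add: g_def g'_def h_def p)
    then show "(\<lambda>i. g i p) \<longlonglongrightarrow> g' p" by (rule tendsto_eventually)
  qed
  have "(\<lambda>i. \<integral>\<^sup>+p. g i p \<partial>lborel) \<longlonglongrightarrow> (\<integral>\<^sup>+p. g' p \<partial>lborel)"
    by (rule nn_integral_dominated_convergence[where w = w]) (use mg mg' mw wfin dom conv in auto)
  moreover have "(\<integral>\<^sup>+p. g' p \<partial>lborel) = ennreal (fact (n - 1) / r) * ennreal (V a)"
  proof -
    \<comment> \<open>The orthant is a cone: division by r t carries its part at height t to the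
      part with coordinate sum 1.\<close>
    have y_int: "(\<integral>\<^sup>+y. h 0 t y \<partial>lborel) = ennreal (exp (- (r * t)) * (r * t) ^ (n - 1)) * ennreal (V a)" if t: "t > 0" for t
    proof -
      define S where "S = {y. \<forall>j. 0 \<le> f ((1 / r) *\<^sub>R b1 + coord_proj D y) $ j}"
      have S: "S \<in> sets borel" unfolding S_def by measurable
      have rt: "r * t > 0" using r t by simp
      have KS: "K 0 t y \<longleftrightarrow> (1 / (r * t)) *\<^sub>R coord_proj D y \<in> S" for y
      proof -
        have cp: "coord_proj D ((1 / (r * t)) *\<^sub>R coord_proj D y) = (1 / (r * t)) *\<^sub>R coord_proj D y"
          by (rule euclidean_eqI) simp
        have "(1 / r) *\<^sub>R b1 + (1 / (r * t)) *\<^sub>R coord_proj D y = (1 / (r * t)) *\<^sub>R Z 0 t y"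
          using r t by (simp add: Z_def scaleR_add_right)
        then have "f ((1 / r) *\<^sub>R b1 + coord_proj D ((1 / (r * t)) *\<^sub>R coord_proj D y)) $ j = (1 / (r * t)) * f (Z 0 t y) $ j" for j
          unfolding cp by (simp add: linear_scale[OF lin])
        moreover have "0 \<le> (1 / (r * t)) * x \<longleftrightarrow> 0 \<le> x" for x :: real
        proof -
          have "1 / (r * t) > 0" using rt by simp
          then show ?thesis by (simp only: zero_le_mult_iff) linarith
        qed
        ultimately show ?thesis unfolding S_def K_def mem_Collect_eq by (simp only:)
      qed
      have "{y \<in> A. K 0 t y} = thicken D {x. (1 / (r * t)) *\<^sub>R x \<in> S}"
        by (auto simp: thicken_def A_def KS)
      moreover have "h 0 t y = ennreal (exp (- (r * t))) * indicator {y \<in> A. K 0 t y} y" for y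
        by (auto simp: h_def indicator_def)
      moreover have "thicken D {x. (1 / (r * t)) *\<^sub>R x \<in> S} \<in> sets borel"
      proof (rule borel_thicken)
        have "(\<lambda>x. (1 / (r * t)) *\<^sub>R x) -` S \<inter> space borel \<in> sets borel" by (rule measurable_sets[OF _ S]) measurable
        then show "{x. (1 / (r * t)) *\<^sub>R x \<in> S} \<in> sets borel" by (simp add: vimage_def)
      qed
      ultimately have "(\<integral>\<^sup>+y. h 0 t y \<partial>lborel) = ennreal (exp (- (r * t))) * emeasure lborel (thicken D {x. (1 / (r * t)) *\<^sub>R x \<in> S})"
        by (simp add: nn_integral_cmult_indicator)
      also have "\<dots> = ennreal (exp (- (r * t))) * (ennreal ((r * t) ^ (n - 1)) * ennreal (V a))"
        using emeasure_thicken_scale[OF D(1) rt S] V by (simp add: D(2) S_def)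
      finally show ?thesis using rt by (simp add: ennreal_mult mult.assoc)
    qed
    have "(\<integral>\<^sup>+p. g' p \<partial>lborel) = (\<integral>\<^sup>+s. \<integral>\<^sup>+t. \<integral>\<^sup>+y. g' (s, t, y) \<partial>lborel \<partial>lborel \<partial>lborel)"
      by (rule nn_integral_lborel_iterated3[OF mg'])
    also have "\<dots> = (\<integral>\<^sup>+s. (\<integral>\<^sup>+t. ennreal (exp (- (r * t)) * (r * t) ^ (n - 1)) * indicator {0..} t * ennreal (V a) \<partial>lborel) * indicator {0<..1::real} s \<partial>lborel)"
    proof (rule nn_integral_cong)
      fix s :: real
      have "(\<integral>\<^sup>+t. \<integral>\<^sup>+y. g' (s, t, y) \<partial>lborel \<partial>lborel) = (\<integral>\<^sup>+t. ennreal (exp (- (r * t)) * (r * t) ^ (n - 1)) * indicator {0..} t * ennreal (V a) * indicator {0<..1} s \<partial>lborel)"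
      proof (rule nn_integral_cong_AE)
        have "AE t in lborel. t \<noteq> (0::real)" by (rule AE_lborel_singleton)
        then show "AE t in lborel. (\<integral>\<^sup>+y. g' (s, t, y) \<partial>lborel) = ennreal (exp (- (r * t)) * (r * t) ^ (n - 1)) * indicator {0..} t * ennreal (V a) * indicator {0<..1} s"
        proof eventually_elim
          fix t :: real assume t: "t \<noteq> 0"
          show "(\<integral>\<^sup>+y. g' (s, t, y) \<partial>lborel) = ennreal (exp (- (r * t)) * (r * t) ^ (n - 1)) * indicator {0..} t * ennreal (V a) * indicator {0<..1} s"
          proof (cases "s \<in> {0<..1}")
            case s: True
            have "(\<integral>\<^sup>+y. g' (s, t, y) \<partial>lborel) = (\<integral>\<^sup>+y. h 0 t y \<partial>lborel)" using s by (simp add: g'_def)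
            also have "\<dots> = ennreal (exp (- (r * t)) * (r * t) ^ (n - 1)) * indicator {0..} t * ennreal (V a)"
            proof (cases "t > 0")
              case True
              then show ?thesis using y_int[OF True] by simp
            next
              case False
              then have "\<not> K 0 t y" for y using Kb[of 0 t y] t by auto
              then show ?thesis using False t by (simp add: h_def)
            qed
            finally show ?thesis using s by simp
          qed (simp add: g'_def)
        qed
      qed
      also have "\<dots> = (\<integral>\<^sup>+t. ennreal (exp (- (r * t)) * (r * t) ^ (n - 1)) * indicator {0..} t * ennreal (V a) \<partial>lborel) * indicator {0<..1} s"
        by (rule nn_integral_multc) measurable
      finally show "(\<integral>\<^sup>+t. \<integral>\<^sup>+y. g' (s, t, y) \<partial>lborel \<partial>lborel) = (\<integral>\<^sup>+t. ennreal (exp (- (r * t)) * (r * t) ^ (n - 1)) * indicator {0..} t * ennreal (V a) \<partial>lborel) * indicator {0<..1} s" .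
    qed
    also have "\<dots> = (\<integral>\<^sup>+t. ennreal (exp (- (r * t)) * (r * t) ^ (n - 1)) * indicator {0..} t * ennreal (V a) \<partial>lborel)"
      by (simp add: nn_integral_cmult_indicator)
    also have "\<dots> = (\<integral>\<^sup>+t. ennreal (exp (- (r * t)) * (r * t) ^ (n - 1)) * indicator {0..} t \<partial>lborel) * ennreal (V a)"
      by (rule nn_integral_multc) measurable
    finally show ?thesis by (simp add: nn_integral_power_exp_scaled[OF r])
  qed
  moreover have "ennreal (Suc i) * (\<integral>\<^sup>+x. ennreal (orthant_exp x) * indicator {x. 0 < a \<bullet> x \<and> a \<bullet> x \<le> 1 / Suc i} x \<partial>lborel) = (\<integral>\<^sup>+p. g i p \<partial>lborel)" for i
  proof -
    have "ennreal (Suc i) * ennreal (1 / Suc i) = 1" by (subst ennreal_mult[symmetric]) auto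
    moreover have "0 < 1 / real (Suc i)" by simp
    note step[OF this]
    ultimately show ?thesis unfolding g_def by (simp only: mult.assoc[symmetric] mult_1)
  qed
  ultimately show ?thesis unfolding r_def by simp
qed

section \<open>The section volume as a Fourier integral\<close>

lemma complex_exp_integral_Ici:
  fixes c :: complex
  assumes c: "Re c > 0"
  shows "integrable lborel (\<lambda>u::real. indicator {0..} u *\<^sub>R exp (- (c * of_real u)))"
    and "(\<integral>u. indicator {0..} u *\<^sub>R exp (- (c * of_real u)) \<partial>lborel) = 1 / c"
proof -
  let ?f = "\<lambda>u::real. exp (- (c * of_real u))"
  have c0: "c \<noteq> 0" using c by auto
  have mf: "?f \<in> borel_measurable borel" by (intro borel_measurable_continuous_onI continuous_intros)
  show int: "integrable lborel (\<lambda>u::real. indicator {0..} u *\<^sub>R ?f u)"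
  proof (rule integrableI_bounded)
    show "(\<lambda>u::real. indicator {0..} u *\<^sub>R ?f u) \<in> borel_measurable lborel" using mf by simp
    have "(\<integral>\<^sup>+u. ennreal (norm (indicator {0..} u *\<^sub>R ?f u)) \<partial>lborel)
        = (\<integral>\<^sup>+t. ennreal (exp (- (Re c * t)) * (Re c * t) ^ 0) * indicator {0..} t \<partial>lborel)"
      by (intro nn_integral_cong) (auto simp: indicator_def)
    also have "\<dots> < \<infinity>" by (subst nn_integral_power_exp_scaled[OF c]) simp
    finally show "(\<integral>\<^sup>+u. ennreal (norm (indicator {0..} u *\<^sub>R ?f u)) \<partial>lborel) < \<infinity>" .
  qed
  have "(LBINT u=ereal 0..\<infinity>. ?f u) = 0 - (- (?f 0 / c))"
  proof (rule interval_integral_FTC_integrable[where F = "\<lambda>u. - (?f u / c)"])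
    show "((\<lambda>u. - (?f u / c)) has_vector_derivative ?f u) (at u)" for u
      using c0 by (auto intro!: derivative_eq_intros has_vector_derivative_real_field simp: field_simps)
    show "isCont ?f u" for u by (intro continuous_intros)
    show "set_integrable lborel (einterval (ereal 0) \<infinity>) ?f"
    proof -
      have "set_integrable lborel {0..} ?f" using int by (simp add: set_integrable_def)
      then show ?thesis by (rule set_integrable_subset) (auto simp: einterval_def)
    qed
    show "(((\<lambda>u. - (?f u / c)) \<circ> real_of_ereal) \<longlongrightarrow> - (?f 0 / c)) (at_right (ereal 0))"
      unfolding ereal_tendsto_simps by (intro tendsto_intros) (use c0 in auto)
    have "((\<lambda>u. norm (?f u)) \<longlongrightarrow> 0) at_top"
    proof -
      have "((\<lambda>u. exp (- (Re c * u))) \<longlongrightarrow> 0) at_top" using c by real_asymp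
      then show ?thesis by simp
    qed
    then have "(?f \<longlongrightarrow> 0) at_top" by (rule tendsto_norm_zero_cancel)
    then have "((\<lambda>u. - (?f u / c)) \<longlongrightarrow> - (0 / c)) at_top" by (intro tendsto_intros) (use c0 in auto)
    then show "(((\<lambda>u. - (?f u / c)) \<circ> real_of_ereal) \<longlongrightarrow> 0) (at_left \<infinity>)"
      unfolding ereal_tendsto_simps by simp
  qed simp
  also have "(LBINT u=ereal 0..\<infinity>. ?f u) = (LBINT u:{0<..}. ?f u)" by (rule interval_integral_to_infinity_eq)
  also have "\<dots> = (\<integral>u. indicator {0..} u *\<^sub>R ?f u \<partial>lborel)"
    unfolding set_lebesgue_integral_def
  proof (rule integral_cong_AE)
    have "AE u in lborel. u \<noteq> (0::real)" by (rule AE_lborel_singleton)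
    then show "AE u in lborel. indicator {0<..} u *\<^sub>R ?f u = indicator {0..} u *\<^sub>R ?f u"
      by eventually_elim (auto simp: indicator_def)
  qed (use mf in auto)
  finally show "(\<integral>u. indicator {0..} u *\<^sub>R ?f u \<partial>lborel) = 1 / c" by simp
qed

lemma prod_Basis_cart:
  fixes g :: "real ^ 'm \<Rightarrow> 'b::comm_monoid_mult"
  shows "(\<Prod>b\<in>Basis. g b) = (\<Prod>j\<in>UNIV. g (axis j 1))"
proof -
  have B: "(Basis :: (real ^ 'm) set) = (\<lambda>j. axis j 1) ` UNIV" by (auto simp: Basis_vec_def)
  have "inj (\<lambda>j :: 'm. axis j (1::real))" by (auto simp: inj_def axis_eq_axis)
  then have "prod g ((\<lambda>j :: 'm. axis j (1::real)) ` UNIV) = prod (g \<circ> (\<lambda>j. axis j 1)) UNIV" by (rule prod.reindex)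
  then show ?thesis unfolding B by (simp only: o_def)
qed

lemma lborel_integral_prod_cart:
  fixes F :: "'m::finite \<Rightarrow> real \<Rightarrow> complex"
  assumes F: "\<And>j. integrable lborel (F j)"
  shows "(\<integral>x. (\<Prod>j\<in>UNIV. F j (x $ j)) \<partial>(lborel :: (real ^ 'm) measure)) = (\<Prod>j\<in>UNIV. \<integral>u. F j u \<partial>lborel)"
proof -
  interpret product_sigma_finite "\<lambda>_ :: real ^ 'm. lborel :: real measure" ..
  \<comment> \<open>The product measure is indexed by basis vectors; \<open>THE\<close> recovers the
    index of the coordinate.\<close>
  define G where "G b = F (THE j. b = axis j 1)" for b :: "real ^ 'm"
  have G: "G (axis j 1) = F j" for j by (simp add: G_def axis_eq_axis)
  have Gi: "integrable lborel (G b)" for b by (simp add: G_def F)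
  have Fm: "F j \<in> borel_measurable borel" for j using borel_measurable_integrable[OF F[of j]] by simp
  have nth: "(\<lambda>x :: real ^ 'm. x $ j) \<in> borel_measurable borel" for j
    by (intro borel_measurable_continuous_onI continuous_on_component continuous_on_id)
  have m: "(\<lambda>x :: real ^ 'm. \<Prod>j\<in>UNIV. F j (x $ j)) \<in> borel_measurable borel"
    by (intro borel_measurable_prod measurable_compose[OF nth Fm])
  have "(\<integral>x. (\<Prod>j\<in>UNIV. F j (x $ j)) \<partial>(lborel :: (real ^ 'm) measure))
      = (\<integral>f. (\<Prod>j\<in>UNIV. F j ((\<Sum>b\<in>Basis. f b *\<^sub>R b) $ j)) \<partial>(\<Pi>\<^sub>M b\<in>(Basis :: (real ^ 'm) set). lborel))"
    by (subst lborel_eq, rule integral_distr) (use m in measurable)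
  also have "\<dots> = (\<integral>f. (\<Prod>b\<in>(Basis :: (real ^ 'm) set). G b (f b)) \<partial>(\<Pi>\<^sub>M b\<in>(Basis :: (real ^ 'm) set). lborel))"
  proof (rule Bochner_Integration.integral_cong[OF refl])
    fix f :: "real ^ 'm \<Rightarrow> real"
    have "(\<Sum>b\<in>Basis. f b *\<^sub>R b) $ j = f (axis j 1)" for j
    proof -
      have "(\<Sum>b\<in>Basis. f b *\<^sub>R b) $ j = (\<Sum>b\<in>Basis. f b *\<^sub>R b) \<bullet> axis j 1" by (simp add: inner_axis)
      also have "\<dots> = f (axis j 1)" by (rule inner_sum_left_Basis) (auto simp: Basis_vec_def)
      finally show ?thesis .
    qed
    then show "(\<Prod>j\<in>UNIV. F j ((\<Sum>b\<in>Basis. f b *\<^sub>R b) $ j)) = (\<Prod>b\<in>(Basis :: (real ^ 'm) set). G b (f b))"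
      by (simp add: prod_Basis_cart G)
  qed
  also have "\<dots> = (\<Prod>b\<in>(Basis :: (real ^ 'm) set). \<integral>u. G b u \<partial>lborel)"
    by (rule product_integral_prod) (auto simp: Gi)
  finally show ?thesis by (simp add: prod_Basis_cart G)
qed

section \<open>The law of the exponential variables\<close>

definition exp_measure :: "(real ^ 'm) measure" where
  "exp_measure = density lborel (\<lambda>x. ennreal (orthant_exp x))"

lemma orthant_exp_prod:
  "orthant_exp x = (\<Prod>j\<in>UNIV. indicator {0..} (x $ j) * exp (- (x $ j)))"
proof (cases "\<forall>j. 0 \<le> x $ j")
  case True
  then show ?thesis by (simp add: orthant_exp_def exp_sum[symmetric] sum_negf)
next
  case False
  then obtain j where "\<not> 0 \<le> x $ j" by blast
  then have "indicator {0..} (x $ j) * exp (- (x $ j)) = 0" by simp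
  then have "(\<Prod>j\<in>UNIV. indicator {0..} (x $ j) * exp (- (x $ j))) = 0" by (intro prod_zero) auto
  then show ?thesis using False unfolding orthant_exp_def by (simp only: if_False)
qed

lemma orthant_exp_nonneg: "orthant_exp x \<ge> 0" by (simp add: orthant_exp_def)

lemma exp_measure_integral_exp:
  fixes a :: "real ^ 'm"
  shows "(\<integral>x. iexp (t * (a \<bullet> x)) \<partial>exp_measure) = (\<Prod>j\<in>UNIV. 1 / (1 - \<i> * of_real (t * a $ j)))"
proof -
  define c where "c j = 1 - \<i> * of_real (t * a $ j)" for j
  have c: "Re (c j) > 0" for j by (simp add: c_def)
  have miexp: "(\<lambda>x. iexp (t * (a \<bullet> x))) \<in> borel_measurable borel"
    by (intro borel_measurable_continuous_onI continuous_intros)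
  have "(\<integral>x. iexp (t * (a \<bullet> x)) \<partial>exp_measure) = (\<integral>x. orthant_exp x *\<^sub>R iexp (t * (a \<bullet> x)) \<partial>lborel)"
    unfolding exp_measure_def using miexp by (intro integral_density) (auto simp: orthant_exp_nonneg)
  also have "\<dots> = (\<integral>x. (\<Prod>j\<in>UNIV. indicator {0..} (x $ j) *\<^sub>R exp (- (c j * of_real (x $ j)))) \<partial>lborel)"
  proof (rule Bochner_Integration.integral_cong[OF refl])
    fix x :: "real ^ 'm"
    have "iexp (t * (a \<bullet> x)) = (\<Prod>j\<in>UNIV. exp (\<i> * of_real (t * a $ j * x $ j)))"
      by (simp add: inner_vec_def sum_distrib_left mult.assoc flip: exp_sum)
    then have "orthant_exp x *\<^sub>R iexp (t * (a \<bullet> x)) = (\<Prod>j\<in>UNIV. of_real (indicator {0..} (x $ j) * exp (- (x $ j))) * exp (\<i> * of_real (t * a $ j * x $ j)))"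
      unfolding scaleR_conv_of_real orthant_exp_prod of_real_prod by (simp only: prod.distrib)
    also have "\<dots> = (\<Prod>j\<in>UNIV. indicator {0..} (x $ j) *\<^sub>R exp (- (c j * of_real (x $ j))))"
    proof (rule prod.cong[OF refl])
      fix j
      have "exp (- (c j * of_real (x $ j))) = exp (of_real (- (x $ j))) * exp (\<i> * of_real (t * a $ j * x $ j))"
        unfolding exp_add[symmetric] by (simp add: c_def algebra_simps)
      then show "of_real (indicator {0..} (x $ j) * exp (- (x $ j))) * exp (\<i> * of_real (t * a $ j * x $ j)) = indicator {0..} (x $ j) *\<^sub>R exp (- (c j * of_real (x $ j)))"
        by (simp only: scaleR_conv_of_real exp_of_real[symmetric] of_real_mult mult.assoc)
    qed
    finally show "orthant_exp x *\<^sub>R iexp (t * (a \<bullet> x)) = (\<Prod>j\<in>UNIV. indicator {0..} (x $ j) *\<^sub>R exp (- (c j * of_real (x $ j))))" .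
  qed
  also have "\<dots> = (\<Prod>j\<in>UNIV. \<integral>u. indicator {0..} u *\<^sub>R exp (- (c j * of_real u)) \<partial>lborel)"
    by (rule lborel_integral_prod_cart[where F = "\<lambda>j u. indicator {0..} u *\<^sub>R exp (- (c j * of_real u))"])
      (rule complex_exp_integral_Ici(1)[OF c])
  also have "\<dots> = (\<Prod>j\<in>UNIV. 1 / c j)" by (simp only: complex_exp_integral_Ici(2)[OF c])
  finally show ?thesis by (simp only: c_def)
qed

lemma prob_space_exp_measure: "prob_space (exp_measure :: (real ^ 'm) measure)"
proof
  have "emeasure (exp_measure :: (real ^ 'm) measure) (space exp_measure) = (\<integral>\<^sup>+x. ennreal (orthant_exp x) \<partial>(lborel :: (real ^ 'm) measure))"
    unfolding exp_measure_def by (subst emeasure_density) auto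
  also have "\<dots> = (\<integral>\<^sup>+x. (\<Prod>b\<in>Basis. ennreal (indicator {0..} (x \<bullet> b) * exp (- (x \<bullet> b)))) \<partial>(lborel :: (real ^ 'm) measure))"
    by (intro nn_integral_cong) (simp add: orthant_exp_prod prod_Basis_cart inner_axis prod_ennreal)
  also have "\<dots> = (\<Prod>b\<in>(Basis :: (real ^ 'm) set). \<integral>\<^sup>+u. ennreal (indicator {0..} u * exp (- u)) \<partial>lborel)"
    by (rule nn_integral_lborel_prod) auto
  also have "(\<integral>\<^sup>+u. ennreal (indicator {0..} u * exp (- u)) \<partial>lborel) = (1 :: ennreal)"
  proof -
    have "(\<integral>\<^sup>+u. ennreal (indicator {0..} u * exp (- u)) \<partial>lborel) = (\<integral>\<^sup>+t. ennreal (exp (- (1 * t)) * (1 * t) ^ 0) * indicator {0..} t \<partial>lborel)"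
      by (intro nn_integral_cong) (auto simp: indicator_def)
    then show ?thesis by (subst (asm) nn_integral_power_exp_scaled) simp_all
  qed
  finally show "emeasure (exp_measure :: (real ^ 'm) measure) (space exp_measure) = 1" by simp
qed

lemma integrable_inverse_quadratic:
  assumes c: "c \<noteq> 0" shows "integrable lborel (\<lambda>t::real. 1 / (1 + (c * t)\<^sup>2))"
proof -
  have "integrable lborel (\<lambda>x::real. inverse (1 + x\<^sup>2))"
    using integrable_inverse_1_plus_square by (simp add: set_integrable_def einterval_eq)
  from lborel_integrable_real_affine[OF this c, of 0] show ?thesis by (simp add: inverse_eq_divide)
qed

section \<open>Integrability on the imaginary axis\<close>

context centred_unit
begin

text \<open>One positive and one negative coordinate give two factors of modulus at least sqrt (1 +
  (c t)^2), and the others have modulus at least 1. Hence the integral converges absolutely for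
  every n >= 1.\<close>

lemma char_fun_bound: "\<exists>c. c \<noteq> 0 \<and> (\<forall>t. cmod (char_fun (\<i> * of_real t)) \<le> 1 / (1 + (c * t)\<^sup>2))"
proof -
  obtain k l where k: "a k > 0" and l: "a l < 0" using ex_pos ex_neg by blast
  have kl: "k \<noteq> l" using k l by auto
  define c where "c = min \<bar>a k\<bar> \<bar>a l\<bar>"
  have c: "c > 0" using k l by (auto simp: c_def)
  have nrm: "cmod (1 - of_real (a j) * (\<i> * of_real t)) = sqrt (1 + (a j * t)\<^sup>2)" for j t
    by (simp add: cmod_def)
  have ge1: "1 \<le> cmod (1 - of_real (a j) * (\<i> * of_real t))" for j t unfolding nrm by simp
  have gec: "sqrt (1 + (c * t)\<^sup>2) \<le> sqrt (1 + (a j * t)\<^sup>2)" if "c \<le> \<bar>a j\<bar>" for j t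
  proof -
    have "\<bar>c * t\<bar> \<le> \<bar>a j * t\<bar>" using that c by (simp add: abs_mult mult_right_mono)
    then show ?thesis by (simp only: abs_le_square_iff real_sqrt_le_iff add_le_cancel_left)
  qed
  have "cmod (char_fun (\<i> * of_real t)) \<le> 1 / (1 + (c * t)\<^sup>2)" for t
  proof -
    have pos: "1 + (c * t)\<^sup>2 > 0" by (intro add_pos_nonneg) auto
    have "1 + (c * t)\<^sup>2 = sqrt (1 + (c * t)\<^sup>2) * sqrt (1 + (c * t)\<^sup>2)" using pos by simp
    also have "\<dots> \<le> sqrt (1 + (a k * t)\<^sup>2) * sqrt (1 + (a l * t)\<^sup>2)"
      using pos by (intro mult_mono gec) (auto simp: c_def)
    also have "\<dots> = (\<Prod>j\<in>{k, l}. cmod (1 - of_real (a j) * (\<i> * of_real t)))" using kl unfolding nrm by simp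
    also have "\<dots> \<le> (\<Prod>j\<in>UNIV. cmod (1 - of_real (a j) * (\<i> * of_real t)))"
      by (rule prod_mono2) (auto intro: ge1)
    finally have le: "1 + (c * t)\<^sup>2 \<le> cmod (\<Prod>j\<in>UNIV. 1 - of_real (a j) * (\<i> * of_real t))" by (simp only: prod_norm)
    have "1 / cmod (\<Prod>j\<in>UNIV. 1 - of_real (a j) * (\<i> * of_real t)) \<le> 1 / (1 + (c * t)\<^sup>2)"
      by (rule divide_left_mono[OF le]) (use pos le in \<open>auto intro: mult_pos_pos less_le_trans\<close>)
    then show ?thesis by (simp only: char_fun_def norm_divide norm_one)
  qed
  then show ?thesis using c by (intro exI[of _ c]) auto
qed

lemma char_fun_axis_measurable: "(\<lambda>t. char_fun (\<i> * of_real t)) \<in> borel_measurable borel"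
proof (rule borel_measurable_continuous_onI)
  have "1 - of_real (a j) * (\<i> * of_real t) \<noteq> 0" for j t
    by (rule slit_nz) (simp add: slit_def)
  then show "continuous_on UNIV (\<lambda>t. char_fun (\<i> * of_real t))"
    unfolding char_fun_def by (intro continuous_intros) auto
qed

lemma char_fun_axis_integrable: "integrable lborel (\<lambda>t. char_fun (\<i> * of_real t))"
proof -
  obtain c where c: "c \<noteq> 0" "\<And>t. cmod (char_fun (\<i> * of_real t)) \<le> 1 / (1 + (c * t)\<^sup>2)" using char_fun_bound by blast
  show ?thesis
    by (rule Bochner_Integration.integrable_bound[OF integrable_inverse_quadratic[OF c(1)]])
      (use c(2) char_fun_axis_measurable in \<open>auto intro: order_trans[OF _ abs_ge_self]\<close>)
qed

text \<open>Half the integral over the whole line, since t and - t give conjugate values; by Fourier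
  inversion it is pi times the density at 0.\<close>

definition axis_value :: real where
  "axis_value = (LBINT t:{0..}. Re (char_fun (\<i> * of_real t)))"

lemma Re_char_fun_integrable: "integrable lborel (\<lambda>t. Re (char_fun (\<i> * of_real t)))"
  using char_fun_axis_integrable by (rule integrable_Re)

lemma axis_value_limit:
  "((\<lambda>R. integral {0..R} (\<lambda>t. Re (char_fun (\<i> * of_real t)))) \<longlongrightarrow> axis_value) at_top"
proof -
  have si: "set_integrable lborel A (\<lambda>t. Re (char_fun (\<i> * of_real t)))" if "A \<in> sets borel" for A
    using Re_char_fun_integrable that unfolding set_integrable_def
    by (intro integrable_mult_indicator) auto
  have "((\<lambda>R. LBINT t:{0..R}. Re (char_fun (\<i> * of_real t))) \<longlongrightarrow> axis_value) at_top"
    unfolding axis_value_def by (intro tendsto_set_lebesgue_integral_at_top si) auto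
  moreover have "(LBINT t:{0..R}. Re (char_fun (\<i> * of_real t))) = integral {0..R} (\<lambda>t. Re (char_fun (\<i> * of_real t)))" for R
    by (intro set_borel_integral_eq_integral si) auto
  ultimately show ?thesis by simp
qed

lemma char_fun_cnj: "char_fun (\<i> * of_real (- t)) = cnj (char_fun (\<i> * of_real t))"
  by (simp add: char_fun_def cnj_prod)

lemma Re_char_fun_integral: "(\<integral>t. Re (char_fun (\<i> * of_real t)) \<partial>lborel) = 2 * axis_value"
proof -
  let ?f = "\<lambda>t. Re (char_fun (\<i> * of_real t))"
  have i: "integrable lborel (\<lambda>t. indicator A t *\<^sub>R ?f t)" if "A \<in> sets borel" for A
    using Re_char_fun_integrable that by (intro integrable_mult_indicator) auto
  have "(\<integral>t. ?f t \<partial>lborel) = (\<integral>t. indicator {0..} t *\<^sub>R ?f t + indicator {..<0} t *\<^sub>R ?f t \<partial>lborel)"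
    by (intro Bochner_Integration.integral_cong refl) (auto simp: indicator_def)
  also have "\<dots> = axis_value + (\<integral>t. indicator {..<0} t *\<^sub>R ?f t \<partial>lborel)"
    unfolding axis_value_def set_lebesgue_integral_def by (intro Bochner_Integration.integral_add i) auto
  also have "(\<integral>t. indicator {..<0} t *\<^sub>R ?f t \<partial>lborel) = (\<integral>t. indicator {..<0} (- t) *\<^sub>R ?f (- t) \<partial>lborel)"
    by (subst lborel_integral_real_affine[where c = "-1" and t = 0]) simp_all
  also have "\<dots> = axis_value"
    unfolding axis_value_def set_lebesgue_integral_def
  proof (rule integral_cong_AE)
    have "AE t in lborel. t \<noteq> (0::real)" by (rule AE_lborel_singleton)
    then show "AE t in lborel. indicator {..<0} (- t) *\<^sub>R ?f (- t) = indicator {0..} t *\<^sub>R ?f t"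
      by eventually_elim (simp only: char_fun_cnj complex_cnj, auto simp: indicator_def)
    have mf: "?f \<in> borel_measurable borel" using borel_measurable_integrable[OF Re_char_fun_integrable] by simp
    show "(\<lambda>t. indicator {..<0} (- t) *\<^sub>R ?f (- t)) \<in> borel_measurable lborel"
      using measurable_compose[of uminus borel borel ?f borel] mf by simp
    show "(\<lambda>t. indicator {0..} t *\<^sub>R ?f t) \<in> borel_measurable lborel" using mf by simp
  qed
  finally show ?thesis by simp
qed

end

text \<open>The probability of 0 < a . E <= eps, divided by eps, has two expressions for its limit:
  \<open>slab_limit\<close> yields the volume, and Levy inversion yields the integral of the
  characteristic function over 2 pi.\<close>

lemma V_eq_axis_value:
  fixes a :: "real ^ 'm"
  assumes card: "CARD('m) = n + 1" and n: "n \<ge> 1" and a: "norm a = 1" "(\<Sum>j\<in>UNIV. a $ j) = 0"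
  shows "centred_unit (\<lambda>j. a $ j) n"
    and "V a = sqrt (real n + 1) / fact (n - 1) * (centred_unit.axis_value (\<lambda>j. a $ j) / pi)"
proof -
  have "(\<Sum>j\<in>UNIV. (a $ j)\<^sup>2) = a \<bullet> a" by (simp add: inner_vec_def power2_eq_square)
  also have "\<dots> = 1" using a by (simp add: dot_square_norm)
  finally show cu: "centred_unit (\<lambda>j. a $ j) n" using card n a by unfold_locales auto
  interpret A: centred_unit "\<lambda>j. a $ j" n by (rule cu)
  interpret E: prob_space "exp_measure :: (real ^ 'm) measure" by (rule prob_space_exp_measure)
  have a0: "a \<noteq> 0" using a by auto
  have mX [measurable]: "(\<lambda>x. a \<bullet> x) \<in> borel_measurable borel"
    by (intro borel_measurable_continuous_onI continuous_intros)
  have mX': "(\<lambda>x. a \<bullet> x) \<in> measurable exp_measure borel" by (simp add: exp_measure_def)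
  define M where "M = distr exp_measure borel (\<lambda>x. a \<bullet> x)"
  interpret M: real_distribution M
    unfolding M_def by (rule E.real_distribution_distr[OF mX'])
  define \<phi> where "\<phi> t = A.char_fun (\<i> * of_real t)" for t
  have charM: "char M t = \<phi> t" for t
  proof -
    have "char M t = (\<integral>x. iexp (t * (a \<bullet> x)) \<partial>exp_measure)"
      unfolding char_def M_def by (rule integral_distr[OF mX']) (intro borel_measurable_continuous_onI continuous_intros)
    also have "\<dots> = \<phi> t"
      unfolding exp_measure_integral_exp \<phi>_def A.char_fun_def by (simp add: prod_dividef mult_ac)
    finally show ?thesis .
  qed
  \<comment> \<open>Levy inversion asks for end points without mass; the preimage of a point is a
    hyperplane, which is a null set for a law with density.\<close>
  have atom: "measure M {c} = 0" for c
  proof -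
    have neg: "negligible {x. a \<bullet> x = c}" using a0 by (rule negligible_hyperplane[OF disjI1])
    have cl: "closed {x. a \<bullet> x = c}" by (rule closed_hyperplane)
    have "{x. a \<bullet> x = c} \<in> null_sets lebesgue" using neg by (simp only: negligible_iff_null_sets)
    then have "emeasure lebesgue {x. a \<bullet> x = c} = 0" by (rule null_setsD1)
    then have "emeasure lborel {x. a \<bullet> x = c} = 0"
      using borel_closed[OF cl] by (subst (asm) emeasure_completion) (simp_all add: main_part_sets)
    then have "{x. a \<bullet> x = c} \<in> null_sets lborel" using borel_closed[OF cl] by (intro null_setsI) auto
    then have ae: "AE x in lborel. x \<notin> {x. a \<bullet> x = c}" by (rule AE_not_in)
    have "emeasure exp_measure {x. a \<bullet> x = c} = (\<integral>\<^sup>+x. ennreal (orthant_exp x) * indicator {x. a \<bullet> x = c} x \<partial>lborel)"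
      unfolding exp_measure_def using borel_closed[OF cl] by (intro emeasure_density) auto
    also have "\<dots> = (\<integral>\<^sup>+x. 0 \<partial>(lborel :: (real ^ 'm) measure))"
      by (rule nn_integral_cong_AE) (use ae in \<open>auto elim!: eventually_mono\<close>)
    finally have "emeasure exp_measure {x. a \<bullet> x = c} = 0" by simp
    moreover have "emeasure M {c} = emeasure exp_measure {x. a \<bullet> x = c}"
      unfolding M_def by (subst emeasure_distr[OF mX']) (auto simp: exp_measure_def vimage_def)
    ultimately show ?thesis by (simp add: measure_def)
  qed
  define \<epsilon> where "\<epsilon> i = 1 / real (Suc i)" for i
  have \<epsilon>: "\<epsilon> i > 0" for i by (simp add: \<epsilon>_def)
  \<comment> \<open>The Fourier kernel of the interval (0, e]. It is bounded by e, so after division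
    by e it stays dominated by 1. At t = 0 the quotient defaults to 0, which affects a null set
    only.\<close>
  define F where "F e t = (1 - iexp (- (t * e))) / (\<i> * t)" for e t :: real
  have Fb: "cmod (F e t) \<le> e" if "e > 0" for e t
  proof (cases "t = 0")
    case False
    have "cmod ((iexp (t * 0) - iexp (t * (- e))) / (\<i> * t)) \<le> 0 - (- e)"
      using that False by (intro Levy_Inversion_aux2) auto
    then show ?thesis by (simp add: F_def)
  qed (use that in \<open>simp add: F_def\<close>)
  have mF: "F e \<in> borel_measurable borel" for e
    unfolding F_def by measurable
  have m\<phi>: "\<phi> \<in> borel_measurable borel" unfolding \<phi>_def by (rule A.char_fun_axis_measurable)
  have i\<phi>: "integrable lborel \<phi>" unfolding \<phi>_def by (rule A.char_fun_axis_integrable)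
  have levy: "complex_of_real (measure M {0<..e}) = 1 / (2 * pi) * (\<integral>t. F e t * \<phi> t \<partial>lborel)" if e: "e > 0" for e
  proof -
    have "(\<lambda>T. 1 / (2 * pi) * (CLBINT t=-real T..real T. (iexp (-(t * 0)) - iexp (-(t * e))) / (\<i> * t) * char M t)) \<longlonglongrightarrow> of_real (measure M {0<..e})"
      using M.Levy_Inversion[of 0 e] e atom by simp
    then have 1: "(\<lambda>T. 1 / (2 * pi) * (CLBINT t=-real T..real T. F e t * \<phi> t)) \<longlonglongrightarrow> of_real (measure M {0<..e})"
      by (simp add: charM F_def)
    have "(\<lambda>T::nat. \<integral>t. indicator {-real T<..<real T} t *\<^sub>R (F e t * \<phi> t) \<partial>lborel) \<longlonglongrightarrow> (\<integral>t. F e t * \<phi> t \<partial>lborel)"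
    proof (rule integral_dominated_convergence[where w = "\<lambda>t. e * cmod (\<phi> t)"])
      show "integrable lborel (\<lambda>t. e * cmod (\<phi> t))" using i\<phi> by auto
      show "AE t in lborel. (\<lambda>T::nat. indicator {-real T<..<real T} t *\<^sub>R (F e t * \<phi> t)) \<longlonglongrightarrow> F e t * \<phi> t"
      proof (rule AE_I2)
        fix t :: real
        obtain N :: nat where N: "\<bar>t\<bar> < real N" using reals_Archimedean2 by blast
        have "eventually (\<lambda>T::nat. indicator {-real T<..<real T} t *\<^sub>R (F e t * \<phi> t) = F e t * \<phi> t) sequentially"
          using eventually_ge_at_top[of N]
        proof eventually_elim
          case (elim T)
          then have "\<bar>t\<bar> < real T" using N by simp
          then show ?case by (simp add: abs_less_iff)
        qed
        then show "(\<lambda>T::nat. indicator {-real T<..<real T} t *\<^sub>R (F e t * \<phi> t)) \<longlonglongrightarrow> F e t * \<phi> t" by (rule tendsto_eventually)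
      qed
      show "AE t in lborel. norm (indicator {-real T<..<real T} t *\<^sub>R (F e t * \<phi> t)) \<le> e * cmod (\<phi> t)" for T :: nat
        using Fb[OF e] e by (intro AE_I2) (auto simp: indicator_def norm_mult intro!: mult_right_mono)
    qed (use mF m\<phi> in auto)
    moreover have "(CLBINT t=-real T..real T. F e t * \<phi> t) = (\<integral>t. indicator {-real T<..<real T} t *\<^sub>R (F e t * \<phi> t) \<partial>lborel)" for T :: nat
      by (simp add: interval_lebesgue_integral_def set_lebesgue_integral_def einterval_eq)
    ultimately have "(\<lambda>T. 1 / (2 * pi) * (CLBINT t=-real T..real T. F e t * \<phi> t)) \<longlonglongrightarrow> 1 / (2 * pi) * (\<integral>t. F e t * \<phi> t \<partial>lborel)"
      by (intro tendsto_mult tendsto_const) simp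
    then show ?thesis using 1 LIMSEQ_unique by blast
  qed
  have \<epsilon>0: "\<epsilon> \<longlonglongrightarrow> 0" unfolding \<epsilon>_def using LIMSEQ_inverse_real_of_nat by (simp add: inverse_eq_divide)
  have "(\<lambda>i. \<integral>t. of_real (1 / \<epsilon> i) * (F (\<epsilon> i) t * \<phi> t) \<partial>lborel) \<longlonglongrightarrow> (\<integral>t. \<phi> t \<partial>lborel)"
  proof (rule integral_dominated_convergence[where w = "\<lambda>t. cmod (\<phi> t)"])
    show "AE t in lborel. (\<lambda>i. of_real (1 / \<epsilon> i) * (F (\<epsilon> i) t * \<phi> t)) \<longlonglongrightarrow> \<phi> t"
    proof -
      have "AE t in lborel. t \<noteq> (0::real)" by (rule AE_lborel_singleton)
      then show ?thesis
      proof eventually_elim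
        fix t :: real assume t: "t \<noteq> 0"
        \<comment> \<open>The derivative of the exponential at 0 shows that the kernel divided by
          eps tends to 1.\<close>
        have "((\<lambda>z. exp (- (\<i> * of_real t * z))) has_field_derivative (exp (- (\<i> * of_real t * 0)) * (- (\<i> * of_real t)))) (at 0)"
          by (auto intro!: derivative_eq_intros)
        then have d: "((\<lambda>z. (exp (- (\<i> * of_real t * z)) - 1) / z) \<longlongrightarrow> - (\<i> * of_real t)) (at 0)"
          by (simp add: has_field_derivative_iff)
        have "filterlim (\<lambda>i. complex_of_real (\<epsilon> i)) (at 0) sequentially"
          unfolding filterlim_at using tendsto_of_real[OF \<epsilon>0, where 'a = complex] \<epsilon> by (auto simp: less_imp_neq[THEN not_sym])
        from filterlim_compose[OF d this]
        have "(\<lambda>i. (exp (- (\<i> * of_real t * of_real (\<epsilon> i))) - 1) / of_real (\<epsilon> i)) \<longlonglongrightarrow> - (\<i> * of_real t)" .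
        then have "(\<lambda>i. - ((exp (- (\<i> * of_real t * of_real (\<epsilon> i))) - 1) / of_real (\<epsilon> i)) / (\<i> * of_real t) * \<phi> t) \<longlonglongrightarrow> - (- (\<i> * of_real t)) / (\<i> * of_real t) * \<phi> t"
          using t by (intro tendsto_intros) auto
        moreover have "- ((exp (- (\<i> * of_real t * of_real (\<epsilon> i))) - 1) / of_real (\<epsilon> i)) / (\<i> * of_real t) * \<phi> t = of_real (1 / \<epsilon> i) * (F (\<epsilon> i) t * \<phi> t)" for i
        proof -
          have "\<i> * of_real (- (t * \<epsilon> i)) = - (\<i> * of_real t * of_real (\<epsilon> i))" by simp
          then show ?thesis unfolding F_def using \<epsilon>[of i] t by (simp only:) (simp add: field_simps)
        qed
        ultimately show "(\<lambda>i. of_real (1 / \<epsilon> i) * (F (\<epsilon> i) t * \<phi> t)) \<longlonglongrightarrow> \<phi> t" using t by simp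
      qed
    qed
    show "AE t in lborel. norm (of_real (1 / \<epsilon> i) * (F (\<epsilon> i) t * \<phi> t)) \<le> cmod (\<phi> t)" for i
    proof (rule AE_I2)
      fix t
      have "norm (of_real (1 / \<epsilon> i) * (F (\<epsilon> i) t * \<phi> t)) = (1 / \<epsilon> i) * (cmod (F (\<epsilon> i) t) * cmod (\<phi> t))"
        unfolding norm_mult norm_of_real using \<epsilon>[of i] by simp
      also have "\<dots> \<le> (1 / \<epsilon> i) * (\<epsilon> i * cmod (\<phi> t))"
        using \<epsilon>[of i] by (intro mult_left_mono mult_right_mono Fb) auto
      finally show "norm (of_real (1 / \<epsilon> i) * (F (\<epsilon> i) t * \<phi> t)) \<le> cmod (\<phi> t)" using \<epsilon>[of i] by simp
    qed
  qed (use mF m\<phi> i\<phi> in auto)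
  then have "(\<lambda>i. 1 / (2 * pi) * (of_real (1 / \<epsilon> i) * (\<integral>t. F (\<epsilon> i) t * \<phi> t \<partial>lborel))) \<longlonglongrightarrow> 1 / (2 * pi) * (\<integral>t. \<phi> t \<partial>lborel)"
    by (intro tendsto_mult tendsto_const) simp
  moreover have "1 / (2 * pi) * (of_real (1 / \<epsilon> i) * (\<integral>t. F (\<epsilon> i) t * \<phi> t \<partial>lborel)) = of_real (1 / \<epsilon> i * measure M {0<..\<epsilon> i})" for i
    using levy[OF \<epsilon>[of i]] by (simp only: of_real_mult mult.left_commute)
  ultimately have "(\<lambda>i. complex_of_real (1 / \<epsilon> i * measure M {0<..\<epsilon> i})) \<longlonglongrightarrow> 1 / (2 * pi) * (\<integral>t. \<phi> t \<partial>lborel)" by simp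
  then have "(\<lambda>i. Re (complex_of_real (1 / \<epsilon> i * measure M {0<..\<epsilon> i}))) \<longlonglongrightarrow> Re (1 / (2 * pi) * (\<integral>t. \<phi> t \<partial>lborel))" by (rule tendsto_Re)
  moreover have "1 / (2 * pi) * (\<integral>t. \<phi> t \<partial>lborel) = of_real (1 / (2 * pi)) * (\<integral>t. \<phi> t \<partial>lborel)" by simp
  moreover have "Re (of_real (1 / (2 * pi)) * (\<integral>t. \<phi> t \<partial>lborel)) = 1 / (2 * pi) * (\<integral>t. Re (\<phi> t) \<partial>lborel)"
    using integral_Re[OF i\<phi>] by (simp only: times_complex.sel Re_complex_of_real Im_complex_of_real mult_zero_left diff_zero)
  moreover have "(\<integral>t. Re (\<phi> t) \<partial>lborel) = 2 * A.axis_value" unfolding \<phi>_def by (rule A.Re_char_fun_integral)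
  ultimately have L1: "(\<lambda>i. 1 / \<epsilon> i * measure M {0<..\<epsilon> i}) \<longlonglongrightarrow> A.axis_value / pi" by simp
  have "ennreal (Suc i) * (\<integral>\<^sup>+x. ennreal (orthant_exp x) * indicator {x. 0 < a \<bullet> x \<and> a \<bullet> x \<le> 1 / Suc i} x \<partial>lborel) = ennreal (1 / \<epsilon> i * measure M {0<..\<epsilon> i})" for i
  proof -
    have S: "{x. 0 < a \<bullet> x \<and> a \<bullet> x \<le> 1 / Suc i} \<in> sets borel" by measurable
    have "(\<integral>\<^sup>+x. ennreal (orthant_exp x) * indicator {x. 0 < a \<bullet> x \<and> a \<bullet> x \<le> 1 / Suc i} x \<partial>lborel) = emeasure exp_measure {x. 0 < a \<bullet> x \<and> a \<bullet> x \<le> 1 / Suc i}"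
      unfolding exp_measure_def using S by (intro emeasure_density[symmetric]) auto
    also have "\<dots> = emeasure M {0<..\<epsilon> i}"
      unfolding M_def by (subst emeasure_distr[OF mX']) (auto simp: exp_measure_def \<epsilon>_def intro!: arg_cong2[where f = emeasure])
    also have "\<dots> = ennreal (measure M {0<..\<epsilon> i})" by (rule M.emeasure_eq_measure)
    finally show ?thesis by (simp add: \<epsilon>_def ennreal_mult)
  qed
  then have "(\<lambda>i. ennreal (1 / \<epsilon> i * measure M {0<..\<epsilon> i})) \<longlonglongrightarrow> ennreal (fact (n - 1) / sqrt (real n + 1)) * ennreal (V a)"
    using slab_limit[OF card n a] by simp
  moreover have "(\<lambda>i. ennreal (1 / \<epsilon> i * measure M {0<..\<epsilon> i})) \<longlonglongrightarrow> ennreal (A.axis_value / pi)"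
    by (rule tendsto_ennrealI[OF L1])
  ultimately have eq: "ennreal (fact (n - 1) / sqrt (real n + 1)) * ennreal (V a) = ennreal (A.axis_value / pi)"
    by (rule LIMSEQ_unique)
  have V0: "V a \<ge> 0" by (simp add: V_def Vol_def)
  have q0: "A.axis_value / pi \<ge> 0" by (rule LIMSEQ_le_const[OF L1]) (auto intro!: exI[of _ 0] divide_nonneg_nonneg simp: \<epsilon>_def)
  have "fact (n - 1) / sqrt (real n + 1) * V a = A.axis_value / pi"
    using eq V0 q0 by (simp add: ennreal_mult[symmetric])
  then show "V a = sqrt (real n + 1) / fact (n - 1) * (A.axis_value / pi)"
    by (simp add: field_simps)
qed

text \<open>Since U + n W = N, 1 / (U W^(k+1)) is the sum of (1 / N) W^(-k-1) and rho / (U W^k). The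
  powers W^-2, W^-3, ... contribute 0 to the real part, so each further factor W multiplies the
  value by rho; the case of one W is settled by arctangents. The exponent m is separate from n so
  that it can vary in the induction.\<close>

lemma axis_integral_two_factor:
  fixes A \<rho> N :: real and n :: nat
  assumes A: "A > 0" and n: "n > 0" and N: "N = real n + 1" and \<rho>: "\<rho> = real n / N" and m: "m \<ge> 1"
  shows "((\<lambda>R. integral {0..R} (\<lambda>t. Re (1 / ((1 - \<i> * of_real (A * t)) * (1 + \<i> * of_real (A / n * t)) ^ m)))) \<longlongrightarrow> \<rho> ^ m * pi / A) at_top"
proof -
  define b where "b = A / n"
  have b: "b > 0" using A n by (simp add: b_def)
  have N0: "N > 0" by (simp add: N)
  define U W where "U t = 1 - \<i> * of_real (A * t)" and "W t = 1 + \<i> * of_real (b * t)" for t :: real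
  have U0: "U t \<noteq> 0" and W0: "W t \<noteq> 0" for t by (auto simp: U_def W_def complex_eq_iff)
  have split: "1 / (U t * W t ^ Suc k) = of_real (1 / N) * (1 / W t ^ Suc k) + of_real \<rho> * (1 / (U t * W t ^ k))" for t k
  proof -
    have "U t + of_real (real n) * W t = of_real N" using n by (simp add: U_def W_def b_def N algebra_simps)
    then have "of_real (1 / N) * U t + of_real \<rho> * W t = 1"
      using N0 by (simp add: \<rho> field_simps)
    then have "1 / (U t * W t ^ Suc k) = (of_real (1 / N) * U t + of_real \<rho> * W t) / (U t * W t ^ Suc k)" by simp
    also have "\<dots> = of_real (1 / N) * (1 / W t ^ Suc k) + of_real \<rho> * (1 / (U t * W t ^ k))"
      using U0[of t] W0[of t] by (simp add: add_divide_distrib)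
    finally show ?thesis .
  qed
  have cont: "(\<lambda>t. Re (1 / (U t ^ j * W t ^ k))) integrable_on {0..R}" for j k R
    proof (intro integrable_continuous_interval continuous_on_Re continuous_on_divide continuous_on_const)
    show "continuous_on {0..R} (\<lambda>t. U t ^ j * W t ^ k)" unfolding U_def W_def by (intro continuous_intros)
    show "\<forall>t\<in>{0..R}. U t ^ j * W t ^ k \<noteq> 0" using U0 W0 by simp
  qed
  have contU: "(\<lambda>t. Re (1 / U t)) integrable_on {0..R}" and contW: "(\<lambda>t. Re (1 / W t ^ k)) integrable_on {0..R}" and contUW: "(\<lambda>t. Re (1 / (U t * W t ^ k))) integrable_on {0..R}" for k R
    using cont[of 1 0 R] cont[of 0 k R] cont[of 1 k R] by simp_all
  have step: "integral {0..R} (\<lambda>t. Re (1 / (U t * W t ^ Suc k))) = 1 / N * integral {0..R} (\<lambda>t. Re (1 / W t ^ Suc k)) + \<rho> * integral {0..R} (\<lambda>t. Re (1 / (U t * W t ^ k)))" for k R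
  proof -
    have "Re (1 / (U t * W t ^ Suc k)) = 1 / N * Re (1 / W t ^ Suc k) + \<rho> * Re (1 / (U t * W t ^ k))" for t
      by (simp only: split plus_complex.sel times_complex.sel Re_complex_of_real Im_complex_of_real mult_zero_left diff_zero)
    then have "integral {0..R} (\<lambda>t. Re (1 / (U t * W t ^ Suc k))) = integral {0..R} (\<lambda>t. 1 / N * Re (1 / W t ^ Suc k) + \<rho> * Re (1 / (U t * W t ^ k)))"
      by (simp only:)
    also have "\<dots> = integral {0..R} (\<lambda>t. 1 / N * Re (1 / W t ^ Suc k)) + integral {0..R} (\<lambda>t. \<rho> * Re (1 / (U t * W t ^ k)))"
      by (intro Henstock_Kurzweil_Integration.integral_add integrable_on_mult_right contW contUW)
    finally show ?thesis by (simp only: Henstock_Kurzweil_Integration.integral_mult_right)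
  qed
  have arctan_int: "((\<lambda>R. integral {0..R} (\<lambda>t. 1 / (1 + (c * t)\<^sup>2))) \<longlongrightarrow> pi / 2 / c) at_top" if c: "c > 0" for c :: real
  proof -
    have eqR: "integral {0..R} (\<lambda>t. 1 / (1 + (c * t)\<^sup>2)) = arctan (c * R) / c" if "0 \<le> R" for R
    proof -
      have "((\<lambda>t. 1 / (1 + (c * t)\<^sup>2)) has_integral (arctan (c * R) / c - arctan (c * 0) / c)) {0..R}"
      proof (rule fundamental_theorem_of_calculus[OF that])
        fix t
        have "((\<lambda>t. arctan (c * t) / c) has_real_derivative (inverse (1 + (c * t)\<^sup>2) * c / c)) (at t)"
          by (intro DERIV_cdivide DERIV_chain2[OF DERIV_arctan]) (auto intro!: derivative_eq_intros)
        then show "((\<lambda>t. arctan (c * t) / c) has_vector_derivative 1 / (1 + (c * t)\<^sup>2)) (at t within {0..R})"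
          using c by (simp add: inverse_eq_divide has_real_derivative_iff_has_vector_derivative has_vector_derivative_at_within)
      qed
      then show ?thesis by (simp add: integral_unique)
    qed
    have "eventually (\<lambda>R. arctan (c * R) / c = integral {0..R} (\<lambda>t. 1 / (1 + (c * t)\<^sup>2))) at_top"
      by (rule eventually_mono[OF eventually_ge_at_top[of 0]]) (simp only: eqR)
    moreover have "((\<lambda>R. arctan (c * R) / c) \<longlongrightarrow> pi / 2 / c) at_top"
    proof -
      have "filterlim (\<lambda>R. c * R) at_top at_top" using c by real_asymp
      then have "((\<lambda>R. arctan (c * R)) \<longlongrightarrow> pi / 2) at_top" by (rule filterlim_compose[OF tendsto_arctan_at_top])
      then show ?thesis by (intro tendsto_divide tendsto_const) (use c in auto)
    qed
    ultimately show ?thesis by (rule Lim_transform_eventually[rotated])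
  qed
  have ReU: "Re (1 / U t) = 1 / (1 + (A * t)\<^sup>2)" and ReW: "Re (1 / W t ^ Suc 0) = 1 / (1 + (b * t)\<^sup>2)" for t
    by (simp_all add: U_def W_def Re_divide)
  have higher: "((\<lambda>R. integral {0..R} (\<lambda>t. Re (1 / W t ^ Suc (Suc k)))) \<longlongrightarrow> 0) at_top" for k
  proof -
    define c where "c = b * real (Suc k)"
    have c: "c > 0" using b by (simp add: c_def)
    \<comment> \<open>A primitive of W^(-k-2). It is imaginary at 0 and tends to 0 at infinity, so
      the real part integrates to 0.\<close>
    define G where "G t = \<i> / of_real c * inverse (W t ^ Suc k)" for t
    have G: "(G has_vector_derivative 1 / W t ^ Suc (Suc k)) (at t)" for t
    proof -
      define h where "h z = 1 + \<i> * (of_real b * z)" for z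
      have hW: "h (of_real t) = W t" for t by (simp add: h_def W_def)
      have alg: "\<i> / (q * \<beta>) * (- (inverse (w * p) * (q * (\<i> * \<beta> * p)) * inverse (w * p))) = 1 / (w * (w * p))"
        if "q \<noteq> 0" "\<beta> \<noteq> 0" "w \<noteq> 0" "p \<noteq> 0" for q \<beta> w p :: complex
        using that by (simp add: field_simps)
      have "(h has_field_derivative \<i> * of_real b) (at (of_real t))"
        unfolding h_def by (auto intro!: derivative_eq_intros)
      from DERIV_power_Suc[OF this, of k]
      have "((\<lambda>z. h z ^ Suc k) has_field_derivative of_nat (Suc k) * (\<i> * of_real b * W t ^ k)) (at (of_real t))"
        unfolding hW by (simp only: of_nat_Suc)
      from DERIV_inverse'[OF this]
      have "((\<lambda>z. inverse (h z ^ Suc k)) has_field_derivative - (inverse (W t ^ Suc k) * (of_nat (Suc k) * (\<i> * of_real b * W t ^ k)) * inverse (W t ^ Suc k))) (at (of_real t))"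
        unfolding hW using W0[of t] by simp
      from DERIV_cmult[OF this, of "\<i> / of_real c"]
      have d: "((\<lambda>z. \<i> / of_real c * inverse (h z ^ Suc k)) has_field_derivative \<i> / of_real c * - (inverse (W t ^ Suc k) * (of_nat (Suc k) * (\<i> * of_real b * W t ^ k)) * inverse (W t ^ Suc k))) (at (of_real t))" .
      have "complex_of_real c = of_nat (Suc k) * of_real b"
        unfolding c_def of_real_mult of_real_of_nat_eq by (rule mult.commute)
      moreover have "of_nat (Suc k) \<noteq> (0::complex)" by (simp only: of_nat_eq_0_iff)
      ultimately have "\<i> / of_real c * - (inverse (W t ^ Suc k) * (of_nat (Suc k) * (\<i> * of_real b * W t ^ k)) * inverse (W t ^ Suc k)) = 1 / W t ^ Suc (Suc k)"
        using alg[of "of_nat (Suc k)" "of_real b" "W t" "W t ^ k"] W0[of t] b by (simp only: power_Suc) auto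
      with d have "((\<lambda>z. \<i> / of_real c * inverse (h z ^ Suc k)) has_field_derivative 1 / W t ^ Suc (Suc k)) (at (of_real t))" by (simp only:)
      from has_vector_derivative_real_field[OF this, where s = UNIV]
      show ?thesis unfolding hW G_def .
    qed
    have eqR: "integral {0..R} (\<lambda>t. Re (1 / W t ^ Suc (Suc k))) = Re (G R)" if R: "R \<ge> 0" for R
    proof -
      have "((\<lambda>t. Re (1 / W t ^ Suc (Suc k))) has_integral (Re (G R) - Re (G 0))) {0..R}"
        by (rule fundamental_theorem_of_calculus[OF R])
          (rule bounded_linear.has_vector_derivative[OF bounded_linear_Re has_vector_derivative_at_within[OF G]])
      moreover have "Re (G 0) = 0" by (simp add: G_def W_def)
      ultimately show ?thesis by (simp add: integral_unique)
    qed
    have "eventually (\<lambda>R. Re (G R) = integral {0..R} (\<lambda>t. Re (1 / W t ^ Suc (Suc k)))) at_top"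
      by (rule eventually_mono[OF eventually_ge_at_top[of 0]]) (simp only: eqR)
    moreover have "((\<lambda>R. Re (G R)) \<longlongrightarrow> 0) at_top"
    proof (rule Lim_null_comparison)
      have "norm (Re (G R)) \<le> 1 / c / (b * R)" if R: "R > 0" for R
      proof -
        have bR: "b * R > 0" using b R by simp
        have "b * R \<le> cmod (W R)" using abs_Im_le_cmod[of "W R"] bR by (simp add: W_def)
        moreover have "1 \<le> cmod (W R)" using abs_Re_le_cmod[of "W R"] by (simp add: W_def)
        ultimately have "b * R * 1 \<le> cmod (W R) * cmod (W R) ^ k" using bR by (intro mult_mono) auto
        then have le: "b * R \<le> cmod (W R ^ Suc k)" by (simp add: norm_power norm_mult)
        have "cmod (G R) = 1 / c / cmod (W R ^ Suc k)"
          unfolding G_def norm_mult norm_divide norm_inverse norm_of_real using c by (simp add: divide_inverse)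
        also have "\<dots> \<le> 1 / c / (b * R)"
          by (rule divide_left_mono[OF le]) (use c less_le_trans[OF bR le] bR in \<open>auto intro!: mult_pos_pos simp del: power_Suc\<close>)
        finally show ?thesis using abs_Re_le_cmod[of "G R"] by simp
      qed
      then show "eventually (\<lambda>R. norm (Re (G R)) \<le> 1 / c / (b * R)) at_top"
        using eventually_gt_at_top[of 0] by (rule eventually_mono[rotated])
      show "((\<lambda>R. 1 / c / (b * R)) \<longlongrightarrow> 0) at_top" using b c by real_asymp
    qed
    ultimately show ?thesis by (rule Lim_transform_eventually[rotated])
  qed
  have "((\<lambda>R. integral {0..R} (\<lambda>t. Re (1 / (U t * W t ^ Suc k)))) \<longlongrightarrow> \<rho> ^ Suc k * pi / A) at_top" for k
  proof (induction k)
    case 0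
    have "((\<lambda>R. 1 / N * integral {0..R} (\<lambda>t. Re (1 / W t ^ Suc 0)) + \<rho> * integral {0..R} (\<lambda>t. Re (1 / (U t * W t ^ 0)))) \<longlongrightarrow> 1 / N * (pi / 2 / b) + \<rho> * (pi / 2 / A)) at_top"
      unfolding ReW power_0 mult_1_right ReU by (intro tendsto_intros arctan_int A b)
    moreover have "1 / N * (pi / 2 / b) + \<rho> * (pi / 2 / A) = \<rho> ^ Suc 0 * pi / A"
    proof -
      have "real n * 2 + real n * (real n * 2) = real n * (2 * N)" by (simp add: N algebra_simps)
      then show ?thesis using A n N0 by (simp add: b_def \<rho> field_simps)
    qed
    ultimately show ?case unfolding step by simp
  next
    case (Suc k)
    have "((\<lambda>R. 1 / N * integral {0..R} (\<lambda>t. Re (1 / W t ^ Suc (Suc k))) + \<rho> * integral {0..R} (\<lambda>t. Re (1 / (U t * W t ^ Suc k)))) \<longlongrightarrow> 1 / N * 0 + \<rho> * (\<rho> ^ Suc k * pi / A)) at_top"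
      by (intro tendsto_intros higher Suc.IH)
    then show ?case unfolding step[of _ "Suc k"] by (simp add: mult.assoc)
  qed
  from this[of "m - 1"] show ?thesis using m by (simp add: U_def W_def b_def)
qed

section \<open>The value at the extremal vector and its symmetries\<close>

lemma sqrt_quotient: "0 < x \<Longrightarrow> 0 < y \<Longrightarrow> sqrt (x / y) = x / sqrt (x * y)" for x y :: real
  by (simp add: real_sqrt_divide real_sqrt_mult field_simps)

lemma a_min_sum:
  fixes k :: "'m::finite"
  assumes n: "n \<ge> 1" and card: "CARD('m) = n + 1"
  shows "(\<Sum>j\<in>UNIV. (a_min n k :: real ^ 'm) $ j) = 0" and "norm (a_min n k :: real ^ 'm) = 1"
proof -
  define N m where "N = real n + 1" and "m = sqrt (real n * N)"
  have n0: "real n > 0" using n by simp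
  have N: "N > 0" by (simp add: N_def)
  have m: "m > 0" "m\<^sup>2 = real n * N" using n0 N by (auto simp: m_def)
  have ak: "sqrt (real n / (real n + 1)) = real n / m"
    using n0 N unfolding m_def N_def[symmetric] by (rule sqrt_quotient)
  have comp: "(a_min n k :: real ^ 'm) $ j = (if j = k then real n / m else - 1 / m)" for j
    by (simp add: a_min_def ak) (simp add: m_def N_def)
  have split: "(\<Sum>j\<in>UNIV. g ((a_min n k :: real ^ 'm) $ j)) = g (real n / m) + real n * g (- 1 / m)" for g :: "real \<Rightarrow> real"
  proof -
    have "(\<Sum>j\<in>UNIV. g ((a_min n k :: real ^ 'm) $ j)) = g ((a_min n k :: real ^ 'm) $ k) + (\<Sum>j\<in>UNIV - {k}. g ((a_min n k :: real ^ 'm) $ j))"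
      by (rule sum.remove) auto
    also have "(\<Sum>j\<in>UNIV - {k}. g ((a_min n k :: real ^ 'm) $ j)) = (\<Sum>j\<in>UNIV - {k}. g (- 1 / m))"
      by (rule sum.cong) (auto simp: comp)
    also have "\<dots> = real n * g (- 1 / m)" using card by (simp add: card_Diff_singleton)
    finally show ?thesis by (simp add: comp)
  qed
  show "(\<Sum>j\<in>UNIV. (a_min n k :: real ^ 'm) $ j) = 0" using split[of "\<lambda>x. x"] by simp
  have "(norm (a_min n k :: real ^ 'm))\<^sup>2 = (\<Sum>j\<in>UNIV. ((a_min n k :: real ^ 'm) $ j)\<^sup>2)"
    unfolding power2_norm_eq_inner inner_vec_def by (simp add: power2_eq_square)
  also have "\<dots> = (real n / m)\<^sup>2 + real n * (- 1 / m)\<^sup>2" by (rule split)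
  also have "\<dots> = ((real n)\<^sup>2 + real n) / m\<^sup>2" by (simp add: power_divide add_divide_distrib)
  also have "(real n)\<^sup>2 + real n = m\<^sup>2" unfolding m(2) by (simp add: N_def power2_eq_square algebra_simps)
  also have "m\<^sup>2 / m\<^sup>2 = 1" using m(1) by simp
  finally have "(norm (a_min n k :: real ^ 'm))\<^sup>2 = 1\<^sup>2" by simp
  then show "norm (a_min n k :: real ^ 'm) = 1" by (rule power2_eq_imp_eq) auto
qed

text \<open>With rho = n / (n + 1) the coordinates are A = sqrt rho and n times - A / n. The
  two-factor integral is rho^n pi / A, and rho^n / A = rho^(n - 1/2) is the power in
  \<open>V_min\<close>.\<close>

lemma axis_value_a_min:
  fixes k :: "'m::finite"
  assumes n: "n \<ge> 1" and card: "CARD('m) = n + 1"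
  defines "b \<equiv> \<lambda>j. (a_min n k :: real ^ 'm) $ j"
  shows "sqrt (real n + 1) / fact (n - 1) * (centred_unit.axis_value b / pi) = V_min n"
proof -
  interpret B: centred_unit b n
    unfolding b_def by (rule V_eq_axis_value(1)[OF card n a_min_sum(2,1)[OF n card]])
  define A \<rho> where "A = sqrt (real n / (real n + 1))" and "\<rho> = real n / (real n + 1)"
  have n0: "real n > 0" using n by simp
  have \<rho>: "\<rho> > 0" using n0 by (simp add: \<rho>_def)
  have A: "A > 0" using \<rho> by (simp add: A_def \<rho>_def)
  have An: "1 / sqrt (real n * (real n + 1)) = A / real n"
    using n0 sqrt_quotient[of "real n" "real n + 1"] by (simp add: A_def)
  have bj: "b j = (if j = k then A else - (A / real n))" for j
    unfolding b_def a_min_def An[symmetric] by (simp add: A_def)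
  have "(\<Prod>j\<in>UNIV. 1 - of_real (b j) * (\<i> * of_real t)) = (1 - \<i> * of_real (A * t)) * (1 + \<i> * of_real (A / real n * t)) ^ n" for t
  proof -
    have "(\<Prod>j\<in>UNIV. 1 - of_real (b j) * (\<i> * of_real t)) = (1 - of_real (b k) * (\<i> * of_real t)) * (\<Prod>j\<in>UNIV - {k}. 1 - of_real (b j) * (\<i> * of_real t))"
      by (rule prod.remove) auto
    also have "(\<Prod>j\<in>UNIV - {k}. 1 - of_real (b j) * (\<i> * of_real t)) = (\<Prod>j\<in>UNIV - {k}. 1 + \<i> * of_real (A / real n * t))"
      by (rule prod.cong) (auto simp: bj)
    also have "\<dots> = (1 + \<i> * of_real (A / real n * t)) ^ n" using card by (simp add: card_Diff_singleton)
    finally show ?thesis by (simp add: bj mult_ac)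
  qed
  then have cf: "B.char_fun (\<i> * of_real t) = 1 / ((1 - \<i> * of_real (A * t)) * (1 + \<i> * of_real (A / real n * t)) ^ n)" for t
    by (simp only: B.char_fun_def)
  have "((\<lambda>R. integral {0..R} (\<lambda>t. Re (B.char_fun (\<i> * of_real t)))) \<longlongrightarrow> \<rho> ^ n * pi / A) at_top"
    unfolding cf using A n by (intro axis_integral_two_factor[OF _ _ refl]) (auto simp: \<rho>_def)
  then have "B.axis_value = \<rho> ^ n * pi / A"
    by (rule tendsto_unique[OF trivial_limit_at_top_linorder B.axis_value_limit])
  moreover have "\<rho> powr (real n - 1 / 2) = \<rho> ^ n / A"
    using \<rho> by (simp add: powr_diff powr_realpow powr_half_sqrt A_def \<rho>_def)
  ultimately show ?thesis by (simp add: V_min_def \<rho>_def)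
qed

text \<open>A permutation reorders the factors; a change of sign replaces t by - t, which conjugates
  \<open>char_fun\<close> and keeps its real part.\<close>

lemma axis_value_signed_permutation:
  fixes a b :: "'m::finite \<Rightarrow> real"
  assumes A: "centred_unit a n" and B: "centred_unit b n"
    and \<pi>: "\<pi> permutes UNIV" and s: "s \<in> {1, -1}" and ab: "\<And>j. a j = s * b (\<pi> j)"
  shows "centred_unit.axis_value a = centred_unit.axis_value b"
proof -
  interpret A: centred_unit a n by (rule A)
  interpret B: centred_unit b n by (rule B)
  have "A.char_fun (\<i> * of_real t) = B.char_fun (\<i> * of_real (s * t))" for t
  proof -
    have "(\<Prod>j\<in>UNIV. 1 - of_real (a j) * (\<i> * of_real t)) = (\<Prod>j\<in>UNIV. 1 - of_real (b (\<pi> j)) * (\<i> * of_real (s * t)))"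
      by (simp add: ab mult_ac)
    also have "\<dots> = (\<Prod>j\<in>UNIV. 1 - of_real (b j) * (\<i> * of_real (s * t)))"
      using prod.permute[OF \<pi>, of "\<lambda>j. 1 - of_real (b j) * (\<i> * of_real (s * t))"] by (simp only: o_def)
    finally show ?thesis by (simp only: A.char_fun_def B.char_fun_def)
  qed
  moreover have "Re (B.char_fun (\<i> * of_real (s * t))) = Re (B.char_fun (\<i> * of_real t))" for t
    using s B.char_fun_cnj[of t] by auto
  ultimately show ?thesis by (simp only: A.axis_value_def B.axis_value_def)
qed

theorem theorem1:
  fixes n :: nat and a :: "real ^ 'm" and k :: 'm
  assumes "n \<ge> 1" and "CARD('m) = n + 1"
    and "norm a = 1" and "(\<Sum>j\<in>UNIV. a $ j) = 0"
  shows "V a \<ge> V_min n \<and>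
    (V a = V_min n \<longleftrightarrow>
      (\<exists>\<pi> s. \<pi> permutes (UNIV :: 'm set) \<and> s \<in> {1, -1 :: real} \<and>
        (\<forall>j. a $ j = s * a_min n k $ \<pi> j)))"
proof -
  define b where "b = (\<lambda>j. (a_min n k :: real ^ 'm) $ j)"
  define c where "c = sqrt (real n + 1) / fact (n - 1)"
  have c: "c > 0" by (simp add: c_def)
  have A: "centred_unit (\<lambda>j. a $ j) n"
    and Va: "V a = c * (centred_unit.axis_value (\<lambda>j. a $ j) / pi)"
    using V_eq_axis_value[OF assms(2,1,3,4)] by (simp_all only: c_def)
  have B: "centred_unit b n"
    unfolding b_def by (rule V_eq_axis_value(1)[OF assms(2,1) a_min_sum(2,1)[OF assms(1,2)]])
  have Vb: "V_min n = c * (centred_unit.axis_value b / pi)"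
    unfolding c_def b_def by (rule axis_value_a_min[OF assms(1,2), symmetric])
  have ext: "centred_unit.drift b n z = of_real ((real n - 1) / sqrt (real n * (real n + 1))) - 1 / z" if "Im z > 0" for z
    by (rule centred_unit.drift_extremal[OF B that, of k]) (auto simp: b_def a_min_def)
  note ext = axis_integral_extremal[OF A B ext centred_unit.axis_value_limit[OF A] centred_unit.axis_value_limit[OF B]]
  have "V a = V_min n \<longleftrightarrow> centred_unit.axis_value (\<lambda>j. a $ j) = centred_unit.axis_value b"
    unfolding Va Vb using c by simp
  also have "\<dots> \<longleftrightarrow> (\<exists>\<pi> s. \<pi> permutes (UNIV :: 'm set) \<and> s \<in> {1, -1 :: real} \<and> (\<forall>j. a $ j = s * b (\<pi> j)))"
    using ext(2) axis_value_signed_permutation[OF A B] by blast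
  finally have "V a = V_min n \<longleftrightarrow> (\<exists>\<pi> s. \<pi> permutes (UNIV :: 'm set) \<and> s \<in> {1, -1 :: real} \<and> (\<forall>j. a $ j = s * b (\<pi> j)))" .
  moreover have "V a \<ge> V_min n"
    unfolding Va Vb using c ext(1) by (intro mult_left_mono divide_right_mono) auto
  ultimately show ?thesis by (simp only: b_def)
qed

end
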